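(* Let $q>3$ be a power of an odd prime $p$, $K$ an algebraic closure of $\mathbb{F}_q$, and $\lambda\in K\setminus\{1,-1\}$. Let $\mathcal X$ be a nonsingular model of the (irreducible) plane curve with affine equation $$(X+Y)^{q+1}-2((XY)^{q}+XY)-\lambda(X-Y)^{q+1}=0,$$ with function field $K(x,y)$. Let $H$ be the group of automorphisms of $K(x,y)$ generated by $(x,y)\mapsto(x+\alpha,y+\alpha)$ ($\alpha\in\mathbb{F}_q$), $(x,y)\mapsto(\mu x,\mu y)$ ($\mu\in\mathbb{F}_q^*$) and $(x,y)\mapsto(x^{-1},y^{-1})$, and let $\Phi:(x,y)\mapsto(y,x)$. Then $\mathrm{Aut}(\mathcal X)=H\times\langle\Phi\rangle$. In particular, $\mathrm{Aut}(\mathcal X)\cong\mathrm{PGL}(2,q)\times C_2$, of order $2(q^3-q)$.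
   Context: $\mathrm{Aut}(\mathcal X)$ is the group of automorphisms of the function field $K(x,y)$ fixing $K$ elementwise; the listed maps are automorphisms of this field, $H\cong\mathrm{PGL}(2,q)$ and $\Phi$ centralizes $H$. *)

theory Defs
  imports "HOL-Computational_Algebra.Polynomial" "HOL-Computational_Algebra.Fraction_Field"
begin

(* Bivariate polynomials K[X,Y] are encoded as 'a poly poly: outer variable Y, inner variable X. *)
definition Xp :: "'a::comm_ring_1 poly poly" where "Xp = [:[:0, 1:]:]"
definition Yp :: "'a::comm_ring_1 poly poly" where "Yp = [:0, 1:]"
definition cst :: "'a::comm_ring_1 \<Rightarrow> 'a poly poly" where "cst c = [:[:c:]:]"

definition curveF :: "nat \<Rightarrow> 'a::comm_ring_1 \<Rightarrow> 'a poly poly" where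
  "curveF q lam = (Xp + Yp) ^ (q + 1) - 2 * ((Xp * Yp) ^ q + Xp * Yp) - cst lam * (Xp - Yp) ^ (q + 1)"

definition tf :: "'a::idom poly \<Rightarrow> 'a poly fract" where "tf g = Fract g 1"

definition Fy :: "nat \<Rightarrow> 'a::field \<Rightarrow> 'a poly fract poly" where
  "Fy q lam = map_poly tf (curveF q lam)"

(* Function field K(x,y) = K(X)[Y]/(F), elements = reduced representatives *)
definition FF :: "nat \<Rightarrow> 'a::field \<Rightarrow> 'a poly fract poly set" where
  "FF q lam = {r. degree r < degree (Fy q lam)}"

definition fmul :: "nat \<Rightarrow> 'a::field \<Rightarrow> 'a poly fract poly \<Rightarrow> 'a poly fract poly \<Rightarrow> 'a poly fract poly" where
  "fmul q lam r s = (r * s) mod Fy q lam"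

definition kc :: "'a::field \<Rightarrow> 'a poly fract poly" where "kc c = [:tf [:c:]:]"

definition xf :: "'a::field poly fract poly" where "xf = [:tf [:0, 1:]:]"
definition yf :: "'a::field poly fract poly" where "yf = [:0, 1:]"

definition Aut :: "nat \<Rightarrow> 'a::field \<Rightarrow> ('a poly fract poly \<Rightarrow> 'a poly fract poly) set" where
  "Aut q lam = {\<sigma>. bij_betw \<sigma> (FF q lam) (FF q lam)
     \<and> (\<forall>r\<in>FF q lam. \<forall>s\<in>FF q lam. \<sigma> (r + s) = \<sigma> r + \<sigma> s)
     \<and> (\<forall>r\<in>FF q lam. \<forall>s\<in>FF q lam. \<sigma> (fmul q lam r s) = fmul q lam (\<sigma> r) (\<sigma> s))
     \<and> (\<forall>c. \<sigma> (kc c) = kc c)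
     \<and> (\<forall>r. r \<notin> FF q lam \<longrightarrow> \<sigma> r = r)}"

definition Fq :: "nat \<Rightarrow> 'a::field set" where "Fq q = {a. a ^ q = a}"

definition Hgens :: "nat \<Rightarrow> 'a::field \<Rightarrow> ('a poly fract poly \<Rightarrow> 'a poly fract poly) set" where
  "Hgens q lam = {\<sigma> \<in> Aut q lam.
      (\<exists>\<alpha>\<in>Fq q. \<sigma> xf = xf + kc \<alpha> \<and> \<sigma> yf = yf + kc \<alpha>)
    \<or> (\<exists>\<mu>\<in>Fq q - {0}. \<sigma> xf = kc \<mu> * xf \<and> \<sigma> yf = kc \<mu> * yf)
    \<or> (fmul q lam (\<sigma> xf) xf = 1 \<and> fmul q lam (\<sigma> yf) yf = 1)}"

definition inv_aut :: "nat \<Rightarrow> 'a::field \<Rightarrow> ('a poly fract poly \<Rightarrow> 'a poly fract poly) \<Rightarrow> ('a poly fract poly \<Rightarrow> 'a poly fract poly)" where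
  "inv_aut q lam \<sigma> = (\<lambda>r. if r \<in> FF q lam then inv_into (FF q lam) \<sigma> r else r)"

inductive_set Hgrp :: "nat \<Rightarrow> 'a::field \<Rightarrow> ('a poly fract poly \<Rightarrow> 'a poly fract poly) set"
  for q :: nat and lam :: 'a where
  Hid: "id \<in> Hgrp q lam"
| Hgen: "g \<in> Hgens q lam \<Longrightarrow> h \<in> Hgrp q lam \<Longrightarrow> g \<circ> h \<in> Hgrp q lam"
| Hinv: "g \<in> Hgens q lam \<Longrightarrow> h \<in> Hgrp q lam \<Longrightarrow> inv_aut q lam g \<circ> h \<in> Hgrp q lam"

end

(* Up to a factor -1 the equation reads (1+lam)(x^q-x)(y^q-y) + (1-lam)(x^q-y)(y^q-x) = 0: the
   cross-ratio of x, y, x^q, y^q is constant. The curve has bidegree (q+1,q+1) on P^1 x P^1, and its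
   only singularities are nodes at the q+1 points (a,a), a in P^1(F_q). For j, k <= q-2 the adjoint
   differentials (x-y) x^j y^k dx/F_y are therefore regular. Their images under an automorphism s are
   again regular, hence have trace zero over K(x). Over a generic value of x this is a linear relation
   with nonzero coefficients between the values of all forms of bidegree (q-2,q-2) at the q+1 distinct
   points (s(x),s(y)). For q > 3 such points must lie on a line of one of the two rulings, so s(x) or
   s(y) lies in K(x). Composing with the swap we may assume that s(x) does; as the same applies to the
   inverse of s and to the conjugate of s by the swap, s acts on x and on y by Moebius
   transformations. Comparing coefficients, a pair of Moebius transformations preserving the
   cross-ratio equation consists of twice the same element of PGL(2,q). *)

theory Submission
  imports Defs "HOL-Computational_Algebra.Computational_Algebra"
begin

text \<open>Places are replaced by pairs of Laurent series solving the equation, and every local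
  condition is decided by orders of series. The factor x - y is chosen because all nodes lie on the
  diagonal: adjoint forms have bidegree (q-1, q-1), and x - y uses up one degree in each variable.
  The trace vanishes because regularity of f dx makes f F_y a polynomial of degree at most q - 1 in
  y, while a fibre has q + 1 points; this is exactly the range of Euler's formula. The nodes and the
  points at infinity are where this bound costs work. The relation between the points is read over x
  = x0 + t with x0 outside F_q, where the fibre consists of q + 1 power series; s(x) is represented
  by a polynomial of degree at most q in y, so a common value on the fibre makes it constant in y.
  Irreducibility, which makes the quotient a field, rests on the branch of a node along which x - a
  has order q in y - a: a factor vanishing there has degree at least q in y, and no factor is
  linear.\<close>

unbundle fps_syntax
notation fls_nth (infixl "$$" 75)

section \<open>Polynomials and fractions over a field\<close>

lemma poly_map_poly_add:
  fixes f :: "'b::comm_ring_1 \<Rightarrow> 'c::comm_ring_1"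
  assumes f0: "f 0 = 0" and fadd: "\<And>a b. f (a + b) = f a + f b"
  shows "poly (map_poly f (p + r)) y = poly (map_poly f p) y + poly (map_poly f r) y"
proof -
  have "map_poly f (p + r) = map_poly f p + map_poly f r"
    by (intro poly_eqI) (simp add: coeff_map_poly f0 fadd)
  thus ?thesis by simp
qed

lemma poly_map_poly_mult:
  fixes f :: "'b::comm_ring_1 \<Rightarrow> 'c::comm_ring_1"
  assumes f0: "f 0 = 0" and fadd: "\<And>a b. f (a + b) = f a + f b"
    and fmult: "\<And>a b. f (a * b) = f a * f b"
  shows "poly (map_poly f (p * r)) y = poly (map_poly f p) y * poly (map_poly f r) y"
proof (induction p)
  case (pCons a p)
  have "poly (map_poly f (smult a r)) y = f a * poly (map_poly f r) y"
    by (simp add: map_poly_smult f0 fmult)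
  with pCons show ?case
    by (simp add: poly_map_poly_add[OF f0 fadd] map_poly_pCons f0 algebra_simps)
qed simp

lemma card_roots_separable:
  fixes P :: "'a::field poly"
  assumes alg: "\<forall>P :: 'a poly. degree P > 0 \<longrightarrow> (\<exists>z. poly P z = 0)"
    and "P \<noteq> 0" and "\<And>z. poly P z = 0 \<Longrightarrow> poly (pderiv P) z \<noteq> 0"
  shows "card {z. poly P z = 0} = degree P"
  using assms(2,3)
proof (induction "degree P" arbitrary: P)
  case 0
  then show ?case by (auto elim!: degree_eq_zeroE)
next
  case (Suc n)
  then obtain z where z: "poly P z = 0" using alg by force
  then obtain Q where Q: "P = [:-z, 1:] * Q" by (auto simp: poly_eq_0_iff_dvd dvd_def)
  have Q0: "Q \<noteq> 0" using Suc Q by auto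
  have dP: "degree P = Suc (degree Q)" using Q0 by (subst Q, subst degree_mult_eq) auto
  have pdP: "poly (pderiv P) w = poly Q w + (w - z) * poly (pderiv Q) w" for w
    unfolding Q pderiv_mult by (simp add: pderiv_pCons algebra_simps)
  have "poly Q z \<noteq> 0" using Suc(4)[OF z] pdP[of z] by simp
  moreover have "{w. poly P w = 0} = insert z {w. poly Q w = 0}" by (auto simp: Q)
  moreover have "card {w. poly Q w = 0} = degree Q"
  proof (rule Suc(1))
    show "n = degree Q" using dP Suc(2) by simp
    show "poly (pderiv Q) w \<noteq> 0" if "poly Q w = 0" for w
      using Suc(4)[of w] pdP[of w] that Q by auto
  qed fact
  ultimately show ?case using Q0 dP by (simp add: poly_roots_finite)
qed

text \<open>A denominator of least degree works: a common root could be cancelled.\<close>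

lemma Fract_no_common_root:
  fixes r :: "'a::field poly fract"
  obtains n d where "d \<noteq> 0" "r = Fract n d" "\<And>z. \<not> (poly n z = 0 \<and> poly d z = 0)"
proof -
  have "\<exists>k n d. d \<noteq> 0 \<and> r = Fract n d \<and> degree d = k"
    by (cases r) auto
  then obtain k n d where nd: "d \<noteq> 0" "r = Fract n d" "degree d = k"
    and mn: "\<And>k'. k' < k \<Longrightarrow> \<not> (\<exists>n d. d \<noteq> 0 \<and> r = Fract n d \<and> degree d = k')"
    using exists_least_iff[of "\<lambda>k. \<exists>n d. d \<noteq> 0 \<and> r = Fract n d \<and> degree d = k"] by auto
  have "\<not> (poly n z = 0 \<and> poly d z = 0)" for z
  proof
    assume "poly n z = 0 \<and> poly d z = 0"
    then obtain n' d' where *: "n = [:-z, 1:] * n'" "d = [:-z, 1:] * d'"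
      by (auto simp: poly_eq_0_iff_dvd dvd_def)
    have d': "d' \<noteq> 0" using nd * by auto
    have "r = Fract n' d'" unfolding nd(2) * by (rule mult_fract_cancel) auto
    moreover have "degree d = Suc (degree d')" using d' by (subst *(2), subst degree_mult_eq) auto
    ultimately show False using mn[of "degree d'"] d' nd by auto
  qed
  thus ?thesis using nd that by blast
qed

lemma tf_0 [simp]: "tf 0 = 0" and tf_1 [simp]: "tf 1 = 1"
  by (simp_all add: tf_def fract_collapse)

lemma tf_add: "tf (a + b) = tf a + tf b" and tf_mult: "tf (a * b) = tf a * tf b"
  and tf_uminus: "tf (- a) = - tf a" and tf_diff: "tf (a - b) = tf a - tf b"
  by (simp_all add: tf_def)

lemma tf_eq_iff [simp]: "tf a = tf b \<longleftrightarrow> a = b"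
  by (simp add: tf_def eq_fract)

lemma tf_eq_0_iff [simp]: "tf a = 0 \<longleftrightarrow> a = 0"
  using tf_eq_iff[of a 0] by (simp del: tf_eq_iff)

lemma Fract_eq_tf_div: "b \<noteq> 0 \<Longrightarrow> Fract a b = tf a / tf b"
  by (simp add: tf_def)

section \<open>Laurent series of bounded order\<close>

text \<open>Order at least \<open>n\<close>. Coefficients are used because
  \<open>fls_subdegree 0 = 0\<close>, whereas the zero series must count as having every
  order.\<close>

definition ge :: "int \<Rightarrow> 'a::field fls \<Rightarrow> bool" where
  "ge n w \<longleftrightarrow> (\<forall>i<n. w $$ i = 0)"

lemma ge_iff: "ge n w \<longleftrightarrow> w = 0 \<or> n \<le> fls_subdegree w"
proof
  assume "ge n w" thus "w = 0 \<or> n \<le> fls_subdegree w"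
    unfolding ge_def by (metis fls_subdegree_geI)
qed (auto simp: ge_def)

lemma ge_add: "ge n w \<Longrightarrow> ge n v \<Longrightarrow> ge n (w + v)" by (simp add: ge_def)
lemma ge_diff: "ge n w \<Longrightarrow> ge n v \<Longrightarrow> ge n (w - v)" by (simp add: ge_def)
lemma ge_uminus: "ge n w \<Longrightarrow> ge n (- w)" by (simp add: ge_def)
lemma ge_0 [simp]: "ge n 0" by (simp add: ge_def)
lemma ge_mono: "ge n w \<Longrightarrow> m \<le> n \<Longrightarrow> ge m w" by (simp add: ge_def)

lemma ge_mult: "ge n w \<Longrightarrow> ge m v \<Longrightarrow> ge (n + m) (w * v)"
  by (cases "w = 0 \<or> v = 0") (auto simp: ge_iff)

lemma ge_mult0: "ge n w \<Longrightarrow> ge 0 v \<Longrightarrow> ge n (w * v)"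
  using ge_mult[of n w 0 v] by simp

lemma ge_mult0': "ge 0 w \<Longrightarrow> ge n v \<Longrightarrow> ge n (w * v)"
  using ge_mult[of 0 w n v] by simp

lemma ge_const [simp]: "ge 0 (fls_const c)" by (simp add: ge_def)
lemma ge_one [simp]: "ge 0 1" by (simp add: ge_def)
lemma ge_numeral [simp]: "ge 0 (numeral k)" by (simp add: ge_def)
lemma ge_X [simp]: "ge 1 fls_X" by (simp add: ge_def)
lemma ge_fps [simp]: "ge 0 (fps_to_fls f)" by (simp add: ge_def)

lemma ge_power: "ge n w \<Longrightarrow> ge (int k * n) (w ^ k)"
proof (induction k)
  case (Suc k)
  thus ?case using ge_mult[of n w "int k * n" "w ^ k"] by (simp add: algebra_simps)
qed simp

lemma ge_power0: "ge 0 w \<Longrightarrow> ge 0 (w ^ k)" using ge_power[of 0 w k] by simp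

lemma ge_X_power [simp]: "ge (int k) (fls_X ^ k)"
  by (simp add: ge_def)

lemma ge_deriv: "ge 0 w \<Longrightarrow> ge 0 (fls_deriv w)"
  unfolding ge_def
proof safe
  fix i :: int assume w: "\<forall>i<0. w $$ i = 0" and i: "i < 0"
  show "fls_deriv w $$ i = 0"
    using w i by (cases "i = -1") auto
qed

lemma ge_inverse: "fls_subdegree w \<le> - n \<Longrightarrow> ge n (inverse w)"
  by (simp add: ge_iff)

lemma ge_divide: "ge n w \<Longrightarrow> ge (n - fls_subdegree v) (w / v)"
  unfolding divide_inverse using ge_mult[of n w "- fls_subdegree v" "inverse v"]
  by (simp add: ge_inverse)

lemma nth_mult_0: "ge 0 w \<Longrightarrow> ge 0 v \<Longrightarrow> (w * v) $$ 0 = w $$ 0 * v $$ 0"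
proof -
  assume w: "ge 0 w" and v: "ge 0 v"
  show ?thesis
  proof (cases "w = 0 \<or> v = 0")
    case False
    hence sd: "fls_subdegree w \<ge> 0" "fls_subdegree v \<ge> 0" using w v by (auto simp: ge_iff)
    show ?thesis
    proof (cases "fls_subdegree w = 0 \<and> fls_subdegree v = 0")
      case True thus ?thesis using fls_times_base[of w v] by simp
    next
      case F: False
      hence "fls_subdegree (w * v) > 0" using sd False by auto
      hence "(w * v) $$ 0 = 0" by simp
      moreover have "w $$ 0 = 0 \<or> v $$ 0 = 0" using F sd by auto
      ultimately show ?thesis by auto
    qed
  qed auto
qed

lemma nth_power_0: "ge 0 w \<Longrightarrow> (w ^ k) $$ 0 = (w $$ 0) ^ k"
  by (induction k) (auto simp: nth_mult_0 ge_power0)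

lemma ge_1_iff: "ge 1 w \<longleftrightarrow> ge 0 w \<and> w $$ 0 = 0"
proof -
  have "i < 1 \<longleftrightarrow> i < 0 \<or> i = 0" for i :: int by auto
  thus ?thesis unfolding ge_def by auto
qed

lemma ge_cancel_X_power: "ge (n + int k) (fls_X ^ k * w) \<Longrightarrow> ge n w"
  by (cases "w = 0") (auto simp: ge_iff)

lemma ge_pos_imp_0: "ge n w \<Longrightarrow> n > 0 \<Longrightarrow> w $$ 0 = 0"
  by (simp add: ge_def)

lemma ge_div_unit:
  assumes "ge 0 w" "ge 0 v" "v $$ 0 \<noteq> 0"
  shows "ge 0 (w / v)"
proof -
  have "fls_subdegree v = 0"
    using assms(2,3) by (intro fls_subdegree_eqI) (auto simp: ge_def)
  thus ?thesis using ge_divide[OF assms(1), of v] by simp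
qed

section \<open>Evaluation at Laurent series\<close>

definition evp :: "'a::field poly \<Rightarrow> 'a fls \<Rightarrow> 'a fls" where
  "evp p x = poly (map_poly fls_const p) x"

lemma evp_0 [simp]: "evp 0 x = 0" by (simp add: evp_def)
lemma evp_pCons: "evp (pCons c p) x = fls_const c + x * evp p x"
  by (simp add: evp_def map_poly_pCons)
lemma evp_1 [simp]: "evp 1 x = 1" by (simp add: one_pCons evp_pCons)
lemma evp_const: "evp [:c:] x = fls_const c" by (simp add: evp_pCons)
lemma evp_add: "evp (p + r) x = evp p x + evp r x"
  unfolding evp_def by (rule poly_map_poly_add) (auto simp: fls_plus_const)
lemma evp_mult: "evp (p * r) x = evp p x * evp r x"
  unfolding evp_def by (rule poly_map_poly_mult) (auto simp: fls_plus_const)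
lemma evp_X: "evp [:0,1:] x = x" by (simp add: evp_pCons)
lemma evp_uminus: "evp (- p) x = - evp p x"
  using evp_add[of p "-p" x] by (simp add: eq_neg_iff_add_eq_0 add.commute)
lemma evp_diff: "evp (p - r) x = evp p x - evp r x"
  using evp_add[of p "-r" x] by (simp add: evp_uminus)
lemma evp_power: "evp (p ^ n) x = evp p x ^ n"
  by (induction n) (auto simp: evp_mult)
lemma evp_smult: "evp (smult c p) x = fls_const c * evp p x"
  using evp_mult[of "[:c:]" p x] by (simp add: evp_const)
lemma ge_evp: "ge 0 x \<Longrightarrow> ge 0 (evp p x)"
  by (induction p) (auto simp: evp_pCons intro!: ge_add ge_mult0)

lemma evp_nth_0: "ge 0 x \<Longrightarrow> evp p x $$ 0 = poly p (x $$ 0)"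
  by (induction p) (auto simp: evp_pCons nth_mult_0 ge_evp)

definition transc :: "'a::field fls \<Rightarrow> bool" where
  "transc x \<longleftrightarrow> (\<forall>p. p \<noteq> 0 \<longrightarrow> evp p x \<noteq> 0)"

text \<open>An annihilating polynomial splits into linear factors, and none of them vanishes at a
  nonconstant series.\<close>

lemma transcI:
  fixes x :: "'a::field fls"
  assumes alg: "\<forall>P :: 'a poly. degree P > 0 \<longrightarrow> (\<exists>z. poly P z = 0)"
    and x: "x \<notin> range fls_const"
  shows "transc x"
  unfolding transc_def
proof safe
  fix p :: "'a poly" assume "p \<noteq> 0" "evp p x = 0"
  thus False
  proof (induction "degree p" arbitrary: p)
    case 0 thus ?case by (auto elim!: degree_eq_zeroE simp: evp_const)
  next
    case (Suc n)
    then obtain z where z: "poly p z = 0" using alg by force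
    then obtain r where r: "p = [:-z, 1:] * r" by (auto simp: poly_eq_0_iff_dvd dvd_def)
    have r0: "r \<noteq> 0" using Suc r by auto
    have "degree p = Suc (degree r)" using r0 by (subst r, subst degree_mult_eq) auto
    moreover have "x - fls_const z \<noteq> 0" using x by auto
    moreover have "evp p x = (x - fls_const z) * evp r x"
      unfolding r evp_mult by (simp add: evp_pCons)
    ultimately show ?case using Suc r0 by auto
  qed
qed

lemma transc_not_const: "transc x \<Longrightarrow> x \<noteq> fls_const c"
proof
  assume "transc x" "x = fls_const c"
  moreover have "evp [:-c, 1:] x = x - fls_const c" by (simp add: evp_pCons)
  moreover have "[:-c, 1:] \<noteq> 0" by simp
  ultimately show False unfolding transc_def by (metis right_minus_eq)
qed

lemma transc_nonzero: "transc x \<Longrightarrow> x \<noteq> 0"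
  using transc_not_const[of x 0] by simp

lemma transc_evp_eq_0: "transc x \<Longrightarrow> evp p x = 0 \<longleftrightarrow> p = 0"
  unfolding transc_def by auto

lemma transc_evp_eq: "transc x \<Longrightarrow> evp p x = evp r x \<longleftrightarrow> p = r"
  using transc_evp_eq_0[of x "p - r"] by (simp add: evp_diff)

text \<open>The choice of the fraction is immaterial once \<open>x\<close> is transcendental, since
  then no denominator vanishes; see \<open>evf_Fract\<close>.\<close>

definition evf :: "'a::field poly fract \<Rightarrow> 'a fls \<Rightarrow> 'a fls" where
  "evf r x = (SOME w. \<exists>a b. b \<noteq> 0 \<and> r = Fract a b \<and> w = evp a x / evp b x)"

lemma evf_Fract:
  assumes x: "transc x" and b: "b \<noteq> 0"
  shows "evf (Fract a b) x = evp a x / evp b x"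
  unfolding evf_def
proof (rule some_equality)
  fix w assume "\<exists>c d. d \<noteq> 0 \<and> Fract a b = Fract c d \<and> w = evp c x / evp d x"
  then obtain c d where d: "d \<noteq> 0" "Fract a b = Fract c d" "w = evp c x / evp d x" by blast
  have "a * d = c * b" using d b by (simp add: eq_fract)
  hence "evp a x * evp d x = evp c x * evp b x" by (metis evp_mult)
  moreover have "evp b x \<noteq> 0" "evp d x \<noteq> 0" using x b d by (auto simp: transc_evp_eq_0)
  ultimately show "w = evp a x / evp b x" using d by (simp add: frac_eq_eq)
qed (use b in blast)

lemma evf_tf: "transc x \<Longrightarrow> evf (tf a) x = evp a x"
  by (simp add: tf_def evf_Fract)

lemma evf_0: "transc x \<Longrightarrow> evf 0 x = 0" using evf_tf[of x 0] by simp

lemma evf_add: "transc x \<Longrightarrow> evf (r + s) x = evf r x + evf s x"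
proof -
  assume x: "transc x"
  obtain a b where r: "r = Fract a b" "b \<noteq> 0" by (cases r) auto
  obtain c d where s: "s = Fract c d" "d \<noteq> 0" by (cases s) auto
  have "evp b x \<noteq> 0" "evp d x \<noteq> 0" using x r s by (auto simp: transc_evp_eq_0)
  thus ?thesis using r s x by (simp add: evf_Fract evp_add evp_mult add_frac_eq)
qed

lemma evf_mult: "transc x \<Longrightarrow> evf (r * s) x = evf r x * evf s x"
proof -
  assume x: "transc x"
  obtain a b where r: "r = Fract a b" "b \<noteq> 0" by (cases r) auto
  obtain c d where s: "s = Fract c d" "d \<noteq> 0" by (cases s) auto
  show ?thesis using r s x by (simp add: evf_Fract evp_mult)
qed

lemma evf_eq_0: "transc x \<Longrightarrow> evf r x = 0 \<longleftrightarrow> r = 0"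
proof -
  assume x: "transc x"
  obtain a b where r: "r = Fract a b" "b \<noteq> 0" by (cases r) auto
  have "r = 0 \<longleftrightarrow> a = 0" using r by (simp add: Fract_eq_tf_div)
  thus ?thesis using r x by (simp add: evf_Fract transc_evp_eq_0)
qed

definition evr :: "'a::field poly fract poly \<Rightarrow> 'a fls \<Rightarrow> 'a fls \<Rightarrow> 'a fls" where
  "evr r x y = poly (map_poly (\<lambda>c. evf c x) r) y"

lemma evr_add: "transc x \<Longrightarrow> evr (r + s) x y = evr r x y + evr s x y"
  unfolding evr_def by (rule poly_map_poly_add) (auto simp: evf_0 evf_add)
lemma evr_mult: "transc x \<Longrightarrow> evr (r * s) x y = evr r x y * evr s x y"
  unfolding evr_def by (rule poly_map_poly_mult) (auto simp: evf_0 evf_add evf_mult)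
lemma evr_0: "evr 0 x y = 0" by (simp add: evr_def)
lemma evr_pCons: "transc x \<Longrightarrow> evr (pCons c r) x y = evf c x + y * evr r x y"
  by (simp add: evr_def map_poly_pCons evf_0)
lemma evr_kc: "transc x \<Longrightarrow> evr (kc c) x y = fls_const c"
  by (simp add: kc_def evr_pCons evr_0 evf_tf evp_const)
lemma evr_xf: "transc x \<Longrightarrow> evr xf x y = x"
  by (simp add: xf_def evr_pCons evr_0 evf_tf evp_X)
lemma evr_yf: "transc x \<Longrightarrow> evr yf x y = y"
  by (simp add: yf_def evr_pCons evr_0 evf_0 evf_tf[of x 1, simplified])

text \<open>The version of \<open>evr\<close> without denominators: it preserves integrality and
  commutes with taking constant terms.\<close>

definition ev2 :: "'a::field poly poly \<Rightarrow> 'a fls \<Rightarrow> 'a fls \<Rightarrow> 'a fls" where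
  "ev2 P x y = poly (map_poly (\<lambda>c. evp c x) P) y"

lemma ev2_0 [simp]: "ev2 0 x y = 0" by (simp add: ev2_def)
lemma ev2_pCons: "ev2 (pCons c P) x y = evp c x + y * ev2 P x y"
  by (simp add: ev2_def map_poly_pCons)
lemma ge_ev2: "ge 0 x \<Longrightarrow> ge 0 y \<Longrightarrow> ge 0 (ev2 P x y)"
  by (induction P) (auto simp: ev2_pCons intro!: ge_add ge_mult0 ge_evp)

lemma ev2_nth_0:
  assumes "ge 0 x" "ge 0 y"
  shows "ev2 P x y $$ 0 = poly (map_poly (\<lambda>c. poly c (x $$ 0)) P) (y $$ 0)"
proof (induction P)
  case (pCons c P)
  show ?case
    by (simp add: ev2_pCons map_poly_pCons evp_nth_0 nth_mult_0 ge_ev2 assms pCons.IH)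
qed simp

section \<open>A fixed point theorem for power series\<close>

text \<open>Banach's theorem for the X-adic metric. The limit is written down coefficientwise:
  coefficient \<open>i\<close> of the iterates is stable from step \<open>Suc i\<close> on.\<close>

lemma fps_fixed_point:
  fixes T :: "'a::field fps \<Rightarrow> 'a fps"
  assumes T: "\<And>k Y Z. fps_X ^ k dvd Y - Z \<Longrightarrow> fps_X ^ Suc k dvd T Y - T Z"
  shows "\<exists>Y. T Y = Y"
proof -
  have eqn: "fps_X ^ k dvd Y - Z \<longleftrightarrow> (\<forall>i<k. Y $ i = Z $ i)" for k and Y Z :: "'a fps"
  proof
    assume "fps_X ^ k dvd Y - Z"
    then obtain W where "Y - Z = fps_X ^ k * W" by (auto simp: dvd_def)
    hence "(Y - Z) $ i = 0" if "i < k" for i using that by (simp add: fps_X_power_mult_nth)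
    thus "\<forall>i<k. Y $ i = Z $ i" by simp
  next
    assume "\<forall>i<k. Y $ i = Z $ i"
    hence "Y - Z = fps_X ^ k * fps_shift k (Y - Z)"
      by (intro fps_ext) (simp add: fps_X_power_mult_nth)
    thus "fps_X ^ k dvd Y - Z" by (metis dvd_triv_left)
  qed
  define U where "U n = (T ^^ n) 0" for n
  have step: "\<forall>i<n. U n $ i = U (Suc n) $ i" for n
  proof (induction n)
    case (Suc n)
    have "fps_X ^ Suc n dvd T (U n) - T (U (Suc n))" using T[of n "U n" "U (Suc n)"] Suc eqn by blast
    thus ?case unfolding eqn by (simp add: U_def)
  qed simp
  have st: "\<forall>i<n. U n $ i = U (n + m) $ i" for n m
  proof (induction m)
    case (Suc m) thus ?case using step[of "n + m"] by auto
  qed simp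
  define Y where "Y = Abs_fps (\<lambda>i. U (Suc i) $ i)"
  have Yn: "\<forall>i<n. Y $ i = U n $ i" for n
  proof safe
    fix i assume "i < n"
    then obtain m where "n = Suc i + m" using less_iff_Suc_add by auto
    thus "Y $ i = U n $ i" using st[of "Suc i" m] by (simp add: Y_def)
  qed
  have "T Y $ i = Y $ i" for i
  proof -
    have "fps_X ^ Suc i dvd T Y - T (U i)" using T[of i Y "U i"] Yn[of i] eqn by blast
    hence "T Y $ i = U (Suc i) $ i" unfolding eqn by (simp add: U_def)
    thus ?thesis by (simp add: Y_def)
  qed
  thus ?thesis by (auto simp: fps_eq_iff)
qed

section \<open>The curve\<close>

definition Gf :: "nat \<Rightarrow> 'b::comm_ring_1 \<Rightarrow> 'b \<Rightarrow> 'b \<Rightarrow> 'b" where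
  "Gf q l x y = (1 - l) * (x * x ^ q + y * y ^ q) + (1 + l) * (x ^ q * y + x * y ^ q)
     - 2 * (x ^ q * y ^ q + x * y)"

definition Gy :: "nat \<Rightarrow> 'b::comm_ring_1 \<Rightarrow> 'b \<Rightarrow> 'b \<Rightarrow> 'b" where
  "Gy q l x y = (1 - l) * y ^ q + (1 + l) * x ^ q - 2 * x"

text \<open>\<open>Gf\<close> is the equation of the curve expanded by means of the Frobenius, \<open>Gy\<close> its partial derivative
  with respect to \<open>y\<close>, and \<open>fibre_poly q l x\<close> the equation as a polynomial in \<open>y\<close>.\<close>

definition fibre_poly :: "nat \<Rightarrow> 'b::comm_ring_1 \<Rightarrow> 'b \<Rightarrow> 'b poly" where
  "fibre_poly q l x = monom (1 - l) (q + 1) + monom ((1 + l) * x - 2 * x ^ q) q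
     + [:(1 - l) * (x * x ^ q), (1 + l) * x ^ q - 2 * x:]"

lemma Gf_sym: "Gf q l x y = Gf q l y x"
  by (simp add: Gf_def algebra_simps)

lemma Gf_Gy: "Gf q l x y = y * Gy q l x y + x * ((1 - l) * x ^ q + (1 + l) * y ^ q) - 2 * x ^ q * y ^ q"
  by (simp add: Gf_def Gy_def algebra_simps)

lemma Gf_inverse:
  fixes x y :: "'b::field"
  assumes "x \<noteq> 0" "y \<noteq> 0"
  shows "Gf q l (1 / x) (1 / y) * (x * y) ^ (q + 1) = Gf q l x y"
proof -
  have "x ^ q \<noteq> 0" "y ^ q \<noteq> 0" using assms by auto
  thus ?thesis using assms
    by (simp add: Gf_def power_divide power_mult_distrib divide_simps) (simp add: algebra_simps)
qed

text \<open>Differentiating \<open>Gf_inverse\<close> with respect to y produces the factor -y^2.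
  The identity holds only modulo the curve, with error \<open>y * Gf q l x y\<close>.\<close>

lemma Gy_inverse:
  fixes x y :: "'b::field"
  assumes "x \<noteq> 0" "y \<noteq> 0" "Gf q l x y = 0"
  shows "Gy q l (1 / x) (1 / y) * (x * y) ^ (q + 1) = - (y ^ 2 * Gy q l x y)"
proof -
  have "x ^ q \<noteq> 0" "y ^ q \<noteq> 0" using assms by auto
  hence "Gy q l (1 / x) (1 / y) * (x * y) ^ (q + 1) = - (y ^ 2 * Gy q l x y) + y * Gf q l x y"
    using assms(1,2)
    by (simp add: Gy_def Gf_def power_divide power_mult_distrib divide_simps)
       (simp add: algebra_simps power2_eq_square)
  thus ?thesis using assms by simp
qed

lemma poly_fibre_poly: "poly (fibre_poly q l x) y = Gf q l x y"
  by (simp add: fibre_poly_def Gf_def poly_monom algebra_simps)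

lemma coeff_fibre_poly_top: "q > 1 \<Longrightarrow> coeff (fibre_poly q l x) (Suc q) = 1 - l"
  by (cases q) (auto simp: fibre_poly_def coeff_pCons)

lemma coeff_fibre_poly_0: "q > 1 \<Longrightarrow> coeff (fibre_poly q l x) 0 = (1 - l) * (x * x ^ q)"
  by (cases q) (auto simp: fibre_poly_def)

lemma degree_fibre_poly:
  assumes "q > 1" "l \<noteq> 1"
  shows "degree (fibre_poly q l x) = Suc q"
proof (rule antisym)
  have "degree [:(1 - l) * (x * x ^ q), (1 + l) * x ^ q - 2 * x:] \<le> 1"
    by simp
  thus "degree (fibre_poly q l x) \<le> Suc q" unfolding fibre_poly_def using assms
    by (intro degree_add_le) (auto intro: order.trans[OF degree_monom_le])
  show "Suc q \<le> degree (fibre_poly q l x)"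
    using coeff_fibre_poly_top[of q l x] assms by (intro le_degree) auto
qed

lemma fibre_poly_nonzero: "q > 1 \<Longrightarrow> l \<noteq> 1 \<Longrightarrow> fibre_poly q l x \<noteq> 0"
  using degree_fibre_poly[of q l x] by auto

lemma poly_pderiv_fibre_poly:
  fixes x y :: "'b::idom"
  assumes "of_nat q = (0 :: 'b)"
  shows "poly (pderiv (fibre_poly q l x)) y = Gy q l x y"
  using assms by (simp add: fibre_poly_def Gy_def pderiv_add pderiv_monom poly_monom pderiv_pCons algebra_simps)

lemma fibre_poly_eq_Gf: "fibre_poly q l x = Gf q [:l:] [:x:] [:0, 1:]"
proof -
  have m: "monom c n = [:c:] * [:0, 1:] ^ n" for c :: 'a and n by (simp add: monom_altdef)
  have xq: "[:x ^ q:] = [:x:] ^ q" by (simp add: poly_const_pow)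
  have two: "[:2:] = (2 :: 'a poly)" by (simp add: numeral_poly)
  have p: "[:a, b:] = [:a:] + [:b:] * [:0, 1:]" for a b :: 'a by simp
  have h: "[:a - b:] = [:a:] - [:b:]" "[:a + b:] = [:a:] + [:b:]" "[:a * b:] = [:a:] * [:b:]" "[:1:] = (1 :: 'a poly)"
    for a b :: 'a by simp_all
  have lin: "[:(1 - l) * (x * x ^ q), (1 + l) * x ^ q - 2 * x:] =
      (1 - [:l:]) * ([:x:] * [:x:] ^ q) + ((1 + [:l:]) * [:x:] ^ q - 2 * [:x:]) * [:0, 1:]"
    unfolding p[of "(1 - l) * (x * x ^ q)"] by (simp only: h two xq)
  have mq: "monom (1 - l) (q + 1) = (1 - [:l:]) * ([:0, 1:] * [:0, 1:] ^ q)"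
     "monom ((1 + l) * x - 2 * x ^ q) q = ((1 + [:l:]) * [:x:] - 2 * [:x:] ^ q) * [:0, 1:] ^ q"
    unfolding m by (simp_all only: h two xq power_add power_one_right mult.commute)
  have alg: "(1 - L) * (Y * Yq) + ((1 + L) * X - 2 * Xq) * Yq + ((1 - L) * (X * Xq) + ((1 + L) * Xq - 2 * X) * Y)
    = (1 - L) * (X * Xq + Y * Yq) + (1 + L) * (Xq * Y + X * Yq) - 2 * (Xq * Yq + X * Y)" for L X Y Xq Yq :: "'a poly"
    by (simp add: algebra_simps)
  show ?thesis unfolding fibre_poly_def Gf_def lin mq by (rule alg)
qed

text \<open>One transport lemma serves evaluation at points and at series, \<open>tf\<close>,
  \<open>map_poly tf\<close> and embeddings alike.\<close>

lemma Gf_hom: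
  fixes h :: "'b::comm_ring_1 \<Rightarrow> 'c::comm_ring_1"
  assumes add: "\<And>a b. h (a + b) = h a + h b" and mult: "\<And>a b. h (a * b) = h a * h b" and one: "h 1 = 1"
  shows "h (Gf q l x y) = Gf q (h l) (h x) (h y)"
proof -
  have diff: "h (a - b) = h a - h b" for a b using add[of "a - b" b] by (simp add: algebra_simps)
  have pow: "h (a ^ n) = h a ^ n" for a n by (induction n) (simp_all add: one mult)
  have two: "h 2 = 2" using add[of 1 1] by (simp add: one)
  show ?thesis unfolding Gf_def by (simp only: add mult one diff pow two)
qed

lemma map_poly_hom_mult:
  fixes f :: "'b::comm_ring_1 \<Rightarrow> 'c::comm_ring_1"
  assumes f0: "f 0 = 0" and fadd: "\<And>a b. f (a + b) = f a + f b"
    and fmult: "\<And>a b. f (a * b) = f a * f b"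
  shows "map_poly f (p * r) = map_poly f p * map_poly f r"
proof (induction p)
  case (pCons a p)
  have add: "map_poly f (p + r) = map_poly f p + map_poly f r" for p r
    by (intro poly_eqI) (simp add: coeff_map_poly f0 fadd)
  show ?case using pCons by (simp add: add map_poly_smult map_poly_pCons f0 fmult)
qed simp

locale curve =
  fixes q :: nat and lam :: "'a::field"
  assumes q_gt_3: "q > 3"
    and prime_char: "prime CHAR('a)" and odd_char: "odd CHAR('a)"
    and q_power: "\<exists>k. q = CHAR('a) ^ k"
    and alg_closed: "\<forall>P :: 'a poly. degree P > 0 \<longrightarrow> (\<exists>z. poly P z = 0)"
    and lam_neq_1: "lam \<noteq> 1" and lam_neq_neg_1: "lam \<noteq> -1"
begin

abbreviation K :: "'a \<Rightarrow> 'a fls" where "K \<equiv> fls_const"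

lemma q_gt_1: "q > 1" using q_gt_3 by simp

lemma of_nat_q: "of_nat q = (0 :: 'a)"
proof -
  obtain k where k: "q = CHAR('a) ^ k" using q_power by blast
  hence "k > 0" using q_gt_3 by (cases k) auto
  thus ?thesis using k by (simp add: of_nat_eq_0_iff_char_dvd)
qed

lemma two_nonzero [simp]: "(2 :: 'a) \<noteq> 0"
proof
  assume "(2 :: 'a) = 0"
  hence "of_nat 2 = (0 :: 'a)" by simp
  hence "CHAR('a) dvd 2" by (simp only: of_nat_eq_0_iff_char_dvd)
  hence "CHAR('a) = 2" using prime_char by (metis primes_dvd_imp_eq two_is_prime_nat)
  thus False using odd_char by simp
qed

lemma frobenius_add:
  fixes x y :: "'b::comm_ring_1"
  assumes "CHAR('b) = CHAR('a)"
  shows "(x + y) ^ q = x ^ q + y ^ q"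
  using q_power freshmans_dream'[where ?'a = 'b] prime_char assms by metis

lemma frobenius_diff:
  fixes x y :: "'b::comm_ring_1"
  assumes "CHAR('b) = CHAR('a)"
  shows "(x - y) ^ q = x ^ q - y ^ q"
  using frobenius_add[OF assms, of "x - y" y] by simp

lemma frobenius_eq_iff:
  fixes x y :: "'b::idom"
  assumes "CHAR('b) = CHAR('a)"
  shows "x ^ q = y ^ q \<longleftrightarrow> x = y"
  using frobenius_diff[OF assms, of x y] by (metis power_eq_0_iff right_minus_eq)

lemma curve_eq_Gf:
  fixes x y l :: "'b::comm_ring_1"
  assumes "CHAR('b) = CHAR('a)"
  shows "(x + y) ^ (q + 1) - 2 * ((x * y) ^ q + x * y) - l * (x - y) ^ (q + 1) = Gf q l x y"
  by (simp add: frobenius_add[OF assms] frobenius_diff[OF assms] Gf_def power_mult_distrib algebra_simps)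

lemma Gf_translate:
  fixes x y l c :: "'b::comm_ring_1"
  assumes "CHAR('b) = CHAR('a)" "c ^ q = c"
  shows "Gf q l (x + c) (y + c) = Gf q l x y"
  by (simp add: frobenius_add[OF assms(1)] assms(2) Gf_def algebra_simps)

lemma Gy_translate:
  fixes x y l c :: "'b::comm_ring_1"
  assumes "CHAR('b) = CHAR('a)" "c ^ q = c"
  shows "Gy q l (x + c) (y + c) = Gy q l x y"
  by (simp add: frobenius_add[OF assms(1)] assms(2) Gy_def algebra_simps)

lemma curveF_eq_fibre_poly: "curveF q lam = fibre_poly q [:lam:] [:0, 1:]"
  unfolding fibre_poly_eq_Gf curveF_def Xp_def Yp_def cst_def
  by (rule curve_eq_Gf) simp

definition Fpol :: "'a poly fract poly" where "Fpol = fibre_poly q (tf [:lam:]) (tf [:0, 1:])"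

lemma Fy_eq_Fpol: "Fy q lam = Fpol"
proof -
  have add: "map_poly tf (p + r) = map_poly tf p + map_poly tf r" for p r :: "'a poly poly"
    by (intro poly_eqI) (simp add: coeff_map_poly tf_add)
  show ?thesis unfolding Fy_def curveF_eq_fibre_poly Fpol_def fibre_poly_eq_Gf
    by (subst Gf_hom) (auto simp: add map_poly_hom_mult tf_add tf_mult map_poly_pCons)
qed

lemma tf_lam_neq_1: "tf [:lam:] \<noteq> 1"
proof -
  have "[:lam:] \<noteq> 1" using lam_neq_1 by (simp add: one_pCons)
  thus ?thesis using tf_eq_iff[of "[:lam:]" 1] by (metis tf_1)
qed

lemma degree_Fpol: "degree Fpol = Suc q"
  unfolding Fpol_def using q_gt_1 tf_lam_neq_1 by (rule degree_fibre_poly)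

lemma FF_iff: "r \<in> FF q lam \<longleftrightarrow> degree r \<le> q"
  by (auto simp: FF_def Fy_eq_Fpol degree_Fpol)

abbreviation G :: "'a fls \<Rightarrow> 'a fls \<Rightarrow> 'a fls" where "G \<equiv> Gf q (K lam)"
abbreviation Dy :: "'a fls \<Rightarrow> 'a fls \<Rightarrow> 'a fls" where "Dy \<equiv> Gy q (K lam)"

lemma frob_fls_const: "c ^ q = c \<Longrightarrow> K c ^ q = (K c :: 'a fls)"
  by (simp flip: fls_const_power)

lemma fls_deriv_frob: "fls_deriv (x ^ q) = (0 :: 'a fls)"
  using of_nat_q by (simp add: fls_deriv_power fls_of_nat)

lemma G_deriv: "fls_deriv (G x y) = Dy y x * fls_deriv x + Dy x y * fls_deriv y"
  by (simp add: Gf_def Gy_def fls_deriv_frob algebra_simps)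

section \<open>Points over the field of Laurent series\<close>

lemma algebraic_point_const:
  assumes "G (K c) y = 0"
  shows "y \<in> range K"
proof (rule ccontr)
  assume "y \<notin> range K"
  hence "transc y" by (rule transcI[OF alg_closed])
  moreover have "evp (fibre_poly q lam c) y = G (K c) y"
  proof -
    have "monom c n = smult c ([:0,1:] ^ n)" for c :: 'a and n by (simp add: monom_altdef)
    thus ?thesis
      by (simp add: fibre_poly_def evp_add evp_smult evp_power evp_X evp_pCons Gf_def algebra_simps
        flip: fls_const_power fls_const_mult_const fls_plus_const fls_minus_const)
  qed
  ultimately show False using assms fibre_poly_nonzero[OF q_gt_1 lam_neq_1] by (simp add: transc_def)
qed

lemma transc_point:
  assumes "G x y = 0" "transc x"
  shows "transc y"
proof (rule transcI[OF alg_closed], rule)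
  assume "y \<in> range K"
  then obtain c where "y = K c" by blast
  hence "G (K c) x = 0" using assms Gf_sym by metis
  hence "x \<in> range K" by (rule algebraic_point_const)
  thus False using assms(2) transc_not_const by blast
qed

text \<open>The equation of the curve is linear in \<open>y\<close> over the \<open>q\<close>-th powers, so that its power series
  solutions are fixed points of a contraction.\<close>

lemma frobenius_moebius_fps:
  fixes A0 A1 B0 B1 :: "'a fps"
  assumes d: "B0 $ 0 + B1 $ 0 * y0 ^ q \<noteq> 0"
    and n: "A0 $ 0 + A1 $ 0 * y0 ^ q = y0 * (B0 $ 0 + B1 $ 0 * y0 ^ q)"
  shows "\<exists>Y. Y $ 0 = y0 \<and> Y * (B0 + B1 * Y ^ q) = A0 + A1 * Y ^ q"
proof -
  \<comment> \<open>The solution is sought as \<open>Y = y0 + X * W\<close>; \<open>U W\<close> is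
    its q-th power by the Frobenius, \<open>R W\<close> the right-hand side solved for the linear
    occurrence of \<open>Y\<close>, and \<open>T\<close> extracts \<open>W\<close> again.\<close>
  define U where "U W = fps_const (y0 ^ q) + fps_X ^ q * W ^ q" for W :: "'a fps"
  define N where "N W = A0 + A1 * U W" for W
  define D where "D W = B0 + B1 * U W" for W
  define R where "R W = N W * inverse (D W)" for W
  define T where "T W = fps_shift 1 (R W - fps_const y0)" for W
  have U0: "U W $ 0 = y0 ^ q" for W using q_gt_1 by (simp add: U_def)
  have D0: "D W $ 0 \<noteq> 0" for W using d by (simp add: D_def U0)
  have DD: "D W * inverse (D W) = 1" for W using inverse_mult_eq_1'[OF D0] .
  have R0: "R W $ 0 = y0" for W
  proof -
    have "R W * D W = N W" using DD[of W] by (simp add: R_def algebra_simps)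
    hence "R W $ 0 * D W $ 0 = N W $ 0" by (metis fps_mult_nth_0)
    thus ?thesis using D0[of W] n by (simp add: N_def D_def U0)
  qed
  have contr: "fps_X ^ Suc k dvd T Y - T Z" if YZ: "fps_X ^ k dvd Y - Z" for k Y Z
  proof -
    obtain V where V: "Y - Z = fps_X ^ k * V" using YZ by (auto simp: dvd_def)
    have "U Y - U Z = fps_X ^ q * (Y ^ q - Z ^ q)" by (simp add: U_def algebra_simps)
    also have "\<dots> = fps_X ^ q * (Y - Z) ^ q" by (simp add: frobenius_diff)
    also have "\<dots> = fps_X ^ (q + k * q) * V ^ q"
      by (simp add: V power_mult_distrib power_add power_mult)
    \<comment> \<open>The Frobenius multiplies the order \<open>k\<close> by \<open>q\<close>, and
      the factor X^q adds \<open>q\<close>. Two orders of this gain are kept, since the division by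
      X in \<open>T\<close> loses one.\<close>
    also have "q + k * q = Suc (Suc k) + (q + k * q - Suc (Suc k))"
      using q_gt_1 by (cases q) (auto simp: algebra_simps)
    also have "fps_X ^ \<dots> * V ^ q = fps_X ^ Suc (Suc k) * (fps_X ^ (q + k * q - Suc (Suc k)) * V ^ q)"
      by (simp only: power_add mult.assoc)
    finally obtain V' where V': "U Y - U Z = fps_X ^ Suc (Suc k) * V'" by blast
    have "R Y - R Z = (N Y * D Z - N Z * D Y) * (inverse (D Y) * inverse (D Z))"
    proof -
      have alg: "a * i * (e * j) - c * j * (d * i) = (a * e - c * d) * (i * j)" for a c d e i j :: "'a fps"
        by (simp add: algebra_simps)
      have "R Y = N Y * inverse (D Y) * (D Z * inverse (D Z))" "R Z = N Z * inverse (D Z) * (D Y * inverse (D Y))"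
        by (simp_all only: R_def DD mult_1_right)
      thus ?thesis by (simp only: alg)
    qed
    also have "N Y * D Z - N Z * D Y = (A1 * B0 - A0 * B1) * (U Y - U Z)"
      by (simp add: N_def D_def algebra_simps)
    finally obtain V'' where "R Y - R Z = fps_X ^ Suc (Suc k) * V''"
      unfolding V' by (metis mult.assoc mult.commute)
    hence "T Y - T Z = fps_shift 1 (fps_X * (fps_X ^ Suc k * V''))"
      by (simp add: T_def fps_shift_diff[symmetric] mult.assoc)
    also have "\<dots> = fps_X ^ Suc k * V''" by (rule fps_ext) simp
    finally show ?thesis by (metis dvd_triv_left)
  qed
  obtain W where W: "T W = W" using fps_fixed_point[of T, OF contr] by blast
  have "R W - fps_const y0 = fps_X * fps_shift 1 (R W - fps_const y0)"
    using R0[of W] by (intro fps_ext) auto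
  hence RW: "R W = fps_const y0 + fps_X * W" using W by (simp add: T_def algebra_simps)
  have "R W ^ q = U W"
    unfolding RW by (simp add: frobenius_add U_def power_mult_distrib fps_const_power)
  moreover have "R W * D W = N W" using DD[of W] by (simp add: R_def algebra_simps)
  ultimately show ?thesis using R0[of W] by (intro exI[of _ "R W"]) (simp add: D_def N_def)
qed

text \<open>The projection to x is unramified off F_q: eliminating y0^q between F = 0 and F_y = 0
  leaves 2 (1 + lam) (x0 - x0^q)^2 = 0.\<close>

lemma Gy_nonzero_off_Fq:
  assumes x: "x0 ^ q \<noteq> x0" and F: "Gf q lam x0 y0 = 0"
  shows "Gy q lam x0 y0 \<noteq> 0"
proof
  assume Gy0: "Gy q lam x0 y0 = 0"
  define X Y where "X = x0 ^ q" and "Y = y0 ^ q"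
  have 1: "(1 - lam) * Y = 2 * x0 - (1 + lam) * X" using Gy0 by (simp add: Gy_def X_def Y_def algebra_simps)
  have "x0 * ((1 - lam) * X + (1 + lam) * Y) - 2 * X * Y = 0"
    using F Gy0 by (simp add: Gf_Gy X_def Y_def)
  hence "(1 - lam) * (x0 * ((1 - lam) * X + (1 + lam) * Y) - 2 * X * Y) = 0" by simp
  hence "x0 * ((1 - lam) * (1 - lam) * X + (1 + lam) * ((1 - lam) * Y)) - 2 * X * ((1 - lam) * Y) = 0"
    by (simp add: algebra_simps)
  hence "2 * (1 + lam) * (x0 - X) ^ 2 = 0" unfolding 1 by (simp add: algebra_simps power2_eq_square)
  moreover have "1 + lam \<noteq> 0" using lam_neq_neg_1 by (metis add_eq_0_iff minus_minus)
  hence "2 * (1 + lam) \<noteq> 0" by (simp only: mult_eq_0_iff two_nonzero simp_thms)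
  ultimately have "(x0 - X) ^ 2 = 0" by (metis mult_eq_0_iff)
  thus False using x by (simp add: X_def)
qed

lemma card_fibre:
  assumes "x0 ^ q \<noteq> x0"
  shows "card {y0. Gf q lam x0 y0 = 0} = Suc q"
proof -
  have "card {y0. poly (fibre_poly q lam x0) y0 = 0} = degree (fibre_poly q lam x0)"
    using fibre_poly_nonzero[OF q_gt_1 lam_neq_1] Gy_nonzero_off_Fq[OF assms]
    by (intro card_roots_separable alg_closed) (auto simp: poly_fibre_poly poly_pderiv_fibre_poly of_nat_q)
  thus ?thesis by (simp add: poly_fibre_poly degree_fibre_poly[OF q_gt_1 lam_neq_1])
qed

text \<open>Hensel lifting: when the equation is solved for the linear occurrence of y, the
  denominator is F_y, a unit at the given point.\<close>

lemma exists_point_over: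
  assumes x: "x0 ^ q \<noteq> x0" and F: "Gf q lam x0 y0 = 0"
  shows "\<exists>y. ge 0 y \<and> y $$ 0 = y0 \<and> G (K x0 + fls_X) y = 0"
proof -
  define xx :: "'a fps" where "xx = fps_const x0 + fps_X"
  have xx0: "xx $ 0 = x0" by (simp add: xx_def)
  have xq0: "(xx ^ q) $ 0 = x0 ^ q" by (simp add: fps_nth_power_0 xx0)
  let ?a = "fps_const (1 - lam)" and ?b = "fps_const (1 + lam)"
  have Gy: "Gy q lam x0 y0 \<noteq> 0" using Gy_nonzero_off_Fq[OF assms] .
  have "\<exists>Y. Y $ 0 = y0 \<and> Y * ((?b * xx ^ q - 2 * xx) + ?a * Y ^ q)
      = - (?a * xx * xx ^ q) + (2 * xx ^ q - ?b * xx) * Y ^ q"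
  proof (rule frobenius_moebius_fps)
    have t: "(2 :: 'a fps) $ 0 = 2" by simp
    show "(?b * xx ^ q - 2 * xx) $ 0 + ?a $ 0 * y0 ^ q \<noteq> 0"
      using Gy by (simp add: Gy_def xx0 xq0 algebra_simps)
    show "(- (?a * xx * xx ^ q)) $ 0 + (2 * xx ^ q - ?b * xx) $ 0 * y0 ^ q =
      y0 * ((?b * xx ^ q - 2 * xx) $ 0 + ?a $ 0 * y0 ^ q)"
      using F by (simp add: Gf_def xx0 xq0 algebra_simps eq_neg_iff_add_eq_0)
  qed
  then obtain Y where Y: "Y $ 0 = y0" and e: "Y * ((?b * xx ^ q - 2 * xx) + ?a * Y ^ q)
      = - (?a * xx * xx ^ q) + (2 * xx ^ q - ?b * xx) * Y ^ q" by blast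
  have ab: "?a = 1 - fps_const lam" "?b = 1 + fps_const lam"
    by (simp_all flip: fps_const_sub fps_const_add)
  have "Gf q (fps_const lam) xx Y = 0" unfolding Gf_def ab[symmetric] using e by (simp add: algebra_simps)
  hence "fps_to_fls (Gf q (fps_const lam) xx Y) = 0" by simp
  hence "G (K x0 + fls_X) (fps_to_fls Y) = 0"
    by (simp add: Gf_def fls_times_fps_to_fls fps_to_fls_power xx_def)
  thus ?thesis using Y by (intro exI[of _ "fps_to_fls Y"]) auto
qed

text \<open>The node at the origin has a branch along which \<open>x\<close> is a local parameter and \<open>y\<close> vanishes to
  order \<open>q\<close>.\<close>

lemma exists_node_branch:
  "\<exists>h. ge 0 h \<and> h $$ 0 = (1 - lam) / 2 \<and> G fls_X (fls_X ^ q * h) = 0"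
proof -
  let ?a = "fps_const (1 - lam)" and ?b = "fps_const (1 + lam)"
  let ?X = "fps_X :: 'a fps"
  \<comment> \<open>With y = X^q Y the equation is divisible by X^(q+1). The exponents
    \<open>m\<close> and \<open>k\<close> are those that survive, and at X = 0 there remains -2 Y =
    -(1 - lam), which gives the constant term of \<open>h\<close>.\<close>
  define m where "m = q * q - q"
  have m: "q * q = q + m" "m > 0"
    using q_gt_1 unfolding m_def by (auto)
  define k where "k = q - 1"
  have k: "q = Suc k" "k > 0" using q_gt_1 by (auto simp: k_def)
  have "\<exists>Y. Y $ 0 = (1 - lam) / 2 \<and> Y * ((?b * ?X ^ k - 2) + (?a * ?X ^ (m + k)) * Y ^ q)
      = - ?a + (2 * ?X ^ (m + k) - ?b * ?X ^ m) * Y ^ q"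
  proof (rule frobenius_moebius_fps)
    show "(?b * ?X ^ k - 2) $ 0 + (?a * ?X ^ (m + k)) $ 0 * ((1 - lam) / 2) ^ q \<noteq> 0"
      using k m by simp
    show "(- ?a) $ 0 + (2 * ?X ^ (m + k) - ?b * ?X ^ m) $ 0 * ((1 - lam) / 2) ^ q =
      (1 - lam) / 2 * ((?b * ?X ^ k - 2) $ 0 + (?a * ?X ^ (m + k)) $ 0 * ((1 - lam) / 2) ^ q)"
      using k m by (simp add: field_simps)
  qed
  then obtain Y where Y: "Y $ 0 = (1 - lam) / 2" and e: "Y * ((?b * ?X ^ k - 2) + (?a * ?X ^ (m + k)) * Y ^ q)
      = - ?a + (2 * ?X ^ (m + k) - ?b * ?X ^ m) * Y ^ q" by blast
  have ab: "?a = 1 - fps_const lam" "?b = 1 + fps_const lam"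
    by (simp_all flip: fps_const_sub fps_const_add)
  have Xq2: "(?X ^ q * Y) ^ q = (?X ^ q * ?X ^ m) * Y ^ q"
    by (simp only: power_mult_distrib m(1) flip: power_mult power_add)
  have Xq: "?X ^ q = ?X * ?X ^ k" by (metis k(1) power_Suc)
  have alg: "a * (X * Xq + (Xq * Y) * ((Xq * Xm) * Yq)) + b * (Xq * (Xq * Y) + X * ((Xq * Xm) * Yq))
      - 2 * (Xq * ((Xq * Xm) * Yq) + X * (Xq * Y)) =
    Xq * X * (Y * ((b * Xk - 2) + (a * (Xm * Xk)) * Yq) - (- a + (2 * (Xm * Xk) - b * Xm) * Yq))"
    if "Xq = X * Xk" for a b X Xq Xm Xk Y Yq :: "'a fps"
    unfolding that by (simp add: algebra_simps)
  have "Gf q (fps_const lam) ?X (?X ^ q * Y) =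
    ?X ^ q * ?X * (Y * ((?b * ?X ^ k - 2) + (?a * (?X ^ m * ?X ^ k)) * Y ^ q)
      - (- ?a + (2 * (?X ^ m * ?X ^ k) - ?b * ?X ^ m) * Y ^ q))"
    unfolding Gf_def ab[symmetric] Xq2 by (rule alg[OF Xq])
  hence "fps_to_fls (Gf q (fps_const lam) ?X (?X ^ q * Y)) = 0" using e by (simp add: power_add)
  hence "G fls_X (fls_X ^ q * fps_to_fls Y) = 0"
    by (simp add: Gf_def fls_times_fps_to_fls fps_to_fls_power)
  thus ?thesis using Y by (intro exI[of _ "fps_to_fls Y"]) auto
qed

section \<open>Irreducibility\<close>

lemma Fpol_eq_Gf: "Fpol = Gf q (kc lam) xf yf"
  unfolding Fpol_def fibre_poly_eq_Gf kc_def xf_def yf_def ..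

lemma evr_1: "transc x \<Longrightarrow> evr 1 x y = 1"
  using evr_kc[of x 1 y] by (simp add: kc_def one_pCons tf_1[unfolded one_pCons])

lemma evr_Fpol: "transc x \<Longrightarrow> evr Fpol x y = G x y"
  unfolding Fpol_eq_Gf
  by (subst Gf_hom) (auto simp: evr_add evr_mult evr_1 evr_kc evr_xf evr_yf)

lemma card_Fq: "card {a :: 'a. a ^ q = a} = q"
proof -
  let ?P = "monom 1 q - [:0, 1:] :: 'a poly"
  have d: "degree ?P = q"
    unfolding diff_conv_add_uminus using q_gt_1 by (subst degree_add_eq_left) (auto simp: degree_monom_eq)
  have "card {z. poly ?P z = 0} = degree ?P"
  proof (rule card_roots_separable[OF alg_closed])
    show "?P \<noteq> 0" using d q_gt_1 by auto
    show "poly (pderiv ?P) z \<noteq> 0" for z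
      using of_nat_q by (simp add: pderiv_diff pderiv_monom pderiv_pCons poly_monom)
  qed
  thus ?thesis by (simp add: d poly_monom)
qed

text \<open>For a in F_q the only point over x = a is y = a, because a translation moves a to 0 and
  the equation becomes (1 - lam) y^(q+1) = 0. Hence r = x + w k with w = x^q - x. Substitution gives
  2 (k - 1) = w^(q-1) k^q (2 - (1 - lam) k), where the right side, if nonzero, has larger degree
  than the left can have. So both vanish, k = 1 and lam = -1.\<close>

lemma no_rational_root_poly:
  fixes r :: "'a poly"
  shows "Gf q [:lam:] [:0, 1:] r \<noteq> 0"
proof
  assume 0: "Gf q [:lam:] [:0, 1:] r = 0"
  have ra: "poly r a = a" if "a ^ q = a" for a
  proof -
    have "poly (Gf q [:lam:] [:0, 1:] r) a = Gf q lam a (poly r a)"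
      by (subst Gf_hom) auto
    hence "Gf q lam (0 + a) ((poly r a - a) + a) = 0" using 0 by simp
    hence "Gf q lam 0 (poly r a - a) = 0" using Gf_translate[OF refl that] by metis
    hence "(1 - lam) * ((poly r a - a) * (poly r a - a) ^ q) = 0"
      using q_gt_1 by (simp add: Gf_def power_0_left)
    thus ?thesis using lam_neq_1 by auto
  qed
  define w where "w = [:0, 1:] ^ q - [:0, 1 :: 'a:]"
  have dw: "degree w = q"
    unfolding w_def diff_conv_add_uminus using q_gt_1
    by (subst degree_add_eq_left) (auto simp: degree_power_eq)
  have w0: "w \<noteq> 0" using dw q_gt_1 by auto
  define s where "s = r - [:0, 1:]"
  define k where "k = s div w"
  have "s mod w = 0"
  proof (rule poly_eqI_degree[where A = "{a. a ^ q = a}"])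
    have "degree (s mod w) < q" using degree_mod_less[OF w0, of s] dw q_gt_1 by auto
    thus "degree (s mod w) < card {a :: 'a. a ^ q = a}" by (simp add: card_Fq)
    show "degree (0 :: 'a poly) < card {a :: 'a. a ^ q = a}" using q_gt_1 by (simp add: card_Fq)
    fix a :: 'a assume "a \<in> {a. a ^ q = a}"
    hence a: "a ^ q = a" by simp
    have "poly (s mod w) a = poly s a - poly w a * poly k a"
      by (metis add_diff_cancel_left' k_def mult_div_mod_eq poly_add poly_mult)
    thus "poly (s mod w) a = poly 0 a" using ra[OF a] a by (simp add: s_def w_def)
  qed
  hence "s = w * k" by (metis k_def add.right_neutral mult_div_mod_eq)
  hence rk: "r = [:0, 1:] + w * k" by (simp add: s_def algebra_simps)
  have rq: "r ^ q = [:0, 1:] ^ q + w ^ q * k ^ q"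
    by (simp add: rk frobenius_add power_mult_distrib)
  have Xq: "[:0, 1:] ^ q = [:0, 1:] + w" by (simp add: w_def)
  have wq: "w ^ q = w * w ^ (q - 1)" using q_gt_1 by (cases q) auto
  have alg: "(1 - l) * (X * (X + w) + (X + w * k) * (X + w + w * u * kq))
      + (1 + l) * ((X + w) * (X + w * k) + X * (X + w + w * u * kq))
      - 2 * ((X + w) * (X + w + w * u * kq) + X * (X + w * k))
      = - (w * w * (2 * (1 - k) + u * kq * (2 - (1 - l) * k)))" for l X w k u kq :: "'a poly"
    by (simp add: algebra_simps)
  have rq': "r ^ q = [:0, 1:] + w + w * w ^ (q - 1) * k ^ q" by (simp only: rq Xq wq)
  have "Gf q [:lam:] [:0, 1:] r = - (w * w * (2 * (1 - k) + w ^ (q - 1) * k ^ q * (2 - (1 - [:lam:]) * k)))"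
    unfolding Gf_def rq' Xq unfolding rk by (rule alg)
  hence ww: "w * w * (2 * (1 - k) + w ^ (q - 1) * k ^ q * (2 - (1 - [:lam:]) * k)) = 0"
    using 0 by (metis neg_equal_0_iff_equal)
  have e: "2 * (k - 1) = w ^ (q - 1) * k ^ q * (2 - (1 - [:lam:]) * k)"
  proof -
    have "2 * (1 - k) + w ^ (q - 1) * k ^ q * (2 - (1 - [:lam:]) * k) = 0"
      using ww w0 by (metis mult_eq_0_iff)
    moreover have "2 * (k - 1) = - (2 * (1 - k))" by (simp add: algebra_simps)
    ultimately show ?thesis by (metis add_eq_0_iff minus_minus)
  qed
  have two: "(2 :: 'a poly) = [:2:]" by (simp add: numeral_poly)
  have "w ^ (q - 1) * k ^ q * (2 - (1 - [:lam:]) * k) = 0"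
  proof (rule ccontr)
    assume n: "w ^ (q - 1) * k ^ q * (2 - (1 - [:lam:]) * k) \<noteq> 0"
    hence k0: "k \<noteq> 0" using q_gt_1 by auto
    have "degree (w ^ (q - 1) * k ^ q * (2 - (1 - [:lam:]) * k)) \<ge> degree (w ^ (q - 1) * k ^ q)"
      using n by (subst degree_mult_eq) auto
    also have "degree (w ^ (q - 1) * k ^ q) = (q - 1) * q + q * degree k"
      using w0 k0 by (subst degree_mult_eq) (auto simp: degree_power_eq dw)
    also have "degree (w ^ (q - 1) * k ^ q * (2 - (1 - [:lam:]) * k)) = degree (2 * (k - 1))"
      by (simp only: e)
    also have "\<dots> \<le> degree k"
      unfolding two by (rule order.trans[OF degree_mult_le]) (auto intro!: degree_diff_le)
    finally have "(q - 1) * q + q * degree k \<le> degree k" .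
    moreover have "1 * degree k \<le> q * degree k" using q_gt_1 by (intro mult_right_mono) auto
    moreover have "(q - 1) * q > 0" using q_gt_1 by simp
    ultimately show False by linarith
  qed
  hence *: "2 * (k - 1) = 0" "w ^ (q - 1) * k ^ q * (2 - (1 - [:lam:]) * k) = 0" using e by auto
  have "k = 1" using * by (simp add: two)
  hence "2 - (1 - [:lam:]) = 0" using * w0 by simp
  hence "1 + lam = 0" by (simp add: two one_pCons)
  thus False using lam_neq_neg_1 by (metis add_eq_0_iff minus_minus)
qed

text \<open>At a root of the denominator the cleared equation reduces to (1 - lam) n^(q+1) = 0, so
  the numerator would share the root. The root is therefore a polynomial.\<close>

lemma no_rational_root: "poly Fpol r \<noteq> 0"
proof
  assume 0: "poly Fpol r = 0"
  obtain n d where nd: "d \<noteq> 0" "r = Fract n d" "\<And>z. \<not> (poly n z = 0 \<and> poly d z = 0)"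
    using Fract_no_common_root[of r] by blast
  have rd: "r = tf n / tf d" "tf d \<noteq> 0" using nd by (auto simp: Fract_eq_tf_div)
  let ?X = "[:0, 1 :: 'a:]" and ?l = "[:lam:]"
  have tp: "tf a ^ n = tf (a ^ n)" for a :: "'a poly" and n by (induction n) (auto simp: tf_mult)
  have t2: "tf 2 = (2 :: 'a poly fract)" by (metis one_add_one tf_1 tf_add)
  have alg: "((1 - l) * (X * Xq + (n / d) * (nq / dq)) + (1 + l) * (Xq * (n / d) + X * (nq / dq))
      - 2 * (Xq * (nq / dq) + X * (n / d))) * (d * dq)
      = (1 - l) * (X * Xq * d * dq + n * nq) + (1 + l) * (Xq * n * dq + X * nq * d)
      - 2 * (Xq * nq * d + X * n * dq)" if "d \<noteq> 0" "dq \<noteq> 0" for l X Xq n nq d dq :: "'a poly fract"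
    using that by (simp add: field_simps)
  have "Gf q (tf ?l) (tf ?X) r = 0" using 0 by (simp add: Fpol_def poly_fibre_poly)
  hence "(1 - tf ?l) * (tf ?X * tf ?X ^ q * tf d * tf d ^ q + tf n * tf n ^ q)
      + (1 + tf ?l) * (tf ?X ^ q * tf n * tf d ^ q + tf ?X * tf n ^ q * tf d)
      - 2 * (tf ?X ^ q * tf n ^ q * tf d + tf ?X * tf n * tf d ^ q) = 0"
    using alg[OF rd(2) power_not_zero[OF rd(2)], of "tf ?l" "tf ?X" "tf ?X ^ q" "tf n" "tf n ^ q" q]
    unfolding Gf_def rd(1) by (simp only: power_divide mult_zero_left)
  hence "tf ((1 - ?l) * (?X * ?X ^ q * d * d ^ q + n * n ^ q)
      + (1 + ?l) * (?X ^ q * n * d ^ q + ?X * n ^ q * d)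
      - 2 * (?X ^ q * n ^ q * d + ?X * n * d ^ q)) = 0"
    by (simp only: tp tf_add tf_mult tf_diff tf_1 t2)
  hence P: "(1 - ?l) * (?X * ?X ^ q * d * d ^ q + n * n ^ q)
      + (1 + ?l) * (?X ^ q * n * d ^ q + ?X * n ^ q * d)
      - 2 * (?X ^ q * n ^ q * d + ?X * n * d ^ q) = 0" (is "?P = 0")
    by (simp only: tf_eq_0_iff)
  have "degree d = 0"
  proof (rule ccontr)
    assume "degree d \<noteq> 0"
    then obtain z where z: "poly d z = 0" using alg_closed by auto
    have "poly ?P z = (1 - lam) * (poly n z * poly n z ^ q)"
      using z q_gt_1 by simp
    moreover have "poly ?P z = 0" by (simp only: P poly_0)
    ultimately have "(1 - lam) * (poly n z * poly n z ^ q) = 0" by argo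
    hence "poly n z = 0" using lam_neq_1 by auto
    thus False using nd(3)[of z] z by simp
  qed
  then obtain c where c: "d = [:c:]" by (auto elim: degree_eq_zeroE)
  hence "c \<noteq> 0" using nd by auto
  hence "n = smult (1 / c) n * d" by (simp add: c)
  hence "r = tf (smult (1 / c) n)" using rd by (metis nonzero_mult_div_cancel_right tf_mult)
  hence "Gf q (tf ?l) (tf ?X) (tf (smult (1 / c) n)) = 0" using 0 by (simp add: Fpol_def poly_fibre_poly)
  hence "tf (Gf q ?l ?X (smult (1 / c) n)) = 0" by (subst Gf_hom) (auto simp: tf_add tf_mult)
  thus False using no_rational_root_poly by simp
qed

lemma node_branch_transc:
  fixes h :: "'a fls"
  assumes "ge 0 h" "h $$ 0 \<noteq> 0"
  shows "fls_subdegree (fls_X ^ q * h) = int q" "transc (fls_X ^ q * h)"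
proof -
  have "fls_subdegree h = 0" using assms by (intro fls_subdegree_eqI) (auto simp: ge_def)
  moreover have "h \<noteq> 0" using assms by auto
  ultimately show *: "fls_subdegree (fls_X ^ q * h) = int q" by simp
  show "transc (fls_X ^ q * h)"
  proof (rule transcI[OF alg_closed], rule)
    assume "fls_X ^ q * h \<in> range K"
    then obtain c where "fls_X ^ q * h = K c" by blast
    thus False using * q_gt_1 by (metis fls_const_subdegree not_less_zero of_nat_0_eq_iff)
  qed
qed

lemma subdegree_evp:
  assumes x: "fls_subdegree x = int q" and "p \<noteq> 0"
  shows "evp p x \<noteq> 0 \<and> int q dvd fls_subdegree (evp p x)"
  using assms(2)
proof (induction p)
  case (pCons c p)
  have gx: "ge 0 x" "x $$ 0 = 0" using x q_gt_1 by (auto simp: ge_def)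
  have x0: "x \<noteq> 0" using x q_gt_1 by auto
  show ?case
  proof (cases "c = 0")
    case True
    hence p: "p \<noteq> 0" using pCons by auto
    thus ?thesis using pCons.IH[OF p] True x x0 by (simp add: evp_pCons)
  next
    case False
    have 0: "evp (pCons c p) x $$ 0 = c" using gx by (simp add: evp_nth_0)
    moreover have "fls_subdegree (evp (pCons c p) x) = 0"
      using ge_evp[OF gx(1), of "pCons c p"] 0 False by (intro fls_subdegree_eqI) (auto simp: ge_def)
    ultimately show ?thesis using False by auto
  qed
qed simp

lemma subdegree_evf:
  assumes x: "fls_subdegree x = int q" "transc x"
  shows "int q dvd fls_subdegree (evf r x)"
proof -
  obtain a b where r: "r = Fract a b" "b \<noteq> 0" by (cases r) auto
  show ?thesis
  proof (cases "a = 0")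
    case True thus ?thesis using r x by (simp add: evf_Fract)
  next
    case False
    have "evp a x \<noteq> 0" "evp b x \<noteq> 0" "int q dvd fls_subdegree (evp a x)" "int q dvd fls_subdegree (evp b x)"
      using subdegree_evp[OF x(1)] r False by auto
    thus ?thesis using r x by (simp add: evf_Fract divide_inverse)
  qed
qed

text \<open>Along the branch \<open>x \<approx> y\<^sup>q\<close> the orders of the terms of a polynomial in \<open>y\<close> of degree less than
  \<open>q\<close> are pairwise distinct, so that it cannot vanish there.\<close>

lemma low_degree_nonzero_on_branch:
  assumes x: "fls_subdegree x = int q" "transc x" and A: "A \<noteq> 0" "degree A < q"
  shows "evr A x fls_X \<noteq> 0"
proof
  assume 0: "evr A x fls_X = 0"
  define c where "c j = evf (coeff A j) x" for j
  define J where "J = {j. j \<le> degree A \<and> c j \<noteq> 0}"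
  define n where "n j = fls_subdegree (c j) + int j" for j
  have "evr A x fls_X = (\<Sum>j\<le>degree (map_poly (\<lambda>c. evf c x) A). c j * fls_X ^ j)"
    unfolding evr_def poly_altdef c_def by (simp add: coeff_map_poly evf_0 x)
  also have "degree (map_poly (\<lambda>c. evf c x) A) = degree A"
    by (rule degree_map_poly) (auto simp: evf_eq_0 x)
  also have "(\<Sum>j\<le>degree A. c j * fls_X ^ j) = (\<Sum>j\<in>J. c j * fls_X ^ j)"
    by (rule sum.mono_neutral_right) (auto simp: J_def)
  finally have S: "(\<Sum>j\<in>J. c j * fls_X ^ j) = 0" using 0 by simp
  have "c (degree A) \<noteq> 0" using A x by (simp add: c_def evf_eq_0)
  hence J: "J \<noteq> {}" "finite J" by (auto simp: J_def)
  then obtain i where i: "i \<in> J" "\<And>j. j \<in> J \<Longrightarrow> n i \<le> n j"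
    using arg_min_if_finite(1)[OF J(2,1), of n] arg_min_least[OF J(2,1), of _ n] by metis
  have nj: "(c j * fls_X ^ j) $$ n i = 0" if j: "j \<in> J" "j \<noteq> i" for j
  proof -
    have "n i \<noteq> n j"
    proof
      assume "n i = n j"
      moreover have "int q dvd fls_subdegree (c j) - fls_subdegree (c i)"
        unfolding c_def using subdegree_evf[OF x] by auto
      moreover have "fls_subdegree (c j) - fls_subdegree (c i) = int i - int j"
        using \<open>n i = n j\<close> by (simp add: n_def)
      ultimately have "int q dvd int i - int j" by simp
      moreover have "\<bar>int i - int j\<bar> < int q" using i j A by (auto simp: J_def)
      ultimately show False using j dvd_imp_le_int[of "int i - int j" "int q"] by auto
    qed
    hence "n i < n j" using i(2)[OF j(1)] by simp
    moreover have "fls_subdegree (c j * fls_X ^ j) = n j" using j by (simp add: n_def J_def)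
    ultimately show ?thesis by simp
  qed
  have "0 = (\<Sum>j\<in>J. c j * fls_X ^ j) $$ n i" by (simp add: S)
  also have "\<dots> = (\<Sum>j\<in>J. (c j * fls_X ^ j) $$ n i)" by (rule fls_nth_sum)
  also have "\<dots> = (c i * fls_X ^ i) $$ n i"
    using J i nj by (subst sum.remove[of _ i]) auto
  also have "\<dots> \<noteq> 0"
  proof -
    have ci: "c i \<noteq> 0" using i by (simp add: J_def)
    hence "n i = fls_subdegree (c i * fls_X ^ i)" by (simp add: n_def)
    thus ?thesis using ci by (metis nth_fls_subdegree_nonzero mult_eq_0_iff fls_X_pow_nonzero)
  qed
  finally show False by simp
qed

text \<open>One of the factors vanishes on the branch on which y is the parameter and x has order q,
  so its degree is at least q. Its cofactor then has degree at most 1, and degree 1 would give a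
  root in K(x).\<close>

lemma Fpol_irreducible:
  assumes F: "Fpol = A * B"
  shows "degree A = 0 \<or> degree B = 0"
proof -
  obtain h where h: "ge 0 h" "h $$ 0 = (1 - lam) / 2" "G fls_X (fls_X ^ q * h) = 0"
    using exists_node_branch by blast
  have "(1 - lam) / 2 \<noteq> 0" using lam_neq_1 by simp
  hence "h $$ 0 \<noteq> 0" by (simp only: h(2) simp_thms)
  note x = node_branch_transc[OF h(1) this]
  let ?x = "fls_X ^ q * h"
  have nz: "A \<noteq> 0" "B \<noteq> 0" using F degree_Fpol by auto
  have d: "degree A + degree B = Suc q" using F degree_Fpol nz by (metis degree_mult_eq)
  have lin: "degree C \<noteq> 1" if "Fpol = C * D" for C D
  proof
    assume "degree C = 1"
    then obtain a b where C: "C = [:b, a:]" "a \<noteq> 0" using degree1_coeffs by blast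
    hence "poly Fpol (- b / a) = 0" by (simp add: that)
    thus False using no_rational_root by blast
  qed
  have "evr A ?x fls_X * evr B ?x fls_X = 0"
    using evr_Fpol[OF x(2), of fls_X] h(3) Gf_sym[of q "K lam" fls_X] F x(2) by (simp add: evr_mult)
  hence "degree A \<ge> q \<or> degree B \<ge> q"
    using low_degree_nonzero_on_branch[OF x] nz by (meson mult_eq_0_iff not_less)
  moreover have "degree A \<noteq> 1" "degree B \<noteq> 1" using lin[of A B] lin[of B A] F by (auto simp: mult.commute)
  ultimately show ?thesis using d by linarith
qed

text \<open>Euclid's algorithm: by irreducibility the remainder of \<open>Fpol\<close> modulo a
  nonconstant \<open>r\<close> is nonzero, and an inverse of this remainder yields one of
  \<open>r\<close>.\<close>

lemma inverse_mod_Fpol_aux: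
  assumes "r \<noteq> 0" "degree r \<le> q"
  shows "\<exists>m. Fpol dvd r * m - 1"
  using assms
proof (induction "degree r" arbitrary: r rule: less_induct)
  case less
  show ?case
  proof (cases "degree r = 0")
    case True
    then obtain c where c: "r = [:c:]" by (auto elim: degree_eq_zeroE)
    hence "r * [:1 / c:] - 1 = 0" using less by (simp add: one_pCons)
    thus ?thesis by (metis dvd_0_right)
  next
    case False
    define s k where "s = Fpol mod r" and "k = Fpol div r"
    have F: "Fpol = r * k + s" by (simp add: s_def k_def)
    have s: "s \<noteq> 0"
    proof
      assume "s = 0"
      hence "Fpol = r * k" using F by simp
      moreover from this have "k \<noteq> 0" "degree k = 0" using Fpol_irreducible[of r k] False degree_Fpol by auto
      ultimately have "degree r = Suc q" using degree_Fpol less(2) degree_mult_eq[of r k] by simp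
      thus False using less by simp
    qed
    have "degree s < degree r" using degree_mod_less[of r Fpol] s less by (auto simp: s_def)
    then obtain m where m: "Fpol dvd s * m - 1" using less s by force
    have "r * (- k * m) - 1 = (s * m - 1) - Fpol * m" by (simp add: F algebra_simps)
    hence "Fpol dvd r * (- k * m) - 1" using m by (metis dvd_diff dvd_triv_left)
    thus ?thesis by blast
  qed
qed

lemma Fpol_nonzero: "Fpol \<noteq> 0" using degree_Fpol by auto

lemma degree_mod_Fpol: "degree (r mod Fpol) \<le> q"
  using degree_mod_less[OF Fpol_nonzero, of r] degree_Fpol by auto

lemma mod_Fpol_eq: "degree r \<le> q \<Longrightarrow> r mod Fpol = r"
  using degree_Fpol by (intro mod_poly_less) simp

lemma inverse_mod_Fpol:
  assumes "\<not> Fpol dvd r"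
  shows "\<exists>m. Fpol dvd r * m - 1"
proof -
  have "r mod Fpol \<noteq> 0" using assms by (auto simp: dvd_eq_mod_eq_0)
  then obtain m where m: "Fpol dvd (r mod Fpol) * m - 1"
    using inverse_mod_Fpol_aux degree_mod_Fpol by blast
  have "r * m - 1 = ((r mod Fpol) * m - 1) + Fpol * ((r div Fpol) * m)"
  proof -
    have "r * m = (Fpol * (r div Fpol) + r mod Fpol) * m" by (simp only: mult_div_mod_eq)
    thus ?thesis by (simp only: algebra_simps)
  qed
  thus ?thesis using m by (metis dvd_add dvd_triv_left)
qed

section \<open>Embeddings of the function field into the field of Laurent series\<close>

text \<open>These homomorphisms parametrize the places of the function field. Quantifying over
  all of them makes every condition stated in this way invariant under automorphisms.\<close>

definition emb :: "('a poly fract poly \<Rightarrow> 'a fls) \<Rightarrow> bool" where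
  "emb i \<longleftrightarrow> (\<forall>r s. i (r + s) = i r + i s) \<and> (\<forall>r s. i (r * s) = i r * i s)
     \<and> (\<forall>c. i (kc c) = K c) \<and> i Fpol = 0"

lemma embD:
  assumes "emb i"
  shows emb_add: "i (r + s) = i r + i s" and emb_mult: "i (r * s) = i r * i s"
    and emb_kc: "i (kc c) = K c" and emb_Fpol: "i Fpol = 0"
  using assms by (auto simp: emb_def)

lemma kc_1: "kc 1 = 1" and kc_0: "kc 0 = 0"
  using tf_1 by (simp_all add: kc_def one_pCons)

lemma emb_1: "emb i \<Longrightarrow> i 1 = 1"
  using emb_kc[of i 1] by (simp add: kc_1)
lemma emb_0: "emb i \<Longrightarrow> i 0 = 0"
  using emb_kc[of i 0] by (simp add: kc_0)
lemma emb_diff: "emb i \<Longrightarrow> i (r - s) = i r - i s"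
  using emb_add[of i "r - s" s] by simp
lemma emb_uminus: "emb i \<Longrightarrow> i (- s) = - i s"
  using emb_diff[of i 0 s] by (simp add: emb_0)
lemma emb_power: "emb i \<Longrightarrow> i (r ^ n) = i r ^ n"
  by (induction n) (auto simp: emb_1 emb_mult)

lemmas emb_simps = emb_add emb_diff emb_mult emb_power emb_kc emb_1 emb_uminus

lemma emb_cong: "emb i \<Longrightarrow> Fpol dvd r - s \<Longrightarrow> i r = i s"
  by (auto simp: dvd_def emb_mult emb_Fpol emb_diff dest!: arg_cong[of _ _ i])

lemma emb_mod: "emb i \<Longrightarrow> i (r mod Fpol) = i r"
  by (rule emb_cong) (auto simp: mod_eq_dvd_iff[symmetric] simp del: mod_eq_dvd_iff intro: mod_eq_dvd_iff[THEN iffD1])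

lemma emb_G: "emb i \<Longrightarrow> G (i xf) (i yf) = 0"
proof -
  assume i: "emb i"
  have "i Fpol = G (i xf) (i yf)" unfolding Fpol_eq_Gf
    by (subst Gf_hom) (auto simp: emb_add i emb_mult emb_1 emb_kc)
  thus ?thesis using i by (simp add: emb_Fpol)
qed

text \<open>Homomorphisms out of a field are injective. Thus an identity in the function field may
  be verified under a single embedding and then holds under all of them.\<close>

lemma emb_eq_0_iff:
  assumes i: "emb i"
  shows "i r = 0 \<longleftrightarrow> Fpol dvd r"
proof
  assume 0: "i r = 0"
  show "Fpol dvd r"
  proof (rule ccontr)
    assume "\<not> Fpol dvd r"
    then obtain m where "Fpol dvd r * m - 1" using inverse_mod_Fpol by blast
    hence "i (r * m) = i 1" using emb_cong[OF i] by blast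
    thus False using 0 i by (simp add: emb_mult emb_1)
  qed
qed (auto simp: dvd_def emb_mult[OF i] emb_Fpol[OF i])

lemma emb_eq_iff: "emb i \<Longrightarrow> i r = i s \<longleftrightarrow> Fpol dvd r - s"
  using emb_eq_0_iff[of i "r - s"] by (simp add: emb_diff)

lemma emb_inj:
  assumes "emb i" "degree r \<le> q" "degree s \<le> q" "i r = i s"
  shows "r = s"
proof -
  have "Fpol dvd r - s" using assms emb_eq_iff by blast
  moreover have "degree (r - s) \<le> q" using assms by (intro degree_diff_le) auto
  ultimately show ?thesis using degree_Fpol dvd_imp_degree_le[of Fpol "r - s"] by force
qed

lemma emb_poly: "emb i \<Longrightarrow> i [:tf a:] = evp a (i xf)"
proof (induction a)
  case (pCons c a)
  have "[:tf (pCons c a):] = kc c + xf * [:tf a:]"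
    by (simp add: kc_def xf_def flip: tf_mult tf_add)
  hence "i [:tf (pCons c a):] = K c + i xf * i [:tf a:]"
    using pCons.prems by (simp only: emb_add emb_mult emb_kc)
  thus ?case using pCons by (simp add: evp_pCons)
qed (auto simp: emb_0)

lemma emb_transc: "emb i \<Longrightarrow> transc (i xf)"
  unfolding transc_def
proof safe
  fix p :: "'a poly" assume i: "emb i" and p: "p \<noteq> 0" "evp p (i xf) = 0"
  have "[:tf p:] * [:1 / tf p:] = 1" using p by (simp add: one_pCons)
  hence "i [:tf p:] * i [:1 / tf p:] = 1" using i by (metis emb_mult emb_1)
  thus False using p i by (simp add: emb_poly)
qed

lemma emb_transc_y: "emb i \<Longrightarrow> transc (i yf)"
  using transc_point emb_G emb_transc by blast

lemma emb_const: "emb i \<Longrightarrow> i [:r:] = evf r (i xf)"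
proof -
  assume i: "emb i"
  obtain a b where r: "r = Fract a b" "b \<noteq> 0" by (cases r) auto
  have "[:r:] * [:tf b:] = [:tf a:]" using r by (simp add: Fract_eq_tf_div)
  hence "i [:r:] * evp b (i xf) = evp a (i xf)" using i by (metis emb_mult emb_poly)
  moreover have "evp b (i xf) \<noteq> 0" using emb_transc[OF i] r by (simp add: transc_evp_eq_0)
  ultimately show ?thesis using emb_transc[OF i] r by (simp add: evf_Fract field_simps)
qed

lemma emb_eq_evr: "emb i \<Longrightarrow> i r = evr r (i xf) (i yf)"
proof (induction r)
  case 0 thus ?case by (simp add: emb_0 evr_0)
next
  case (pCons a r)
  have "pCons a r = [:a:] + yf * r" by (simp add: yf_def)
  hence "i (pCons a r) = evf a (i xf) + i yf * i r" using pCons by (simp only: emb_add emb_mult emb_const)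
  thus ?case using pCons emb_transc by (simp add: evr_pCons)
qed

text \<open>Converse of \<open>emb_G\<close> and \<open>emb_transc\<close>: embeddings are the same
  as Laurent series points of the curve with transcendental x-coordinate.\<close>

lemma emb_evr: "transc x \<Longrightarrow> G x y = 0 \<Longrightarrow> emb (\<lambda>r. evr r x y)"
  by (simp add: emb_def evr_add evr_mult evr_kc evr_Fpol)

lemma emb_map_poly: "emb i \<Longrightarrow> i (map_poly tf P) = ev2 P (i xf) (i yf)"
proof (induction P)
  case (pCons a P)
  have "map_poly tf (pCons a P) = [:tf a:] + yf * map_poly tf P" by (simp add: yf_def map_poly_pCons)
  thus ?case using pCons by (simp add: emb_add emb_mult emb_poly ev2_pCons)
qed (auto simp: emb_0)

lemma emb_eqI: "emb i \<Longrightarrow> emb j \<Longrightarrow> i xf = j xf \<Longrightarrow> i yf = j yf \<Longrightarrow> i = j"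
  by (rule ext) (metis emb_eq_evr)

lemma emb_exists: "\<exists>i. emb i"
proof -
  obtain h where h: "ge 0 h" "h $$ 0 = (1 - lam) / 2" "G fls_X (fls_X ^ q * h) = 0"
    using exists_node_branch by blast
  have "fls_X \<notin> range (K :: 'a \<Rightarrow> _)" by (metis fls_X_subdegree fls_const_subdegree imageE zero_neq_one)
  hence "transc (fls_X :: 'a fls)" by (rule transcI[OF alg_closed])
  thus ?thesis using emb_evr h by blast
qed

lemma degree_xf: "degree xf = 0" and degree_yf: "degree yf = 1" and degree_kc: "degree (kc c) = 0"
  by (simp_all add: xf_def yf_def kc_def)

section \<open>Automorphisms\<close>

abbreviation "AutX \<equiv> Aut q lam"

lemma Fpol_in_FF: "r mod Fpol \<in> FF q lam" using degree_mod_Fpol FF_iff by blast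
lemma xf_in_FF: "xf \<in> FF q lam" and yf_in_FF: "yf \<in> FF q lam" and kc_in_FF: "kc c \<in> FF q lam"
  using q_gt_1 by (auto simp: FF_iff degree_xf degree_yf degree_kc)
lemma FF_mod: "r \<in> FF q lam \<Longrightarrow> r mod Fpol = r" using mod_Fpol_eq FF_iff by blast
lemma fmul_eq: "fmul q lam r s = (r * s) mod Fpol" by (simp add: fmul_def Fy_eq_Fpol)
lemma FF_inj: "emb i \<Longrightarrow> r \<in> FF q lam \<Longrightarrow> s \<in> FF q lam \<Longrightarrow> i r = i s \<Longrightarrow> r = s"
  using emb_inj FF_iff by blast

lemma AutD:
  assumes "s \<in> AutX"
  shows "bij_betw s (FF q lam) (FF q lam)" "\<And>r t. r \<in> FF q lam \<Longrightarrow> t \<in> FF q lam \<Longrightarrow> s (r + t) = s r + s t"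
    "\<And>r t. r \<in> FF q lam \<Longrightarrow> t \<in> FF q lam \<Longrightarrow> s (fmul q lam r t) = fmul q lam (s r) (s t)"
    "\<And>c. s (kc c) = kc c" "\<And>r. r \<notin> FF q lam \<Longrightarrow> s r = r"
  using assms unfolding Aut_def by auto

lemma Aut_in_FF: "s \<in> AutX \<Longrightarrow> r \<in> FF q lam \<Longrightarrow> s r \<in> FF q lam"
  using AutD(1) bij_betwE by blast

text \<open>An automorphism in the sense of \<open>Aut\<close> is meaningful on reduced representatives only, whence the
  reduction modulo \<open>Fpol\<close>.\<close>

definition act :: "('a poly fract poly \<Rightarrow> 'a poly fract poly) \<Rightarrow> ('a poly fract poly \<Rightarrow> 'a fls)
    \<Rightarrow> 'a poly fract poly \<Rightarrow> 'a fls" where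
  "act s i = (\<lambda>r. i (s (r mod Fpol)))"

lemma act_FF: "r \<in> FF q lam \<Longrightarrow> act s i r = i (s r)"
  by (simp add: act_def FF_mod)

lemma act_xf: "act s i xf = i (s xf)" and act_yf: "act s i yf = i (s yf)"
  by (simp_all add: act_FF xf_in_FF yf_in_FF)

lemma emb_act:
  assumes s: "s \<in> AutX" and i: "emb i"
  shows "emb (act s i)"
  unfolding emb_def
proof (intro conjI allI)
  fix r t c
  show "act s i (r + t) = act s i r + act s i t"
    by (simp add: act_def poly_mod_add_left AutD(2)[OF s Fpol_in_FF Fpol_in_FF] emb_add[OF i])
  have "(r * t) mod Fpol = fmul q lam (r mod Fpol) (t mod Fpol)" by (simp add: fmul_eq mod_mult_eq)
  hence "act s i (r * t) = i ((s (r mod Fpol) * s (t mod Fpol)) mod Fpol)"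
    by (simp only: act_def AutD(3)[OF s Fpol_in_FF Fpol_in_FF]) (simp only: fmul_eq)
  thus "act s i (r * t) = act s i r * act s i t" by (simp add: emb_mod[OF i] emb_mult[OF i] act_def)
  show "act s i (kc c) = K c" by (simp add: act_FF kc_in_FF AutD(4)[OF s] emb_kc[OF i])
  have "s 0 = 0" using AutD(4)[OF s, of 0] by (simp add: kc_0)
  thus "act s i Fpol = 0" by (simp add: act_def emb_0[OF i])
qed

lemma Aut_eqI:
  assumes s: "s \<in> AutX" and t: "t \<in> AutX" and i: "emb i"
    and "i (s xf) = i (t xf)" "i (s yf) = i (t yf)"
  shows "s = t"
proof
  fix r
  have "act s i = act t i" using assms by (intro emb_eqI emb_act) (auto simp: act_xf act_yf)
  hence "i (s r) = i (t r)" if "r \<in> FF q lam" using that by (metis act_FF)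
  thus "s r = t r" using FF_inj[OF i] Aut_in_FF[OF s] Aut_in_FF[OF t] AutD(5)[OF s] AutD(5)[OF t]
    by (cases "r \<in> FF q lam") auto
qed

lemma fmul_in_FF: "fmul q lam r s \<in> FF q lam" by (simp add: fmul_eq Fpol_in_FF)

lemma add_in_FF: "r \<in> FF q lam \<Longrightarrow> s \<in> FF q lam \<Longrightarrow> r + s \<in> FF q lam"
  by (auto simp: FF_iff intro: degree_add_le)

lemma id_in_Aut: "id \<in> AutX" by (auto simp: Aut_def)

lemma comp_in_Aut:
  assumes s: "s \<in> AutX" and t: "t \<in> AutX"
  shows "s \<circ> t \<in> AutX"
  unfolding Aut_def
  using bij_betw_trans[OF AutD(1)[OF t] AutD(1)[OF s]] AutD(2-5)[OF s] AutD(2-5)[OF t]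
    Aut_in_FF[OF t] by auto

lemma inv_in_Aut:
  assumes s: "s \<in> AutX"
  shows "inv_aut q lam s \<in> AutX"
    and "r \<in> FF q lam \<Longrightarrow> s (inv_aut q lam s r) = r"
    and "r \<in> FF q lam \<Longrightarrow> inv_aut q lam s (s r) = r"
proof -
  let ?t = "inv_aut q lam s"
  note b = AutD(1)[OF s]
  show st: "s (?t r) = r" if "r \<in> FF q lam" for r
    using that b by (simp add: inv_aut_def bij_betw_def f_inv_into_f)
  show ts: "?t (s r) = r" if "r \<in> FF q lam" for r
    using that b Aut_in_FF[OF s] by (simp add: inv_aut_def bij_betw_def)
  have bt: "bij_betw ?t (FF q lam) (FF q lam)"
    using bij_betw_inv_into[OF b] by (rule bij_betw_cong[THEN iffD1, rotated]) (simp add: inv_aut_def)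
  have tF: "?t r \<in> FF q lam" if "r \<in> FF q lam" for r using bt that bij_betwE by blast
  have inj: "r = u" if "r \<in> FF q lam" "u \<in> FF q lam" "s r = s u" for r u
    using that b by (metis ts)
  show "?t \<in> AutX" unfolding Aut_def
  proof (intro CollectI conjI ballI allI impI)
    show "bij_betw ?t (FF q lam) (FF q lam)" by (rule bt)
    fix r u assume ru: "r \<in> FF q lam" "u \<in> FF q lam"
    show "?t (r + u) = ?t r + ?t u"
      by (rule inj) (auto simp: ru tF add_in_FF st AutD(2)[OF s])
    show "?t (fmul q lam r u) = fmul q lam (?t r) (?t u)"
      by (rule inj) (auto simp: ru tF fmul_in_FF st AutD(3)[OF s])
  next
    fix c show "?t (kc c) = kc c" using ts[OF kc_in_FF, of c] AutD(4)[OF s] by simp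
  next
    fix r assume "r \<notin> FF q lam" thus "?t r = r" by (simp add: inv_aut_def)
  qed
qed

section \<open>Construction of automorphisms\<close>

definition subfield_fls :: "'a fls set \<Rightarrow> bool" where
  "subfield_fls S \<longleftrightarrow> (\<forall>c. K c \<in> S) \<and> (\<forall>u\<in>S. \<forall>v\<in>S. u + v \<in> S \<and> u * v \<in> S) \<and> (\<forall>u\<in>S. inverse u \<in> S)"

lemma subfield_evr:
  assumes S: "subfield_fls S" and x: "transc x" "x \<in> S" and y: "y \<in> S"
  shows "evr r x y \<in> S"
proof -
  have c: "K c \<in> S" and a: "u \<in> S \<Longrightarrow> v \<in> S \<Longrightarrow> u + v \<in> S"
    and m: "u \<in> S \<Longrightarrow> v \<in> S \<Longrightarrow> u * v \<in> S" and i: "u \<in> S \<Longrightarrow> inverse u \<in> S" for u v c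
    using S by (auto simp: subfield_fls_def)
  have p: "evp p x \<in> S" for p
    by (induction p) (use c[of 0] x in \<open>auto simp: evp_pCons intro!: a m c\<close>)
  have f: "evf r x \<in> S" for r
  proof -
    obtain a b where r: "r = Fract a b" "b \<noteq> 0" by (cases r) auto
    thus ?thesis using p x by (auto simp: evf_Fract divide_inverse intro!: m i)
  qed
  show ?thesis
    by (induction r) (use c[of 0] x y in \<open>auto simp: evr_0 evr_pCons intro!: a m f\<close>)
qed

lemma subfield_range_emb:
  assumes i: "emb i"
  shows "subfield_fls (range i)"
  unfolding subfield_fls_def
proof (intro conjI ballI allI)
  fix c show "K c \<in> range i" using emb_kc[OF i] by (metis rangeI)
next
  fix u v assume "u \<in> range i" "v \<in> range i"
  thus "u + v \<in> range i" "u * v \<in> range i" by (auto simp flip: emb_add[OF i] emb_mult[OF i])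
next
  fix u assume "u \<in> range i"
  then obtain r where r: "u = i r" by blast
  show "inverse u \<in> range i"
  proof (cases "u = 0")
    case True thus ?thesis using emb_0[OF i] by (metis inverse_zero rangeI)
  next
    case False
    hence "\<not> Fpol dvd r" using r emb_eq_0_iff[OF i] by blast
    then obtain m where "Fpol dvd r * m - 1" using inverse_mod_Fpol by blast
    hence "i (r * m) = i 1" by (rule emb_cong[OF i])
    hence "u * i m = 1" using r by (simp add: emb_simps[OF i])
    thus ?thesis by (metis inverse_unique rangeI)
  qed
qed

text \<open>If a second point (x, y) generates the same subfield of the Laurent series as the point
  of \<open>i\<close>, then evaluation at (x, y) followed by the inverse of \<open>i\<close> is an
  automorphism.\<close>

lemma exists_Aut:
  assumes i: "emb i" and x: "transc x" and G: "G x y = 0" and r: "x \<in> range i" "y \<in> range i"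
    and surj: "i xf \<in> range (\<lambda>r. evr r x y)" "i yf \<in> range (\<lambda>r. evr r x y)"
  shows "\<exists>s\<in>AutX. i (s xf) = x \<and> i (s yf) = y"
proof -
  define j where "j = (\<lambda>r. evr r x y)"
  have j: "emb j" unfolding j_def using x G by (rule emb_evr)
  have "\<exists>s. s \<in> FF q lam \<and> i s = j r" for r
  proof -
    have "j r \<in> range i" unfolding j_def by (rule subfield_evr[OF subfield_range_emb[OF i] x r])
    thus ?thesis using Fpol_in_FF emb_mod[OF i] by (metis imageE)
  qed
  then obtain f where f: "\<And>r. f r \<in> FF q lam" "\<And>r. i (f r) = j r" by metis
  define s where "s r = (if r \<in> FF q lam then f r else r)" for r
  have sF: "s r \<in> FF q lam" and isr: "i (s r) = j r" if "r \<in> FF q lam" for r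
    using f that by (auto simp: s_def)
  have "s \<in> AutX" unfolding Aut_def
  proof (intro CollectI conjI ballI allI impI)
    show "bij_betw s (FF q lam) (FF q lam)" unfolding bij_betw_def
    proof
      show "inj_on s (FF q lam)" using FF_inj[OF j] isr by (intro inj_onI) metis
      have "u \<in> s ` FF q lam" if u: "u \<in> FF q lam" for u
      proof -
        have "i u = evr u (i xf) (i yf)" by (rule emb_eq_evr[OF i])
        also have "\<dots> \<in> range j"
          using surj by (intro subfield_evr[OF subfield_range_emb[OF j] emb_transc[OF i]]) (auto simp: j_def)
        finally obtain r where "i u = j r" by blast
        hence "i u = i (s (r mod Fpol))" using isr[OF Fpol_in_FF] emb_mod[OF j] by simp
        hence "u = s (r mod Fpol)" using FF_inj[OF i u] sF[OF Fpol_in_FF] by blast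
        thus ?thesis using Fpol_in_FF by blast
      qed
      thus "s ` FF q lam = FF q lam" using sF by auto
    qed
    fix r t assume rt: "r \<in> FF q lam" "t \<in> FF q lam"
    show "s (r + t) = s r + s t"
      by (rule FF_inj[OF i]) (auto simp: rt sF add_in_FF isr emb_add[OF i] emb_add[OF j])
    show "s (fmul q lam r t) = fmul q lam (s r) (s t)"
      by (rule FF_inj[OF i])
         (auto simp: rt sF fmul_in_FF isr, simp add: fmul_eq emb_mod[OF i] emb_mod[OF j] emb_mult[OF i]
             emb_mult[OF j] rt isr)
  next
    fix c show "s (kc c) = kc c"
      by (rule FF_inj[OF i]) (auto simp: kc_in_FF sF isr emb_kc[OF i] emb_kc[OF j])
  next
    fix r assume "r \<notin> FF q lam" thus "s r = r" by (simp add: s_def)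
  qed
  moreover have "i (s xf) = x" "i (s yf) = y"
    using x by (simp_all add: isr xf_in_FF yf_in_FF, simp_all add: j_def evr_xf evr_yf)
  ultimately show ?thesis by blast
qed

lemma transcI': "x \<notin> range K \<Longrightarrow> transc x" for x :: "'a fls"
  by (rule transcI[OF alg_closed])

lemma range_evr:
  assumes "transc x"
  shows "x \<in> range (\<lambda>r. evr r x y)" "y \<in> range (\<lambda>r. evr r x y)"
  using evr_xf[OF assms] evr_yf[OF assms] by (metis rangeI)+

lemma subfield_range_evr:
  assumes "transc x" "G x y = 0"
  shows "subfield_fls (range (\<lambda>r. evr r x y))"
  using emb_evr[OF assms] by (rule subfield_range_emb)

lemma exists_swap: "\<exists>s\<in>AutX. s xf = yf \<and> s yf = xf"
proof -
  obtain i where i: "emb i" using emb_exists by blast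
  have "G (i yf) (i xf) = 0" using emb_G[OF i] Gf_sym by metis
  then obtain s where s: "s \<in> AutX" "i (s xf) = i yf" "i (s yf) = i xf"
    using exists_Aut[OF i emb_transc_y[OF i], of "i xf"] range_evr[OF emb_transc_y[OF i]] by blast
  thus ?thesis using FF_inj[OF i] Aut_in_FF[OF s(1)] xf_in_FF yf_in_FF by blast
qed

lemma Gf_scale:
  fixes x y l m :: "'b::comm_ring_1"
  assumes "m ^ q = m"
  shows "Gf q l (m * x) (m * y) = m ^ 2 * Gf q l x y"
  by (simp add: Gf_def power_mult_distrib assms power2_eq_square algebra_simps)

lemma kc_mult_in_FF: "r \<in> FF q lam \<Longrightarrow> kc m * r \<in> FF q lam"
  using degree_mult_le[of "kc m" r] by (simp add: FF_iff degree_kc)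

lemma exists_affine:
  assumes m: "m \<in> Fq q - {0}" and c: "c \<in> Fq q"
  shows "\<exists>s\<in>AutX. s xf = kc m * xf + kc c \<and> s yf = kc m * yf + kc c"
proof -
  obtain i where i: "emb i" using emb_exists by blast
  let ?f = "\<lambda>u. K m * u + K c"
  have m0: "m \<noteq> 0" and mc: "m ^ q = m" "c ^ q = c" using m c by (auto simp: Fq_def)
  have "G (?f (i xf)) (?f (i yf)) = G (K m * i xf) (K m * i yf)"
    by (rule Gf_translate) (auto simp: frob_fls_const mc)
  also have "\<dots> = 0" using emb_G[OF i] by (subst Gf_scale) (auto simp: frob_fls_const mc)
  finally have G: "G (?f (i xf)) (?f (i yf)) = 0" .
  have inv: "K (1 / m) * (?f u + K (- c)) = u" for u
    using m0 by (simp flip: mult.assoc)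
  have x: "transc (?f (i xf))"
  proof (rule transcI', rule)
    assume "?f (i xf) \<in> range K"
    then obtain d where "?f (i xf) = K d" by blast
    hence "i xf = K (1 / m) * (K d + K (- c))" using inv[of "i xf"] by metis
    also have "\<dots> = K (1 / m * (d + - c))" by (simp only: fls_plus_const fls_const_mult_const)
    finally show False using transc_not_const emb_transc[OF i] by blast
  qed
  let ?R = "range (\<lambda>r. evr r (?f (i xf)) (?f (i yf)))"
  have sub: "u \<in> ?R" if "?f u \<in> ?R" for u
  proof -
    have "K (1 / m) * (?f u + K (- c)) \<in> ?R"
      using subfield_range_evr[OF x G] that unfolding subfield_fls_def by blast
    thus ?thesis unfolding inv .
  qed
  have xy: "?f (i xf) = i (kc m * xf + kc c)" "?f (i yf) = i (kc m * yf + kc c)"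
    by (simp_all add: emb_simps[OF i])
  obtain s where s: "s \<in> AutX" "i (s xf) = ?f (i xf)" "i (s yf) = ?f (i yf)"
    using exists_Aut[OF i x G] sub[OF range_evr(1)[OF x]] sub[OF range_evr(2)[OF x]] xy by (metis rangeI)
  have "s xf = kc m * xf + kc c" "s yf = kc m * yf + kc c"
    using s xy by (auto intro!: FF_inj[OF i] Aut_in_FF[OF s(1)] xf_in_FF yf_in_FF kc_in_FF add_in_FF kc_mult_in_FF)
  thus ?thesis using s by blast
qed

lemma exists_translation:
  assumes c: "c \<in> Fq q"
  shows "\<exists>s\<in>Hgens q lam. s xf = xf + kc c \<and> s yf = yf + kc c"
proof -
  have "(1 :: 'a) \<in> Fq q - {0}" by (simp add: Fq_def)
  from exists_affine[OF this c] show ?thesis using c unfolding Hgens_def kc_1 mult_1 by blast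
qed

lemma exists_scaling:
  assumes m: "m \<in> Fq q - {0}"
  shows "\<exists>s\<in>Hgens q lam. s xf = kc m * xf \<and> s yf = kc m * yf"
proof -
  have "(0 :: 'a) \<in> Fq q" using q_gt_1 by (simp add: Fq_def)
  from exists_affine[OF m this] show ?thesis using m unfolding Hgens_def kc_0 add_0_right by blast
qed

lemma one_in_FF: "1 \<in> FF q lam" by (simp add: FF_iff)

lemma exists_inversion:
  "\<exists>s\<in>Hgens q lam. fmul q lam (s xf) xf = 1 \<and> fmul q lam (s yf) yf = 1"
proof -
  obtain i where i: "emb i" using emb_exists by blast
  let ?x = "1 / i xf" and ?y = "1 / i yf"
  have nz: "i xf \<noteq> 0" "i yf \<noteq> 0" using emb_transc[OF i] emb_transc_y[OF i] transc_nonzero by auto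
  hence G: "G ?x ?y = 0"
    using Gf_inverse[OF nz, of q "K lam"] emb_G[OF i] by simp
  have x: "transc ?x"
  proof (rule transcI', rule)
    assume "?x \<in> range K"
    then obtain d where d: "?x = K d" by blast
    hence "d \<noteq> 0" using nz by auto
    have 1: "K d * K (1 / d) = 1" using \<open>d \<noteq> 0\<close> by simp
    have "i xf * (K d * K (1 / d)) = (i xf * ?x) * K (1 / d)"
      by (simp only: d mult.assoc)
    hence "i xf = K (1 / d)" unfolding 1 using nz by simp
    thus False using transc_not_const emb_transc[OF i] by blast
  qed
  have inv: "inverse u \<in> range j" if "u \<in> range j" "emb j" for u j
    using subfield_range_emb[OF that(2)] that(1) unfolding subfield_fls_def by blast
  have r: "?x \<in> range i" "?y \<in> range i"
    using inv[OF _ i, of "i xf"] inv[OF _ i, of "i yf"] by (auto simp: divide_inverse)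
  have r': "i xf \<in> range (\<lambda>r. evr r ?x ?y)" "i yf \<in> range (\<lambda>r. evr r ?x ?y)"
    using inv[OF range_evr(1)[OF x] emb_evr[OF x G]] inv[OF range_evr(2)[OF x] emb_evr[OF x G]]
    by (auto simp: divide_inverse)
  obtain s where s: "s \<in> AutX" "i (s xf) = ?x" "i (s yf) = ?y"
    using exists_Aut[OF i x G r r'] by blast
  have "fmul q lam (s xf) xf = 1" "fmul q lam (s yf) yf = 1"
    using s nz by (auto intro!: FF_inj[OF i] fmul_in_FF one_in_FF simp: fmul_eq emb_mod[OF i] emb_mult[OF i] emb_1[OF i])
      (auto simp: FF_iff degree_mod_Fpol)
  thus ?thesis using s unfolding Hgens_def by blast
qed

section \<open>Automorphisms acting diagonally by Moebius transformations\<close>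

definition moebius_type :: "'a \<Rightarrow> 'a \<Rightarrow> 'a \<Rightarrow> 'a \<Rightarrow> ('a poly fract poly \<Rightarrow> 'a poly fract poly) \<Rightarrow> bool" where
  "moebius_type a b c d s \<longleftrightarrow> (\<forall>i. emb i \<longrightarrow>
     i (s xf) * (K c * i xf + K d) = K a * i xf + K b \<and>
     i (s yf) * (K c * i yf + K d) = K a * i yf + K b)"

definition in_PGL :: "('a poly fract poly \<Rightarrow> 'a poly fract poly) \<Rightarrow> bool" where
  "in_PGL s \<longleftrightarrow> (\<exists>a\<in>Fq q. \<exists>b\<in>Fq q. \<exists>c\<in>Fq q. \<exists>d\<in>Fq q. a * d \<noteq> b * c \<and> moebius_type a b c d s)"

lemma in_PGLI:
  "a \<in> Fq q \<Longrightarrow> b \<in> Fq q \<Longrightarrow> c \<in> Fq q \<Longrightarrow> d \<in> Fq q \<Longrightarrow> a * d \<noteq> b * c \<Longrightarrow> moebius_type a b c d s \<Longrightarrow> in_PGL s"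
  unfolding in_PGL_def by blast

lemma Fq_0: "(0 :: 'a) \<in> Fq q" and Fq_1: "(1 :: 'a) \<in> Fq q"
  using q_gt_1 by (auto simp: Fq_def)

lemma Fq_closed:
  fixes a b :: 'a
  assumes "a \<in> Fq q" "b \<in> Fq q"
  shows "a + b \<in> Fq q" "a * b \<in> Fq q" "a - b \<in> Fq q" "- a \<in> Fq q" "a / b \<in> Fq q"
proof -
  have "0 - a \<in> Fq q" using assms frobenius_diff[of 0 a] q_gt_1 by (simp add: Fq_def power_0_left)
  thus "- a \<in> Fq q" by simp
qed (use assms in \<open>auto simp: Fq_def frobenius_add frobenius_diff power_mult_distrib power_divide\<close>)

lemma linear_nonzero:
  fixes c d :: 'a
  assumes "transc x" "c \<noteq> 0 \<or> d \<noteq> 0"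
  shows "K c * x + K d \<noteq> 0"
proof -
  have "evp [:d, c:] x \<noteq> 0" using assms by (subst transc_evp_eq_0) auto
  thus ?thesis by (simp add: evp_pCons algebra_simps)
qed

lemma moebius_type_unique:
  assumes s: "s \<in> AutX" and t: "t \<in> AutX" and "a * d \<noteq> b * c"
    and S: "moebius_type a b c d s" and T: "moebius_type a b c d t"
  shows "s = t"
proof -
  obtain i where i: "emb i" using emb_exists by blast
  have cd: "c \<noteq> 0 \<or> d \<noteq> 0" using assms by auto
  note nz = linear_nonzero[OF emb_transc[OF i] cd] linear_nonzero[OF emb_transc_y[OF i] cd]
  show ?thesis using S T i nz
    by (intro Aut_eqI[OF s t i]) (auto simp: moebius_type_def dest!: spec[of _ i]
      intro: mult_right_cancel[THEN iffD1, OF nz(1)] mult_right_cancel[THEN iffD1, OF nz(2)])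
qed

lemma moebius_type_id: "moebius_type 1 0 0 1 id"
  by (simp add: moebius_type_def)

text \<open>The matrices multiply in the opposite order: applying \<open>s\<close> to the fraction
  t(x) substitutes s(x) into it.\<close>

lemma moebius_type_comp:
  assumes s: "s \<in> AutX" and S: "moebius_type a' b' c' d' s"
    and t: "t \<in> AutX" and T: "moebius_type a b c d t"
  shows "moebius_type (a * a' + b * c') (a * b' + b * d') (c * a' + d * c') (c * b' + d * d') (s \<circ> t)"
  unfolding moebius_type_def
proof safe
  fix i assume i: "emb i"
  have *: "w * (K (c * a' + d * c') * x + K (c * b' + d * d')) =
      K (a * a' + b * c') * x + K (a * b' + b * d')"
    if 1: "w * (K c * v + K d) = K a * v + K b"
      and 2: "v * (K c' * x + K d') = K a' * x + K b'" for w v x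
  proof -
    have e: "K (k * k' + l * l') = K k * K k' + K l * K l'" for k k' l l' :: 'a
      by (simp add: fls_plus_const)
    have "w * (K (c * a' + d * c') * x + K (c * b' + d * d'))
      = w * (K c * (K a' * x + K b') + K d * (K c' * x + K d'))"
      unfolding e by (simp only: algebra_simps)
    also have "\<dots> = (w * (K c * v + K d)) * (K c' * x + K d')"
      unfolding 2[symmetric] by (simp only: algebra_simps)
    also have "\<dots> = K a * (v * (K c' * x + K d')) + K b * (K c' * x + K d')"
      unfolding 1 by (simp only: algebra_simps)
    also have "\<dots> = K (a * a' + b * c') * x + K (a * b' + b * d')"
      unfolding 2 e by (simp only: algebra_simps)
    finally show ?thesis .
  qed
  have x: "i ((s \<circ> t) xf) = act s i (t xf)" "i ((s \<circ> t) yf) = act s i (t yf)"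
    by (simp_all add: act_FF Aut_in_FF[OF t] xf_in_FF yf_in_FF)
  show "i ((s \<circ> t) xf) * (K (c * a' + d * c') * i xf + K (c * b' + d * d')) =
      K (a * a' + b * c') * i xf + K (a * b' + b * d')"
    unfolding x by (rule *[of _ "i (s xf)"]) (use S T i emb_act[OF s i] in \<open>auto simp: moebius_type_def simp flip: act_xf\<close>)
  show "i ((s \<circ> t) yf) * (K (c * a' + d * c') * i yf + K (c * b' + d * d')) =
      K (a * a' + b * c') * i yf + K (a * b' + b * d')"
    unfolding x by (rule *[of _ "i (s yf)"]) (use S T i emb_act[OF s i] in \<open>auto simp: moebius_type_def simp flip: act_yf\<close>)
qed

lemma moebius_type_inv:
  assumes s: "s \<in> AutX" and S: "moebius_type a b c d s"
  shows "moebius_type d (- b) (- c) a (inv_aut q lam s)"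
  unfolding moebius_type_def
proof (intro allI impI)
  fix i assume i: "emb i"
  let ?t = "inv_aut q lam s"
  note t = inv_in_Aut[OF s]
  have "act ?t i (s xf) = i xf" "act ?t i (s yf) = i yf"
    using t(3) by (simp_all add: act_FF Aut_in_FF[OF s] xf_in_FF yf_in_FF)
  hence "i xf * (K c * i (?t xf) + K d) = K a * i (?t xf) + K b"
    "i yf * (K c * i (?t yf) + K d) = K a * i (?t yf) + K b"
    using S emb_act[OF t(1) i] unfolding moebius_type_def by (metis act_xf act_yf)+
  thus "i (?t xf) * (K (- c) * i xf + K a) = K d * i xf + K (- b) \<and>
    i (?t yf) * (K (- c) * i yf + K a) = K d * i yf + K (- b)"
    by (simp add: algebra_simps eq_diff_eq)
qed

lemma in_PGL_comp:
  assumes s: "s \<in> AutX" "in_PGL s" and t: "t \<in> AutX" "in_PGL t"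
  shows "in_PGL (s \<circ> t)"
proof -
  obtain a' b' c' d' where S: "a' \<in> Fq q" "b' \<in> Fq q" "c' \<in> Fq q" "d' \<in> Fq q" "a' * d' \<noteq> b' * c'"
    "moebius_type a' b' c' d' s" using s unfolding in_PGL_def by blast
  obtain a b c d where T: "a \<in> Fq q" "b \<in> Fq q" "c \<in> Fq q" "d \<in> Fq q" "a * d \<noteq> b * c"
    "moebius_type a b c d t" using t unfolding in_PGL_def by blast
  have "(a * a' + b * c') * (c * b' + d * d') - (a * b' + b * d') * (c * a' + d * c')
    = (a * d - b * c) * (a' * d' - b' * c')" by (simp add: algebra_simps)
  moreover have "\<dots> \<noteq> 0" using S(5) T(5) by simp
  ultimately have "(a * a' + b * c') * (c * b' + d * d') \<noteq> (a * b' + b * d') * (c * a' + d * c')"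
    by (metis right_minus_eq)
  thus ?thesis
    by (rule in_PGLI[OF _ _ _ _ _ moebius_type_comp[OF s(1) S(6) t(1) T(6)], rotated 4])
       (intro Fq_closed S T)+
qed

lemma in_PGL_inv:
  assumes s: "s \<in> AutX" "in_PGL s"
  shows "in_PGL (inv_aut q lam s)"
proof -
  obtain a b c d where S: "a \<in> Fq q" "b \<in> Fq q" "c \<in> Fq q" "d \<in> Fq q" "a * d \<noteq> b * c"
    "moebius_type a b c d s" using s unfolding in_PGL_def by blast
  have "d * a \<noteq> (- b) * (- c)" using S(5) by (simp add: mult.commute)
  thus ?thesis
    by (rule in_PGLI[OF _ _ _ _ _ moebius_type_inv[OF s(1) S(6)], rotated 4])
       (intro Fq_closed(4)[OF _ Fq_0] S)+
qed

lemma in_PGL_id: "in_PGL id"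
  by (rule in_PGLI[OF Fq_1 Fq_0 Fq_0 Fq_1 _ moebius_type_id]) simp

lemma inversion_emb:
  assumes "fmul q lam r xf = 1" "emb i" shows "i r * i xf = 1"
  using assms by (metis emb_1 emb_mod emb_mult fmul_eq)

lemma inversion_emb_y:
  assumes "fmul q lam r yf = 1" "emb i" shows "i r * i yf = 1"
  using assms by (metis emb_1 emb_mod emb_mult fmul_eq)

lemma moebius_type_translation: "g xf = xf + kc e \<and> g yf = yf + kc e \<Longrightarrow> moebius_type 1 e 0 1 g"
  by (simp add: moebius_type_def emb_add emb_kc)

lemma moebius_type_scaling: "g xf = kc m * xf \<and> g yf = kc m * yf \<Longrightarrow> moebius_type m 0 0 1 g"
  by (simp add: moebius_type_def emb_mult emb_kc)

lemma moebius_type_inversion: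
  "fmul q lam (g xf) xf = 1 \<and> fmul q lam (g yf) yf = 1 \<Longrightarrow> moebius_type 0 1 1 0 g"
  by (simp add: moebius_type_def inversion_emb inversion_emb_y)

lemma Hgens_in_PGL:
  assumes "g \<in> Hgens q lam"
  shows "g \<in> AutX \<and> in_PGL g"
proof
  show "g \<in> AutX" using assms by (simp add: Hgens_def)
  consider (t) \<alpha> where "\<alpha> \<in> Fq q" "g xf = xf + kc \<alpha>" "g yf = yf + kc \<alpha>"
    | (s) \<mu> where "\<mu> \<in> Fq q - {0}" "g xf = kc \<mu> * xf" "g yf = kc \<mu> * yf"
    | (j) "fmul q lam (g xf) xf = 1" "fmul q lam (g yf) yf = 1"
    using assms unfolding Hgens_def by blast
  thus "in_PGL g"
  proof cases
    case t
    hence "moebius_type 1 \<alpha> 0 1 g" by (simp add: moebius_type_translation)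
    thus ?thesis by (intro in_PGLI[OF Fq_1 t(1) Fq_0 Fq_1]) auto
  next
    case s
    hence "moebius_type \<mu> 0 0 1 g" by (simp add: moebius_type_scaling)
    thus ?thesis using s(1) by (intro in_PGLI[OF _ Fq_0 Fq_0 Fq_1]) auto
  next
    case j
    hence "moebius_type 0 1 1 0 g" by (simp add: moebius_type_inversion)
    thus ?thesis by (intro in_PGLI[OF Fq_0 Fq_1 Fq_1 Fq_0]) auto
  qed
qed

lemma Hgrp_in_PGL: "h \<in> Hgrp q lam \<Longrightarrow> h \<in> AutX \<and> in_PGL h"
proof (induction rule: Hgrp.induct)
  case Hid thus ?case using id_in_Aut in_PGL_id by blast
next
  case (Hgen g h) thus ?case using Hgens_in_PGL comp_in_Aut in_PGL_comp by blast
next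
  case (Hinv g h) thus ?case using Hgens_in_PGL comp_in_Aut in_PGL_comp inv_in_Aut(1) in_PGL_inv by blast
qed

lemma scale_moebius_eq:
  fixes w x :: "'a fls"
  assumes "w * (K c * x + K d) = K a * x + K b"
  shows "w * (K (k * c) * x + K (k * d)) = K (k * a) * x + K (k * b)"
proof -
  have "K k * (w * (K c * x + K d)) = K k * (K a * x + K b)"
    using assms by simp
  thus ?thesis by (simp add: algebra_simps flip: fls_const_mult_const)
qed

lemma moebius_type_scale:
  "moebius_type a b c d s \<Longrightarrow> moebius_type (k * a) (k * b) (k * c) (k * d) s"
  unfolding moebius_type_def by (blast intro: scale_moebius_eq)

text \<open>Bruhat decomposition: a triangular matrix needs a scaling and a translation, any other
  one also the inversion between two translations.\<close>

lemma exists_moebius_type: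
  fixes a b c d :: 'a
  assumes F: "a \<in> Fq q" "b \<in> Fq q" "c \<in> Fq q" "d \<in> Fq q" and det: "a * d \<noteq> b * c"
  shows "\<exists>h\<in>Hgrp q lam. moebius_type a b c d h"
proof -
  have G: "s \<in> AutX" if "s \<in> Hgens q lam" for s using that by (simp add: Hgens_def)
  have tr: "\<exists>t\<in>Hgens q lam. moebius_type 1 e 0 1 t" if "e \<in> Fq q" for e
    using exists_translation[OF that] moebius_type_translation by blast
  have sc: "\<exists>s\<in>Hgens q lam. moebius_type m 0 0 1 s" if "m \<in> Fq q - {0}" for m
    using exists_scaling[OF that] moebius_type_scaling by blast
  show ?thesis
  proof (cases "c = 0")
    case True
    hence ad: "a \<noteq> 0" "d \<noteq> 0" using det by auto
    obtain t where t: "t \<in> Hgens q lam" "moebius_type 1 (b / d) 0 1 t" using tr F Fq_closed by meson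
    obtain s where s: "s \<in> Hgens q lam" "moebius_type (a / d) 0 0 1 s" using sc[of "a / d"] F Fq_closed ad by auto
    have "s \<circ> (t \<circ> id) \<in> Hgrp q lam" using s t by (intro Hgrp.intros)
    moreover have "moebius_type a b c d (s \<circ> t)"
      using moebius_type_scale[OF moebius_type_comp[OF G[OF s(1)] s(2) G[OF t(1)] t(2)], of d] ad True by simp
    ultimately show ?thesis by auto
  next
    case False
    \<comment> \<open>From (a x + b) / (c x + d) = a/c + m / (x + d/c).\<close>
    define m where "m = (b * c - a * d) / (c * c)"
    have "b * c - a * d \<in> Fq q" "c * c \<in> Fq q" using F by (auto intro!: Fq_closed)
    hence m: "m \<in> Fq q - {0}" using det False Fq_closed(5) by (auto simp: m_def)
    obtain t where t: "t \<in> Hgens q lam" "moebius_type 1 (d / c) 0 1 t" using tr F Fq_closed by meson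
    obtain u where u: "u \<in> Hgens q lam" "moebius_type 1 (a / c) 0 1 u" using tr F Fq_closed by meson
    obtain s where s: "s \<in> Hgens q lam" "moebius_type m 0 0 1 s" using sc m by blast
    obtain w where w: "w \<in> Hgens q lam" "moebius_type 0 1 1 0 w"
      using exists_inversion moebius_type_inversion by blast
    note A = G[OF s(1)] G[OF t(1)] G[OF u(1)] G[OF w(1)]
    have "t \<circ> (w \<circ> (s \<circ> (u \<circ> id))) \<in> Hgrp q lam" using s t u w by (intro Hgrp.intros)
    moreover have "moebius_type m (a / c) 0 1 (s \<circ> u)"
      using moebius_type_comp[OF A(1) s(2) A(3) u(2)] by simp
    from moebius_type_comp[OF A(4) w(2) comp_in_Aut[OF A(1,3)] this]
    have "moebius_type (a / c) m 1 0 (w \<circ> (s \<circ> u))" by simp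
    from moebius_type_scale[OF moebius_type_comp[OF A(2) t(2) comp_in_Aut[OF A(4) comp_in_Aut[OF A(1,3)]] this], of c]
    have "moebius_type a b c d (t \<circ> (w \<circ> (s \<circ> u)))" using False by (simp add: m_def field_simps)
    ultimately show ?thesis by auto
  qed
qed

lemma in_PGL_imp_Hgrp:
  assumes "s \<in> AutX" "in_PGL s" shows "s \<in> Hgrp q lam"
  using assms exists_moebius_type Hgrp_in_PGL moebius_type_unique unfolding in_PGL_def by metis

text \<open>One matrix for each class modulo scalars: the lower row is scaled to (0, 1) or (1, d).
  In the second family nonsingularity excludes exactly b = a d.\<close>

definition normal_forms :: "('a \<times> 'a \<times> 'a \<times> 'a) set" where
  "normal_forms = (\<lambda>(a, b). (a, b, 0, 1)) ` ((Fq q - {0}) \<times> Fq q)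
     \<union> (\<lambda>(a, d, b). (a, b, 1, d)) ` (SIGMA a:Fq q. SIGMA d:Fq q. Fq q - {a * d})"

lemma finite_Fq: "finite (Fq q :: 'a set)" and card_Fq': "card (Fq q :: 'a set) = q"
  using card_Fq q_gt_1 unfolding Fq_def by (auto intro: card_ge_0_finite)

lemma card_normal_forms: "finite normal_forms" "card normal_forms = q ^ 3 - q"
proof -
  show "finite normal_forms" unfolding normal_forms_def by (auto simp: finite_Fq)
  have 1: "card ((\<lambda>(a :: 'a, b :: 'a). (a, b, 0 :: 'a, 1 :: 'a)) ` ((Fq q - {0}) \<times> Fq q)) = (q - 1) * q"
    by (subst card_image) (auto simp: inj_on_def card_cartesian_product card_Diff_singleton[OF Fq_0] card_Fq')
  have "card (Fq q - {a * d}) = q - 1" if "a \<in> Fq q" "d \<in> Fq q" for a d :: 'a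
    using that by (simp add: card_Fq' finite_Fq Fq_closed)
  hence 2: "card ((\<lambda>(a :: 'a, d :: 'a, b :: 'a). (a, b, 1 :: 'a, d)) ` (SIGMA a:Fq q. SIGMA d:Fq q. Fq q - {a * d})) = q * (q * (q - 1))"
    by (subst card_image) (auto simp: inj_on_def card_SigmaI finite_Fq card_Fq' finite_SigmaI)
  have "card normal_forms = (q - 1) * q + q * (q * (q - 1))"
    unfolding normal_forms_def using 1 2 by (subst card_Un_disjoint) (auto simp: finite_Fq)
  also have "\<dots> = q ^ 3 - q" using q_gt_1 by (cases q) (auto simp: algebra_simps power3_eq_cube)
  finally show "card normal_forms = q ^ 3 - q" .
qed

lemma normal_formsE:
  assumes "(a, b, c, d) \<in> normal_forms"
  shows "a \<in> Fq q" "b \<in> Fq q" "c \<in> Fq q" "d \<in> Fq q" "a * d \<noteq> b * c" "(c = 0 \<and> d = 1) \<or> c = 1"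
  using assms Fq_0 Fq_1 by (auto simp: normal_forms_def)

lemma in_PGL_normal_form:
  assumes "in_PGL s"
  shows "\<exists>a b c d. (a, b, c, d) \<in> normal_forms \<and> moebius_type a b c d s"
proof -
  obtain a b c d where S: "a \<in> Fq q" "b \<in> Fq q" "c \<in> Fq q" "d \<in> Fq q" "a * d \<noteq> b * c"
    "moebius_type a b c d s" using assms unfolding in_PGL_def by blast
  show ?thesis
  proof (cases "c = 0")
    case True
    hence "a \<noteq> 0" "d \<noteq> 0" using S by auto
    hence "moebius_type (a / d) (b / d) 0 1 s"
      using moebius_type_scale[OF S(6), of "1 / d"] True by simp
    moreover have "(a / d, b / d, 0, 1) \<in> normal_forms"
      using S \<open>a \<noteq> 0\<close> \<open>d \<noteq> 0\<close> by (auto simp: normal_forms_def image_iff intro!: Fq_closed)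
    ultimately show ?thesis by blast
  next
    case False
    hence "moebius_type (a / c) (b / c) 1 (d / c) s"
      using moebius_type_scale[OF S(6), of "1 / c"] by simp
    moreover have "b / c \<noteq> a / c * (d / c)" using S(5) False by (auto simp: field_simps)
    hence "(a / c, b / c, 1, d / c) \<in> normal_forms"
      using S by (auto simp: normal_forms_def image_iff intro!: Fq_closed)
    ultimately show ?thesis by blast
  qed
qed

text \<open>The three equations compare the coefficients in (a x + b)(c' x + d') = (a' x + b')(c x +
  d), that is, the two matrices define the same fraction. They also express agreement at infinity, 0
  and 1, which is how \<open>moebius_pair\<close> uses them.\<close>

lemma moebius_nf_unique:
  fixes a b c d a' b' c' d' :: 'a
  assumes nf: "a * d \<noteq> b * c" "(c = 0 \<and> d = 1) \<or> c = 1" "a' * d' \<noteq> b' * c'" "(c' = 0 \<and> d' = 1) \<or> c' = 1"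
    and e: "a * c' = a' * c" "b * d' = b' * d" "a * d' + b * c' = a' * d + b' * c"
  shows "(a, b, c, d) = (a', b', c', d')"
proof (cases "c = 0")
  case True
  hence "d = 1" "a \<noteq> 0" using nf by auto
  thus ?thesis using True nf e by auto
next
  case False
  hence c: "c = 1" using nf by auto
  have c': "c' = 1" using e nf c by auto
  have a: "a = a'" using e c c' by simp
  have "b' = b + a * (d' - d)" using e(3) c c' a by (simp add: algebra_simps)
  hence "b * d' = (b + a * (d' - d)) * d" using e(2) by simp
  hence "(d' - d) * (a * d - b) = 0" by (simp add: algebra_simps)
  hence "d' = d" using nf(1) c by auto
  thus ?thesis using a c c' e(3) by simp
qed

lemma moebius_type_determines:
  assumes S: "moebius_type a b c d s" "(a, b, c, d) \<in> normal_forms"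
    and T: "moebius_type a' b' c' d' s" "(a', b', c', d') \<in> normal_forms"
  shows "(a, b, c, d) = (a', b', c', d')"
proof -
  obtain i where i: "emb i" using emb_exists by blast
  let ?x = "i xf" and ?w = "i (s xf)"
  have e: "evp [:k, l:] ?x = K l * ?x + K k" for k l by (simp add: evp_pCons algebra_simps)
  have 1: "?w * evp [:d, c:] ?x = evp [:b, a:] ?x" "?w * evp [:d', c':] ?x = evp [:b', a':] ?x"
    using S(1) T(1) i by (auto simp: moebius_type_def e)
  have "evp [:b, a:] ?x * evp [:d', c':] ?x = evp [:b', a':] ?x * evp [:d, c:] ?x"
    unfolding 1[symmetric] by (simp only: mult_ac)
  hence "evp ([:b, a:] * [:d', c':]) ?x = evp ([:b', a':] * [:d, c:]) ?x" by (simp only: evp_mult)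
  hence "[:b, a:] * [:d', c':] = [:b', a':] * [:d, c:]"
    using transc_evp_eq[OF emb_transc[OF i]] by blast
  thus ?thesis using normal_formsE[OF S(2)] normal_formsE[OF T(2)]
    by (intro moebius_nf_unique) (auto simp: algebra_simps)
qed

lemma card_Hgrp: "finite (Hgrp q lam)" "card (Hgrp q lam) = q ^ 3 - q"
proof -
  define T where "T M h \<longleftrightarrow> (case M of (a, b, c, d) \<Rightarrow> moebius_type a b c d h)" for M h
  have ex: "\<exists>h. h \<in> Hgrp q lam \<and> T M h" if "M \<in> normal_forms" for M
  proof -
    obtain a b c d where M: "M = (a, b, c, d)" by (cases M)
    show ?thesis using exists_moebius_type[OF normal_formsE(1-5)[OF that[unfolded M]]]
      by (auto simp: T_def M)
  qed
  have uniq_M: "M = N" if "M \<in> normal_forms" "N \<in> normal_forms" "T M h" "T N h" for M N h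
  proof -
    obtain a b c d where M: "M = (a, b, c, d)" by (cases M)
    obtain a' b' c' d' where N: "N = (a', b', c', d')" by (cases N)
    show ?thesis using moebius_type_determines[of a b c d h a' b' c' d'] that by (simp add: T_def M N)
  qed
  have uniq_h: "h = g" if "M \<in> normal_forms" "h \<in> Hgrp q lam" "g \<in> Hgrp q lam" "T M h" "T M g" for M h g
  proof -
    obtain a b c d where M: "M = (a, b, c, d)" by (cases M)
    show ?thesis
      using moebius_type_unique[OF _ _ normal_formsE(5)[OF that(1)[unfolded M]], of h g] that Hgrp_in_PGL
      by (simp add: T_def M)
  qed
  have nf: "\<exists>M\<in>normal_forms. T M h" if h: "h \<in> Hgrp q lam" for h
  proof -
    have "in_PGL h" using Hgrp_in_PGL[OF h] by blast
    then obtain a b c d where "(a, b, c, d) \<in> normal_forms" "moebius_type a b c d h"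
      using in_PGL_normal_form by blast
    thus ?thesis by (intro bexI[of _ "(a, b, c, d)"]) (simp_all add: T_def)
  qed
  define f where "f M = (SOME h. h \<in> Hgrp q lam \<and> T M h)" for M
  have f: "f M \<in> Hgrp q lam" "T M (f M)" if "M \<in> normal_forms" for M
    using someI_ex[OF ex[OF that]] unfolding f_def by auto
  have "inj_on f normal_forms" by (rule inj_onI) (metis f(2) uniq_M)
  moreover have "f ` normal_forms = Hgrp q lam"
  proof safe
    fix h assume h: "h \<in> Hgrp q lam"
    obtain M where M: "M \<in> normal_forms" "T M h" using nf[OF h] by blast
    have "h = f M" by (rule uniq_h[OF M(1) h f(1)[OF M(1)] M(2) f(2)[OF M(1)]])
    thus "h \<in> f ` normal_forms" using M by blast
  qed (rule f)
  ultimately have "bij_betw f normal_forms (Hgrp q lam)" by (simp add: bij_betw_def)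
  thus "finite (Hgrp q lam)" "card (Hgrp q lam) = q ^ 3 - q"
    using card_normal_forms by (metis bij_betw_finite, metis bij_betw_same_card)
qed

section \<open>Differentials\<close>

lemma subdegree_add_ge:
  fixes w z :: "'b::field fls"
  assumes "ge (m + 1) w" "z \<noteq> 0" "fls_subdegree z = m"
  shows "w + z \<noteq> 0 \<and> fls_subdegree (w + z) = m"
proof -
  have "(w + z) $$ m \<noteq> 0" using assms by (auto simp: ge_def)
  moreover have "(w + z) $$ k = 0" if "k < m" for k using assms that by (auto simp: ge_def)
  ultimately show ?thesis using fls_subdegree_eqI fls_nonzeroI by metis
qed

lemma ge_scale: "ge n w \<Longrightarrow> ge n (K c * w)"
  by (rule ge_mult0'[OF ge_const])

lemma ge_scale_numeral: "ge n w \<Longrightarrow> ge n (numeral k * w)"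
  by (rule ge_mult0'[OF ge_numeral])

lemma two_fls: "(2 :: 'a fls) = K 2" by simp

lemma two_fls_nonzero [simp]: "(2 :: 'a fls) \<noteq> 0"
  unfolding two_fls using two_nonzero by (simp del: fls_const_numeral)

lemma G_translate_const: "a ^ q = a \<Longrightarrow> G (x - K a) (y - K a) = G x y"
  using Gf_translate[of "- K a" "K lam" x y] frob_fls_const[of "- a"]
    Fq_closed(4)[OF _ Fq_0, of a] by (simp add: Fq_def)

lemma Dy_translate_const: "a ^ q = a \<Longrightarrow> Dy (x - K a) (y - K a) = Dy x y"
  using Gy_translate[of "- K a" "K lam" x y] frob_fls_const[of "- a"]
    Fq_closed(4)[OF _ Fq_0, of a] by (simp add: Fq_def)

lemma fls_const_1_pm_lam: "1 - K lam = K (1 - lam)" "1 + K lam = K (1 + lam)"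
  by (simp_all flip: fls_minus_const fls_plus_const)

lemma ge_Dy: "ge 0 x \<Longrightarrow> ge 0 y \<Longrightarrow> ge 0 (Dy x y)"
  unfolding Gy_def fls_const_1_pm_lam by (intro ge_add ge_diff ge_mult0 ge_power0 ge_const ge_numeral)

lemma Dy_nth_0: "ge 0 x \<Longrightarrow> ge 0 y \<Longrightarrow> Dy x y $$ 0 = Gy q lam (x $$ 0) (y $$ 0)"
  unfolding Gy_def fls_const_1_pm_lam two_fls
  by (simp add: nth_mult_0 nth_power_0 ge_power0 del: fls_const_numeral)

lemma G_nth_0: "ge 0 x \<Longrightarrow> ge 0 y \<Longrightarrow> G x y $$ 0 = Gf q lam (x $$ 0) (y $$ 0)"
  unfolding Gf_def fls_const_1_pm_lam two_fls
  by (simp add: nth_mult_0 nth_power_0 ge_power0 ge_mult0 ge_add del: fls_const_numeral)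

text \<open>By \<open>Gy_nonzero_off_Fq\<close> both coordinates lie in F_q, where F reduces to (1 -
  lam) (x - y)^2.\<close>

lemma singular_point:
  fixes x y :: 'a
  assumes F: "Gf q lam x y = 0" "Gy q lam x y = 0" "Gy q lam y x = 0"
  shows "x ^ q = x" "x = y"
proof -
  show x: "x ^ q = x" using Gy_nonzero_off_Fq F by blast
  have y: "y ^ q = y" using Gy_nonzero_off_Fq[of y x] F Gf_sym[of q lam x y] by auto
  have "(1 - lam) * (x - y) ^ 2 = Gf q lam x y"
    by (simp add: Gf_def x y power2_eq_square algebra_simps)
  thus "x = y" using F lam_neq_1 by simp
qed

lemma deriv_quotient_swap:
  assumes G: "G x y = 0" and D: "Dy x y \<noteq> 0" "Dy y x \<noteq> 0"
  shows "fls_deriv x / Dy x y = - (fls_deriv y / Dy y x)"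
proof -
  have "Dy y x * fls_deriv x + Dy x y * fls_deriv y = 0" using G_deriv[of x y] G by simp
  hence "fls_deriv x * Dy y x = - (fls_deriv y * Dy x y)" by (simp add: algebra_simps eq_neg_iff_add_eq_0)
  thus ?thesis using D by (simp add: field_simps)
qed

text \<open>In local coordinates at a node \<open>F\<^sub>y\<close> vanishes exactly to the order of \<open>u\<close> if \<open>u\<close> has the smaller order.\<close>

lemma subdegree_Dy_near_node:
  assumes u: "u \<noteq> 0" "fls_subdegree u \<ge> 1" and v: "ge (fls_subdegree u) v"
  shows "Dy u v \<noteq> 0 \<and> fls_subdegree (Dy u v) = fls_subdegree u"
proof -
  let ?m = "fls_subdegree u"
  have gu: "ge ?m u" by (simp add: ge_iff)
  have q: "?m + 1 \<le> int q * ?m"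
  proof -
    have "2 * ?m \<le> int q * ?m" using q_gt_1 u by (intro mult_right_mono) auto
    thus ?thesis using u by linarith
  qed
  have "ge (?m + 1) (u ^ q)" "ge (?m + 1) (v ^ q)"
    using ge_mono[OF ge_power[OF gu] q] ge_mono[OF ge_power[OF v] q] by auto
  hence "ge (?m + 1) ((1 - K lam) * v ^ q + (1 + K lam) * u ^ q)"
    unfolding fls_const_1_pm_lam by (intro ge_add ge_mult0' ge_const)
  moreover have "- (2 * u) \<noteq> 0" "fls_subdegree (- (2 * u)) = ?m" using u by auto
  ultimately show ?thesis using subdegree_add_ge unfolding Gy_def diff_conv_add_uminus[of _ "2 * u"] by blast
qed

text \<open>The quadratic part at the node is -2 u v. For equal orders m it has order exactly 2 m,
  while every other term contains a q-th power and has larger order, so nothing can cancel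
  it.\<close>

lemma node_orders_distinct:
  assumes u: "u \<noteq> 0" "fls_subdegree u \<ge> 1" and v: "v \<noteq> 0" "fls_subdegree v = fls_subdegree u"
  shows "G u v \<noteq> 0"
proof -
  let ?m = "fls_subdegree u"
  have g: "ge ?m u" "ge ?m v" using v by (auto simp: ge_iff)
  have q: "?m + 1 \<le> int q * ?m"
  proof -
    have "2 * ?m \<le> int q * ?m" using q_gt_1 u by (intro mult_right_mono) auto
    thus ?thesis using u by linarith
  qed
  have gq: "ge (?m + 1) (u ^ q)" "ge (?m + 1) (v ^ q)"
    using ge_mono[OF ge_power[OF g(1)] q] ge_mono[OF ge_power[OF g(2)] q] by auto
  have p: "ge (2 * ?m + 1) (w * z)" if "ge ?m w" "ge (?m + 1) z" for w z
    using ge_mult[OF that] by (rule ge_mono) simp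
  have p': "ge (2 * ?m + 1) (w * z)" if "ge ?m w" "ge (?m + 1) z" for z w
    using ge_mult[OF that] by (rule ge_mono) simp
  have p2: "ge (2 * ?m + 1) (u ^ q * v ^ q)" "ge (2 * ?m + 1) (u ^ q * v)"
    using ge_mult[OF gq] ge_mult[OF gq(1) g(2)] by (auto elim!: ge_mono intro: ge_mono simp: u)
  have "ge (2 * ?m + 1) ((1 - K lam) * (u * u ^ q + v * v ^ q) + (1 + K lam) * (u ^ q * v + u * v ^ q)
     + - (2 * (u ^ q * v ^ q)))"
    unfolding fls_const_1_pm_lam using p[OF g(1) gq(1)] p[OF g(2) gq(2)] p[OF g(1) gq(2)] p2
    by (intro ge_add ge_uminus ge_scale ge_scale_numeral)
  moreover have "- (2 * (u * v)) \<noteq> 0" "fls_subdegree (- (2 * (u * v))) = 2 * ?m" using u v by auto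
  ultimately have "(1 - K lam) * (u * u ^ q + v * v ^ q) + (1 + K lam) * (u ^ q * v + u * v ^ q)
     + - (2 * (u ^ q * v ^ q)) + - (2 * (u * v)) \<noteq> 0" using subdegree_add_ge by blast
  thus ?thesis by (simp add: Gf_def algebra_simps)
qed

text \<open>Where F_y is a unit this is clear, and where F_x is one it follows from dx / F_y = - dy
  / F_x. If both vanish, the point is a node; there F_y or F_x has the smaller of the two local
  orders, which the factor x - y compensates. For F_y = 0 the quotient is 0 by the convention on
  division.\<close>

lemma holomorphic_finite:
  assumes G: "G x y = 0" and t: "transc x" and g: "ge 0 x" "ge 0 y"
  shows "ge 0 ((x - y) * (fls_deriv x / Dy x y))"
proof (cases "Dy x y = 0")
  case D: False
  have d: "ge 0 (fls_deriv x)" "ge 0 (fls_deriv y)" using g ge_deriv by auto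
  have xy: "ge 0 (x - y)" using g ge_diff by blast
  show ?thesis
  proof (cases "Dy x y $$ 0 = 0")
    case False
    show ?thesis using ge_div_unit[OF d(1) ge_Dy[OF g] False] xy by (rule ge_mult0'[rotated])
  next
    case Dy0: True
    show ?thesis
    proof (cases "Dy y x $$ 0 = 0")
      case False
      hence "Dy y x \<noteq> 0" by auto
      show ?thesis unfolding deriv_quotient_swap[OF G D \<open>Dy y x \<noteq> 0\<close>]
        by (rule ge_mult0[OF xy ge_uminus[OF ge_div_unit[OF d(2) ge_Dy[OF g(2,1)] False]]])
    next
      case Dx0: True
      define a where "a = x $$ 0"
      have a: "a ^ q = a" "y $$ 0 = a"
        using singular_point[of "x $$ 0" "y $$ 0"] Dy0 Dx0 G_nth_0[OF g] G
        by (auto simp: a_def Dy_nth_0 g)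
      define u v where "u = x - K a" and "v = y - K a"
      have Guv: "G u v = 0" using G_translate_const[OF a(1)] G by (simp add: u_def v_def)
      have Dt: "Dy u v = Dy x y" "Dy v u = Dy y x" using Dy_translate_const[OF a(1)] by (simp_all add: u_def v_def)
      have u: "u \<noteq> 0" "v \<noteq> 0"
        using transc_not_const[OF t] transc_not_const[OF transc_point[OF G t]] by (auto simp: u_def v_def)
      have gu: "ge 1 u" "ge 1 v" using g a by (auto simp: ge_1_iff u_def v_def a_def intro: ge_diff)
      hence s: "fls_subdegree u \<ge> 1" "fls_subdegree v \<ge> 1" using u by (auto simp: ge_iff)
      have uv: "x - y = u - v" by (simp add: u_def v_def)
      consider "fls_subdegree u < fls_subdegree v" | "fls_subdegree v < fls_subdegree u"
        using node_orders_distinct[OF u(1) s(1) u(2)] Guv by force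
      thus ?thesis
      proof cases
        case 1
        hence gm: "ge (fls_subdegree u) (u - v)" "ge (fls_subdegree u) v"
          using ge_diff[of "fls_subdegree u" u v] by (simp_all add: ge_iff)
        have "fls_subdegree (Dy x y) = fls_subdegree u"
          using subdegree_Dy_near_node[OF u(1) s(1) gm(2)] Dt by simp
        hence "ge 0 ((x - y) / Dy x y)" unfolding uv using ge_divide[OF gm(1), of "Dy x y"] by simp
        thus ?thesis using ge_mult0[OF _ d(1), of 0 "(x - y) / Dy x y"] by simp
      next
        case 2
        hence gm: "ge (fls_subdegree v) (u - v)" "ge (fls_subdegree v) u"
          using ge_diff[of "fls_subdegree v" u v] by (simp_all add: ge_iff)
        have sd: "Dy y x \<noteq> 0 \<and> fls_subdegree (Dy y x) = fls_subdegree v"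
          using subdegree_Dy_near_node[OF u(2) s(2) gm(2)] Dt by simp
        hence "ge 0 ((x - y) / Dy y x)" unfolding uv using ge_divide[OF gm(1), of "Dy y x"] by simp
        hence "ge 0 (- ((x - y) / Dy y x * fls_deriv y))" using d by (intro ge_uminus ge_mult0)
        thus ?thesis using deriv_quotient_swap[OF G D] sd by simp
      qed
    qed
  qed
qed simp

text \<open>If y were finite, (1 - lam) x^(q+1) would be the only term of lowest order.\<close>

lemma pole_of_point:
  assumes G: "G x y = 0" and x: "\<not> ge 0 x" shows "\<not> ge 0 y"
proof
  assume y: "ge 0 y"
  let ?m = "fls_subdegree x"
  have m: "?m < 0" "x \<noteq> 0" using x by (auto simp: ge_iff)
  have gx: "ge ?m x" by (simp add: ge_iff)
  have gq: "ge (int q * ?m) (x ^ q)" by (rule ge_power[OF gx])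
  have qm: "int q * ?m \<le> ?m" "int q * ?m \<le> 0"
    using mult_right_mono_neg[of 1 "int q" ?m] mult_nonneg_nonpos[of "int q" ?m] q_gt_1 m by auto
  have yq: "ge 0 (y ^ q)" using y by (rule ge_power0)
  have g: "ge (int q * ?m) (x ^ q * y)" "ge (int q * ?m) (x * y ^ q)" "ge (int q * ?m) (x ^ q * y ^ q)"
    "ge (int q * ?m) (x * y)" "ge (int q * ?m) (y * y ^ q)"
    using ge_mult0[OF gq y] ge_mono[OF ge_mult0[OF gx yq] qm(1)] ge_mult0[OF gq yq] ge_mono[OF ge_mult0[OF gx y] qm(1)]
     ge_mono[OF ge_mult0[OF y yq] qm(2)] by auto
  have "ge (int q * ?m) ((1 - K lam) * (y * y ^ q) + (1 + K lam) * (x ^ q * y + x * y ^ q)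
     - 2 * (x ^ q * y ^ q + x * y))"
    unfolding fls_const_1_pm_lam using g by (intro ge_add ge_diff ge_scale ge_scale_numeral)
  moreover have "(int q + 1) * ?m + 1 \<le> int q * ?m" using m by (simp add: algebra_simps)
  ultimately have "ge ((int q + 1) * ?m + 1) ((1 - K lam) * (y * y ^ q) + (1 + K lam) * (x ^ q * y + x * y ^ q)
     - 2 * (x ^ q * y ^ q + x * y))" by (rule ge_mono)
  moreover have "K (1 - lam) * (x * x ^ q) \<noteq> 0" using m lam_neq_1 by auto
  moreover have "fls_subdegree (K (1 - lam) * (x * x ^ q)) = (int q + 1) * ?m"
    using m lam_neq_1 by (subst fls_subdegree_mult) (auto simp: fls_subdegree_pow algebra_simps)
  ultimately have "(1 - K lam) * (y * y ^ q) + (1 + K lam) * (x ^ q * y + x * y ^ q)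
     - 2 * (x ^ q * y ^ q + x * y) + K (1 - lam) * (x * x ^ q) \<noteq> 0" using subdegree_add_ge by blast
  thus False using G by (simp add: Gf_def algebra_simps flip: fls_const_1_pm_lam)
qed

text \<open>The differentials \<open>(x - y) x\<^sup>j y\<^sup>k dx / F\<^sub>y\<close> come from adjoint curves containing the diagonal; they
  are regular at every place.\<close>

lemma holomorphic:
  assumes G: "G x y = 0" and t: "transc x" and jk: "j \<le> q - 2" "k \<le> q - 2"
  shows "ge 0 ((x - y) * x ^ j * y ^ k * fls_deriv x / Dy x y)"
proof (cases "ge 0 x \<and> ge 0 y")
  case True
  hence "ge 0 (((x - y) * (fls_deriv x / Dy x y)) * (x ^ j * y ^ k))"
    using ge_mult0[OF holomorphic_finite[OF G t] ge_mult0[OF ge_power0 ge_power0]] by blast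
  thus ?thesis by (simp add: mult_ac)
next
  case False
  have "G y x = 0" using G by (subst Gf_sym)
  hence "\<not> ge 0 x" "\<not> ge 0 y"
    using False pole_of_point[OF G] pole_of_point[of y x] by blast+
  hence nz: "x \<noteq> 0" "y \<noteq> 0" and s: "fls_subdegree x < 0" "fls_subdegree y < 0" by (auto simp: ge_iff)
  \<comment> \<open>Both coordinates have poles, so the inversion leads to a finite point, where
    \<open>holomorphic_finite\<close> applies.\<close>
  define u v where "u = 1 / x" and "v = 1 / y"
  have xu: "x = 1 / u" "y = 1 / v" and unz: "u \<noteq> 0" "v \<noteq> 0" using nz by (auto simp: u_def v_def)
  have g: "ge 0 u" "ge 0 v" using s by (auto simp: u_def v_def divide_inverse intro!: ge_inverse)
  have Guv: "G u v = 0" using Gf_inverse[OF nz, of q "K lam"] G nz by (simp add: u_def v_def)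
  have tu: "transc u"
  proof (rule transcI', rule)
    assume "u \<in> range K"
    then obtain c where c: "u = K c" by blast
    hence "fls_subdegree u = 0" by simp
    thus False using s by (simp add: u_def divide_inverse)
  qed
  have hol: "ge 0 ((u - v) * (fls_deriv u / Dy u v))" by (rule holomorphic_finite[OF Guv tu g])
  show ?thesis
  proof (cases "Dy x y = 0")
    case D: False
    have "Dy u v * (x * y) ^ (q + 1) = - (y ^ 2 * Dy x y)"
      using Gy_inverse[OF nz G] by (simp add: u_def v_def)
    hence Duv: "Dy u v * (x * y) ^ (q + 1) = - (y ^ 2) * Dy x y" by simp
    have Duv0: "Dy u v \<noteq> 0" using Duv D nz by auto
    have "fls_deriv (x * u) = 0" using nz by (simp add: u_def)
    hence du: "fls_deriv u * x = - (u * fls_deriv x)" by (simp add: algebra_simps eq_neg_iff_add_eq_0)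
    \<comment> \<open>The inversion replaces the exponents j, k by q - 2 - j, q - 2 - k;
      nonnegativity of these is what bounds the exponents.\<close>
    define j' k' where "j' = q - 2 - j" and "k' = q - 2 - k"
    have j': "q = j + 2 + j'" and k': "q = k + 2 + k'" using jk q_gt_3 by (auto simp: j'_def k'_def)
    have xq: "x ^ (q + 1) = x ^ j * x ^ 3 * x ^ j'" "y ^ (q + 1) = y ^ k * y ^ 3 * y ^ k'"
      by (subst j', simp add: power_add power3_eq_cube power2_eq_square mult_ac)
         (subst k', simp add: power_add power3_eq_cube power2_eq_square mult_ac)
    have dx: "fls_deriv x = - (fls_deriv u * x * x)" using du nz unz by (simp add: u_def field_simps)
    have Dxy: "Dy x y = - (Dy u v * (x ^ j * x ^ 3 * x ^ j') * (y ^ k * y ^ 3 * y ^ k')) / y ^ 2"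
      using Duv nz unfolding power_mult_distrib xq by (simp add: field_simps)
    have "(x - y) * x ^ j * y ^ k * fls_deriv x / Dy x y = - (((u - v) * (fls_deriv u / Dy u v)) * (u ^ j' * v ^ k'))"
    proof -
      have alg: "(x - y) * A * C * (- (U * x * x)) / (- (W * (A * x ^ 3 * B) * (C * y ^ 3 * D)) / y ^ 2)
          = - (((1 / x - 1 / y) * (U / W)) * (1 / B * (1 / D)))"
        if "A \<noteq> 0" "B \<noteq> 0" "C \<noteq> 0" "D \<noteq> 0" "W \<noteq> 0" for A B C D W U :: "'a fls"
        using that nz by (simp add: divide_simps) (simp add: algebra_simps power2_eq_square power3_eq_cube)
      have p: "(1 / x) ^ j' = 1 / x ^ j'" "(1 / y) ^ k' = 1 / y ^ k'" by (simp_all add: power_one_over)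
      show ?thesis unfolding dx Dxy unfolding u_def[symmetric] v_def[symmetric] p[folded u_def v_def]
        unfolding u_def v_def by (rule alg) (use nz Duv0 in \<open>auto simp: u_def v_def\<close>)
    qed
    thus ?thesis using ge_uminus[OF ge_mult0[OF hol ge_mult0[OF ge_power0[OF g(1)] ge_power0[OF g(2)]]]] by metis
  qed simp
qed

lemma deriv_evp: "fls_deriv (evp p x) = evp (pderiv p) x * fls_deriv x"
  by (induction p) (auto simp: evp_pCons pderiv_pCons evp_add algebra_simps)

definition DyR :: "'a poly fract poly" where "DyR = Gy q (kc lam) xf yf"

lemma emb_DyR: "emb i \<Longrightarrow> i DyR = Dy (i xf) (i yf)"
proof -
  assume i: "emb i"
  have 2: "i 2 = 2" using emb_add[OF i, of 1 1] by (simp add: emb_1[OF i])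
  show ?thesis unfolding DyR_def Gy_def
    by (simp add: emb_simps[OF i] 2)
qed

text \<open>F_y is nonzero in the function field, that is, x is separating: on the branch of the
  node with parameter x it has order 1.\<close>

lemma DyR_inverse: "\<exists>m. Fpol dvd DyR * m - 1"
proof (rule inverse_mod_Fpol)
  obtain h where h: "ge 0 h" "h $$ 0 = (1 - lam) / 2" "G fls_X (fls_X ^ q * h) = 0"
    using exists_node_branch by blast
  have "fls_X \<notin> range (K :: 'a \<Rightarrow> _)" by (metis fls_X_subdegree fls_const_subdegree imageE zero_neq_one)
  hence t: "transc (fls_X :: 'a fls)" by (rule transcI')
  define i where "i = (\<lambda>r. evr r (fls_X :: 'a fls) (fls_X ^ q * h))"
  have i: "emb i" unfolding i_def by (rule emb_evr[OF t h(3)])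
  have "ge (int q) (fls_X ^ q * h)" using h by (intro ge_mult0) auto
  hence "ge 1 (fls_X ^ q * h)" by (rule ge_mono) (use q_gt_1 in auto)
  hence "Dy fls_X (fls_X ^ q * h) \<noteq> 0" using subdegree_Dy_near_node[of fls_X] by simp
  hence "i DyR \<noteq> 0" using emb_DyR[OF i] t by (simp add: i_def evr_xf evr_yf)
  thus "\<not> Fpol dvd DyR" using emb_eq_0_iff[OF i] by blast
qed

lemma Dy_nonzero: "emb i \<Longrightarrow> Dy (i xf) (i yf) \<noteq> 0"
proof -
  assume i: "emb i"
  obtain m where "Fpol dvd DyR * m - 1" using DyR_inverse by blast
  hence "i DyR * i m = 1" using emb_cong[OF i] emb_mult[OF i] emb_1[OF i] by metis
  thus ?thesis using emb_DyR[OF i] by auto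
qed

text \<open>The derivation d/dx of the function field: \<open>m\<close> is dr/dx, and it is
  independent of the embedding.\<close>

lemma exists_derivative: "\<exists>m. \<forall>i. emb i \<longrightarrow> fls_deriv (i r) = i m * fls_deriv (i xf)"
proof (induction r)
  case 0
  show ?case by (intro exI[of _ 0]) (simp add: emb_0)
next
  case (pCons a r)
  then obtain m where m: "\<And>i. emb i \<Longrightarrow> fls_deriv (i r) = i m * fls_deriv (i xf)" by blast
  obtain n d where a: "a = Fract n d" "d \<noteq> 0" by (cases a) auto
  obtain w where w: "Fpol dvd DyR * w - 1" using DyR_inverse by blast
  define m1 where "m1 = [:tf (pderiv n * d - n * pderiv d) / tf (d * d):]"
  \<comment> \<open>dy/dx = - F_x / F_y, where \<open>w\<close> is the inverse of F_y;
    \<open>m1\<close> is the derivative of the coefficient \<open>a\<close> by the quotient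
    rule.\<close>
  define m2 where "m2 = - Gy q (kc lam) yf xf * w"
  have "fls_deriv (i (pCons a r)) = i (m1 + m2 * r + yf * m) * fls_deriv (i xf)" if i: "emb i" for i
  proof -
    have t: "transc (i xf)" by (rule emb_transc[OF i])
    have 2: "i 2 = 2" using emb_add[OF i, of 1 1] by (simp add: emb_1[OF i])
    have e: "i (pCons a r) = evf a (i xf) + i yf * i r" unfolding emb_eq_evr[OF i, of r] emb_eq_evr[OF i, of "pCons a r"]
      using t by (simp add: evr_pCons)
    have d0: "evp d (i xf) \<noteq> 0" using t a by (simp add: transc_evp_eq_0)
    have "fls_deriv (evf a (i xf) * evp d (i xf)) = fls_deriv (evp n (i xf))" using a t d0 by (simp add: evf_Fract)
    hence "fls_deriv (evf a (i xf)) * evp d (i xf) + evf a (i xf) * (evp (pderiv d) (i xf) * fls_deriv (i xf))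
       = evp (pderiv n) (i xf) * fls_deriv (i xf)" by (simp add: deriv_evp add.commute)
    hence "fls_deriv (evf a (i xf)) = (evp (pderiv n) (i xf) - evf a (i xf) * evp (pderiv d) (i xf)) / evp d (i xf) * fls_deriv (i xf)"
      using d0 by (simp add: field_simps)
    also have "(evp (pderiv n) (i xf) - evf a (i xf) * evp (pderiv d) (i xf)) / evp d (i xf) =
        evf (Fract (pderiv n * d - n * pderiv d) (d * d)) (i xf)"
      using a t d0 by (simp add: evf_Fract evp_mult evp_diff field_simps)
    also have "\<dots> = i m1" using a unfolding m1_def emb_const[OF i] by (simp add: Fract_eq_tf_div)
    finally have 1: "fls_deriv (evf a (i xf)) = i m1 * fls_deriv (i xf)" .
    have "i DyR * i w = 1" using emb_cong[OF i w] emb_mult[OF i] emb_1[OF i] by metis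
    hence iw: "Dy (i xf) (i yf) * i w = 1" by (simp add: emb_DyR[OF i])
    have im2: "i m2 = - Dy (i yf) (i xf) * i w" unfolding m2_def Gy_def
      by (simp add: emb_simps[OF i] 2 emb_uminus[OF i])
    have "Dy (i yf) (i xf) * fls_deriv (i xf) + Dy (i xf) (i yf) * fls_deriv (i yf) = 0"
      using G_deriv[of "i xf" "i yf"] emb_G[OF i] by simp
    hence "Dy (i xf) (i yf) * fls_deriv (i yf) = - Dy (i yf) (i xf) * fls_deriv (i xf)"
      by (simp add: eq_neg_iff_add_eq_0 add.commute)
    hence "(Dy (i xf) (i yf) * i w) * fls_deriv (i yf) = - Dy (i yf) (i xf) * i w * fls_deriv (i xf)"
      by (simp add: mult_ac)
    hence dy: "fls_deriv (i yf) = i m2 * fls_deriv (i xf)" by (simp add: iw im2)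
    show ?thesis unfolding e
      by (simp add: 1 dy m[OF i] emb_simps[OF i] algebra_simps)
  qed
  thus ?case by blast
qed

text \<open>\<open>regular_diff f\<close> expresses that \<open>f dx\<close> is regular everywhere; \<open>numer f\<close> is \<open>f F\<^sub>y\<close>. Regularity forces
  \<open>numer f\<close> to be a polynomial in \<open>x\<close> and \<open>y\<close> whose degree in \<open>y\<close> is less than \<open>q\<close>, and then the trace
  of \<open>f\<close> over \<open>K(x)\<close> vanishes by Euler's formula.\<close>

definition regular_diff :: "'a poly fract poly \<Rightarrow> bool" where
  "regular_diff f \<longleftrightarrow> (\<forall>i. emb i \<longrightarrow> ge 0 (i f * fls_deriv (i xf)))"

definition numer :: "'a poly fract poly \<Rightarrow> 'a poly fract poly" where
  "numer f = (f * DyR) mod Fpol"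

lemma degree_numer: "degree (numer f) \<le> q"
  by (simp add: numer_def degree_mod_Fpol)

lemma emb_numer: "emb i \<Longrightarrow> i (numer f) = i f * Dy (i xf) (i yf)"
  by (simp add: numer_def emb_mod emb_mult emb_DyR)

lemma common_denominator: "\<exists>d N0. d \<noteq> 0 \<and> smult (tf d) N = map_poly tf N0"
  for N :: "'a poly fract poly"
proof (induction N)
  case 0
  show ?case by (intro exI[of _ 1] exI[of _ 0]) auto
next
  case (pCons a N)
  then obtain d N0 where d: "d \<noteq> 0" "smult (tf d) N = map_poly tf N0" by blast
  obtain n e where a: "a = tf n / tf e" "e \<noteq> 0" using Fract_eq_tf_div by (cases a) auto
  have m: "map_poly tf (smult e N0) = smult (tf e) (map_poly tf N0)"
    by (rule map_poly_smult) (auto simp: tf_mult)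
  have "smult (tf (d * e)) (pCons a N) = map_poly tf (pCons (d * n) (smult e N0))"
    using a by (simp add: map_poly_pCons m tf_mult d(2)[symmetric] mult.commute)
  thus ?case using d a by (metis mult_eq_0_iff)
qed

lemma evp_split: "evp c x = K (poly c a) + (x - K a) * evp (synthetic_div c a) x"
proof -
  have "evp c x = evp ([:-a, 1:] * synthetic_div c a + [:poly c a:]) x"
    by (simp only: synthetic_div_correct')
  also have "\<dots> = evp [:-a, 1:] x * evp (synthetic_div c a) x + K (poly c a)"
    by (simp only: evp_add evp_mult evp_const)
  also have "evp [:-a, 1:] x = x - K a" by (simp add: evp_pCons)
  finally show ?thesis by simp
qed

text \<open>Separates N(a, y) from a multiple of x - a, so that their orders can be played off
  against each other near a node.\<close>

lemma ev2_split:
  "ev2 N x y = evp (map_poly (\<lambda>c. poly c a) N) y + (x - K a) * ev2 (map_poly (\<lambda>c. synthetic_div c a) N) x y"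
proof (induction N)
  case (pCons c N)
  show ?case unfolding ev2_pCons pCons.IH evp_split[of c x a]
    by (simp add: map_poly_pCons ev2_pCons evp_pCons algebra_simps)
qed simp

lemma const_plus_X_not_const: "K a + fls_X \<notin> range (K :: 'a \<Rightarrow> _)"
proof
  assume "K a + fls_X \<in> range (K :: 'a \<Rightarrow> _)"
  then obtain c where "K a + fls_X = K c" by blast
  hence "(K a + fls_X) $$ 1 = K c $$ 1" by simp
  thus False by simp
qed

lemma transc_const_plus_X: "transc (K a + fls_X :: 'a fls)"
  by (rule transcI'[OF const_plus_X_not_const])

lemma order_at_const_plus_X:
  fixes p :: "'a poly"
  assumes "ge (int (degree p) + 1) (evp p (K a + fls_X))"
  shows "p = 0"
proof (rule ccontr)
  assume p: "p \<noteq> 0"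
  obtain r where r: "p = [:-a, 1:] ^ order a p * r" "\<not> [:-a, 1:] dvd r"
    using order_decomp[OF p] by blast
  have g: "ge 0 (K a + fls_X)" by (simp add: ge_def)
  have "poly r a \<noteq> 0" using r(2) by (simp add: poly_eq_0_iff_dvd)
  hence n: "evp r (K a + fls_X) $$ 0 \<noteq> 0" by (simp add: evp_nth_0[OF g])
  hence s: "fls_subdegree (evp r (K a + fls_X)) = 0"
    using ge_evp[OF g, of r] by (intro fls_subdegree_eqI) (auto simp: ge_def)
  have "evp p (K a + fls_X) = fls_X ^ order a p * evp r (K a + fls_X)"
    by (subst r(1)) (simp add: evp_mult evp_power evp_pCons)
  moreover have "evp r (K a + fls_X) \<noteq> 0" using n by auto
  ultimately have "fls_subdegree (evp p (K a + fls_X)) = int (order a p)" "evp p (K a + fls_X) \<noteq> 0"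
    using s by auto
  thus False using assms order_degree[OF p, of a] by (simp add: ge_iff)
qed

section \<open>Denominators of regular differentials\<close>

context
  fixes f d N0
  assumes reg: "regular_diff f" and d0: "d \<noteq> 0" and N0: "smult (tf d) (numer f) = map_poly tf N0"
begin

lemma degree_N0: "degree N0 \<le> q"
proof -
  have "degree N0 = degree (map_poly tf N0)" by (rule degree_map_poly[symmetric]) auto
  also have "\<dots> = degree (numer f)" unfolding N0[symmetric] using d0 by (simp add: degree_smult_eq)
  finally show ?thesis using degree_numer[of f] by simp
qed

lemma ev2_N0: "emb i \<Longrightarrow> ev2 N0 (i xf) (i yf) = evp d (i xf) * (i f * Dy (i xf) (i yf))"
proof -
  assume i: "emb i"
  have "ev2 N0 (i xf) (i yf) = i (map_poly tf N0)" by (rule emb_map_poly[OF i, symmetric])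
  also have "\<dots> = i ([:tf d:] * numer f)" by (simp flip: N0)
  finally show ?thesis by (simp only: emb_mult[OF i] emb_poly[OF i] emb_numer[OF i])
qed

text \<open>At each of the q + 1 unramified points over x0 the function f is finite, so N0 = d f F_y
  vanishes together with d. But N0(x0, y) has degree at most q in y.\<close>

lemma vanishing_off_Fq:
  assumes x0: "poly d x0 = 0" "x0 ^ q \<noteq> x0"
  shows "map_poly (\<lambda>c. poly c x0) N0 = 0"
proof (rule poly_eqI_degree[where A = "{y0. Gf q lam x0 y0 = 0}"])
  have "degree (map_poly (\<lambda>c. poly c x0) N0) \<le> degree N0"
    by (rule degree_le) (auto simp: coeff_map_poly coeff_eq_0)
  thus "degree (map_poly (\<lambda>c. poly c x0) N0) < card {y0. Gf q lam x0 y0 = 0}"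
    using degree_N0 card_fibre[OF x0(2)] by simp
  show "degree (0 :: 'a poly) < card {y0. Gf q lam x0 y0 = 0}" using card_fibre[OF x0(2)] by simp
  fix y0 assume "y0 \<in> {y0. Gf q lam x0 y0 = 0}"
  then obtain y where y: "ge 0 y" "y $$ 0 = y0" "G (K x0 + fls_X) y = 0"
    using exists_point_over[OF x0(2)] by blast
  let ?x = "K x0 + fls_X"
  define i where "i = (\<lambda>r. evr r ?x y)"
  have t: "transc ?x" by (rule transc_const_plus_X)
  have i: "emb i" unfolding i_def by (rule emb_evr[OF t y(3)])
  have xy: "i xf = ?x" "i yf = y" using t by (simp_all add: i_def evr_xf evr_yf)
  have gx: "ge 0 ?x" "?x $$ 0 = x0" by (simp_all add: ge_def)
  have "ge 0 (i f * fls_deriv (i xf))" using reg i unfolding regular_diff_def by blast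
  hence "ge 0 (i f)" by (simp add: xy)
  hence gf: "ge 0 (i f * Dy ?x y)" using ge_Dy[OF gx(1) y(1)] by (rule ge_mult0)
  have "ev2 N0 ?x y $$ 0 = poly d x0 * (i f * Dy ?x y) $$ 0"
    using ev2_N0[OF i] nth_mult_0[OF ge_evp[OF gx(1)] gf] evp_nth_0[OF gx(1)] gx(2) by (simp add: xy)
  thus "poly (map_poly (\<lambda>c. poly c x0) N0) y0 = poly 0 y0"
    using x0 ev2_nth_0[OF gx(1) y(1), of N0] by (simp only: gx(2) y(2)) simp
qed

text \<open>The two branches of the node are played off against each other: on \<open>x - a \<approx> (y - a)\<^sup>q\<close> regularity
  gives vanishing up to the term of order \<open>q\<close>, which the other branch shows to be zero.\<close>

lemma vanishing_at_node:
  assumes a: "poly d a = 0" "a ^ q = a"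
  shows "map_poly (\<lambda>c. poly c a) N0 = 0"
proof -
  obtain h where h: "ge 0 h" "h $$ 0 = (1 - lam) / 2" "G fls_X (fls_X ^ q * h) = 0"
    using exists_node_branch by blast
  have "(1 - lam) / 2 \<noteq> 0" using lam_neq_1 by simp
  hence h0: "h $$ 0 \<noteq> 0" by (simp only: h(2) simp_thms)
  let ?v = "fls_X ^ q * h"
  define z w where "z = K a + fls_X" and "w = K a + ?v"
  have gv: "ge (int q) ?v" using ge_mult0[OF ge_X_power h(1)] .
  have gv1: "ge 1 ?v" using gv by (rule ge_mono) (use q_gt_1 in auto)
  have G1: "G z w = 0" using G_translate_const[OF a(2), of z w] h(3) by (simp add: z_def w_def)
  have G2: "G w z = 0" using G1 by (subst Gf_sym)
  have tz: "transc z" unfolding z_def by (rule transc_const_plus_X)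
  have tw: "transc w" by (rule transc_point[OF G1 tz])
  have g: "ge 0 z" "z $$ 0 = a" by (simp_all add: z_def ge_def)
  have gw: "ge 0 w" "w $$ 0 = a"
    using gv1 by (simp_all add: w_def ge_def)
  have Dzw: "ge 1 (Dy z w)"
  proof -
    have "Dy z w = Dy fls_X ?v" using Dy_translate_const[OF a(2), of z w] by (simp add: z_def w_def)
    thus ?thesis using subdegree_Dy_near_node[of fls_X ?v] gv1 by (simp add: ge_iff)
  qed
  define Na where "Na = map_poly (\<lambda>c. poly c a) N0"
  define N1 where "N1 = map_poly (\<lambda>c. synthetic_div c a) N0"
  have split: "ev2 N0 x y = evp Na y + (x - K a) * ev2 N1 x y" for x y
    unfolding Na_def N1_def by (rule ev2_split)
  have dNa: "degree Na \<le> q"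
  proof -
    have "degree Na \<le> degree N0" unfolding Na_def by (rule degree_le) (auto simp: coeff_map_poly coeff_eq_0)
    thus ?thesis using degree_N0 by simp
  qed
  \<comment> \<open>On the branch with parameter x - a the series N0 has order at least 2, one from
    \<open>d\<close> and one from F_y, while y - a has order q. The terms of order 0 and 1 give
    \<open>poly Na a = 0\<close> and then the vanishing of \<open>N1\<close> at the node.\<close>
  have N1_0: "poly (map_poly (\<lambda>c. poly c a) N1) a = 0"
  proof -
    define i where "i = (\<lambda>r. evr r z w)"
    have i: "emb i" unfolding i_def by (rule emb_evr[OF tz G1])
    have xy: "i xf = z" "i yf = w" using tz by (simp_all add: i_def evr_xf evr_yf)
    have "ge 0 (i f * fls_deriv (i xf))" using reg i unfolding regular_diff_def by blast
    hence gf: "ge 0 (i f)" by (simp add: xy z_def)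
    have "ge 1 (evp d z)" using ge_evp[OF g(1)] evp_nth_0[OF g(1)] a g by (simp add: ge_1_iff)
    hence "ge (1 + (0 + 1)) (evp d z * (i f * Dy z w))" by (intro ge_mult gf Dzw)
    hence A: "ge 2 (evp Na w + fls_X * ev2 N1 z w)"
      using ev2_N0[OF i] split[of z w] by (simp add: xy z_def)
    have E: "evp Na w = K (poly Na a) + ?v * evp (synthetic_div Na a) w"
      using evp_split[of Na w a] by (simp add: w_def)
    have gs: "ge 2 (?v * evp (synthetic_div Na a) w)"
      using ge_mult0[OF gv ge_evp[OF gw(1)]] by (rule ge_mono) (use q_gt_1 in auto)
    have B: "evp Na w + fls_X * ev2 N1 z w - ?v * evp (synthetic_div Na a) w
      = K (poly Na a) + fls_X * ev2 N1 z w" by (simp add: E)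
    have 2: "ge 2 (K (poly Na a) + fls_X * ev2 N1 z w)" using ge_diff[OF A gs] unfolding B .
    have gN: "ge 0 (ev2 N1 z w)" by (rule ge_ev2[OF g(1) gw(1)])
    have gX: "ge 1 (fls_X * ev2 N1 z w)" by (rule ge_mult0[OF ge_X gN])
    have "(K (poly Na a) + fls_X * ev2 N1 z w) $$ 0 = 0" by (rule ge_pos_imp_0[OF 2]) simp
    hence "poly Na a = 0" using ge_pos_imp_0[OF gX] by simp
    hence "ge (1 + int 1) (fls_X ^ 1 * ev2 N1 z w)" using 2 by simp
    hence "ge 1 (ev2 N1 z w)" by (rule ge_cancel_X_power)
    hence "ev2 N1 z w $$ 0 = 0" by (rule ge_pos_imp_0) simp
    thus ?thesis using ev2_nth_0[OF g(1) gw(1), of N1] by (simp add: g gw)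
  qed
  \<comment> \<open>The branch with the coordinates exchanged: here \<open>d\<close> has order at
    least q and f F_y order at least 1. As \<open>N1\<close> vanishes at the node, \<open>Na\<close>
    has order at least q + 1 at \<open>a\<close>, more than its degree allows.\<close>
  define i where "i = (\<lambda>r. evr r w z)"
  have i: "emb i" unfolding i_def by (rule emb_evr[OF tw G2])
  have xy: "i xf = w" "i yf = z" using tw by (simp_all add: i_def evr_xf evr_yf)
  have gf: "ge 0 (i f * fls_deriv w)" using reg i xy unfolding regular_diff_def by metis
  \<comment> \<open>Regularity controls only the product of f with the derivative of
    \<open>w\<close>, which need not be a unit; the derivative of the equation produces this factor
    from F_y.\<close>
  have "Dy z w * fls_deriv w + Dy w z * fls_deriv z = 0" using G_deriv[of w z] G2 by simp
  hence "Dy w z = - (Dy z w * fls_deriv w)" by (simp add: z_def eq_neg_iff_add_eq_0 add.commute)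
  hence "i f * Dy w z = - ((i f * fls_deriv w) * Dy z w)" by simp
  hence gfD: "ge 1 (i f * Dy w z)" using ge_uminus[OF ge_mult0'[OF gf Dzw]] by simp
  have "evp d w = ?v * evp (synthetic_div d a) w" using evp_split[of d w a] a by (simp add: w_def)
  hence "ge (int q) (evp d w)" using ge_mult0[OF gv ge_evp[OF gw(1)]] by simp
  hence "ge (int q + 1) (evp d w * (i f * Dy w z))" using gfD by (rule ge_mult)
  hence 1: "ge (int q + 1) (evp Na z + ?v * ev2 N1 w z)"
    using ev2_N0[OF i] split[of w z] by (simp add: xy w_def)
  have "ev2 N1 w z $$ 0 = 0" using ev2_nth_0[OF gw(1) g(1), of N1] N1_0 by (simp add: g gw)
  hence "ge 1 (ev2 N1 w z)" using ge_ev2[OF gw(1) g(1), of N1] by (simp add: ge_1_iff)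
  hence "ge (int q + 1) (?v * ev2 N1 w z)" by (rule ge_mult[OF gv])
  hence "ge (int q + 1) (evp Na z)" using ge_diff[OF 1] by (metis add_diff_cancel_right')
  hence "ge (int (degree Na) + 1) (evp Na (K a + fls_X))"
    unfolding z_def by (rule ge_mono) (use dNa in auto)
  thus ?thesis unfolding Na_def[symmetric] by (rule order_at_const_plus_X)
qed

end

text \<open>A common denominator of least degree has no root: by the two vanishing lemmas its linear
  factor would divide \<open>N0\<close> and could be cancelled.\<close>

lemma regular_diff_numer_polynomial:
  assumes reg: "regular_diff f"
  shows "\<exists>N0. numer f = map_poly tf N0"
proof -
  let ?P = "\<lambda>k. \<exists>d N0. d \<noteq> 0 \<and> smult (tf d) (numer f) = map_poly tf N0 \<and> degree d = k"
  have "\<exists>k. ?P k" using common_denominator[of "numer f"] by blast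
  then obtain k where k: "?P k" "\<And>k'. k' < k \<Longrightarrow> \<not> ?P k'" using exists_least_iff[of ?P] by blast
  then obtain d N0 where d: "d \<noteq> 0" "smult (tf d) (numer f) = map_poly tf N0" "degree d = k" by blast
  have "k = 0"
  proof (rule ccontr)
    assume "k \<noteq> 0"
    then obtain z where z: "poly d z = 0" using alg_closed d by auto
    have v: "map_poly (\<lambda>c. poly c z) N0 = 0"
      using vanishing_off_Fq[OF reg d(1,2) z] vanishing_at_node[OF reg d(1,2) z] by blast
    have vc: "poly (coeff N0 n) z = 0" for n
    proof -
      have "coeff (map_poly (\<lambda>c. poly c z) N0) n = 0" by (simp add: v)
      thus ?thesis by (simp add: coeff_map_poly)
    qed
    define d' N' where "d' = synthetic_div d z" and "N' = map_poly (\<lambda>c. synthetic_div c z) N0"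
    have d': "d = [:-z, 1:] * d'" using synthetic_div_correct'[of z d] z by (simp add: d'_def)
    have "coeff N0 n = [:-z, 1:] * coeff N' n" for n
      using synthetic_div_correct'[of z "coeff N0 n"] vc[of n] by (simp add: N'_def coeff_map_poly)
    hence N': "N0 = smult [:-z, 1:] N'" by (intro poly_eqI) simp
    have d'0: "d' \<noteq> 0" using d d' by auto
    have "smult (tf [:-z, 1:]) (smult (tf d') (numer f)) = smult (tf [:-z, 1:]) (map_poly tf N')"
    proof -
      have "smult (tf [:-z, 1:]) (smult (tf d') (numer f)) = map_poly tf N0"
        by (simp add: d' flip: d(2) tf_mult)
      also have "\<dots> = smult (tf [:-z, 1:]) (map_poly tf N')"
        unfolding N' by (rule map_poly_smult) (auto simp: tf_mult)
      finally show ?thesis .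
    qed
    hence "smult (tf d') (numer f) = map_poly tf N'"
    proof -
      assume e: "smult (tf [:-z, 1:]) (smult (tf d') (numer f)) = smult (tf [:-z, 1:]) (map_poly tf N')"
      have nz: "tf [:-z, 1:] \<noteq> 0" by simp
      show ?thesis using e nz
        by (intro poly_eqI) (metis coeff_smult mult_left_cancel)
    qed
    moreover have "degree d = Suc (degree d')" using d'0 by (subst d', subst degree_mult_eq) auto
    ultimately show False using k(2)[of "degree d'"] d'0 d(3) by auto
  qed
  then obtain c where c: "d = [:c:]" "c \<noteq> 0" using d by (metis degree_eq_zeroE pCons_0_0)
  have "numer f = smult (tf [:1 / c:]) (smult (tf d) (numer f))"
    using c by (simp flip: tf_mult one_pCons)
  also have "\<dots> = map_poly tf (smult [:1 / c:] N0)"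
    unfolding d(2) by (rule map_poly_smult[symmetric]) (auto simp: tf_mult)
  finally show ?thesis by blast
qed

end

text \<open>Interpolate g at the roots of P by Lagrange. The sum, up to the leading coefficient of
  P, is the coefficient of degree \<open>card S - 1\<close> in the interpolant, which is zero for
  g.\<close>

lemma euler_sum:
  fixes P g :: "'b::field poly"
  assumes S: "finite S" "card S = degree P" "\<And>s. s \<in> S \<Longrightarrow> poly P s = 0" and P: "P \<noteq> 0"
    and g: "degree g + 1 < card S"
  shows "(\<Sum>s\<in>S. poly g s / poly (pderiv P) s) = 0"
proof -
  define L where "L s = (\<Prod>t\<in>S - {s}. [:-t, 1:])" for s
  have degL: "degree (L s) = card S - 1" "coeff (L s) (card S - 1) = 1" if "s \<in> S" for s
  proof -
    show "degree (L s) = card S - 1" unfolding L_def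
      using S that by (subst degree_prod_eq_sum_degree) auto
    moreover have "lead_coeff (L s) = 1" unfolding L_def by (simp add: lead_coeff_prod)
    ultimately show "coeff (L s) (card S - 1) = 1" by simp
  qed
  have Lt: "poly (L s) t = 0" if "t \<in> S" "t \<noteq> s" for s t
    using S that by (auto simp: L_def poly_prod)
  have Ls: "poly (L s) s \<noteq> 0" for s using S by (auto simp: L_def poly_prod)
  have PL: "P = smult (lead_coeff P) ([:-s, 1:] * L s)" if s: "s \<in> S" for s
  proof (rule poly_eqI_degree_lead_coeff[where n = "card S" and A = S])
    have deg: "degree ([:-s, 1:] * L s) = card S"
      using degL[OF s] g Ls[of s] by (subst degree_mult_eq) auto
    moreover have "lead_coeff ([:-s, 1:] * L s) = 1"
      using degL[OF s] by (simp only: lead_coeff_mult) simp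
    ultimately show "coeff P (card S) = coeff (smult (lead_coeff P) ([:-s, 1:] * L s)) (card S)"
      using S by simp
    show "degree (smult (lead_coeff P) ([:-s, 1:] * L s)) \<le> card S"
      using deg degree_smult_le[of "lead_coeff P" "[:-s, 1:] * L s"] by simp
    show "poly P t = poly (smult (lead_coeff P) ([:-s, 1:] * L s)) t" if "t \<in> S" for t
      using S(3)[OF that] Lt[OF that] by (cases "t = s") auto
  qed (use S in auto)
  have dP: "poly (pderiv P) s = lead_coeff P * poly (L s) s" if s: "s \<in> S" for s
    by (subst PL[OF s]) (simp add: pderiv_smult pderiv_mult pderiv_pCons del: mult_pCons_left)
  define h where "h = (\<Sum>s\<in>S. smult (poly g s / poly (L s) s) (L s))"
  have "h = g"
  proof (rule poly_eqI_degree[where A = S])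
    show "poly h t = poly g t" if t: "t \<in> S" for t
    proof -
      have "poly h t = (\<Sum>s\<in>S. if s = t then poly g t else 0)" unfolding h_def poly_sum
        using Ls Lt t by (intro sum.cong) auto
      thus ?thesis using S t by simp
    qed
    have "degree h \<le> card S - 1" unfolding h_def
      by (rule degree_sum_le[OF S(1)]) (use degL in \<open>auto intro: order.trans[OF degree_smult_le]\<close>)
    thus "degree h < card S" using g by simp
    show "degree g < card S" using g by simp
  qed
  hence "coeff h (card S - 1) = 0" using g by (intro coeff_eq_0) auto
  hence "(\<Sum>s\<in>S. poly g s / poly (L s) s) = 0"
    unfolding h_def coeff_sum using degL by simp
  hence "(\<Sum>s\<in>S. poly g s / poly (L s) s) / lead_coeff P = 0" by simp
  thus ?thesis by (simp add: sum_divide_distrib dP divide_divide_eq_left mult.commute)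
qed

context curve
begin

section \<open>Regular differentials at infinity\<close>

lemma ev2_altdef:
  assumes "degree N \<le> n"
  shows "ev2 N x y = (\<Sum>j\<le>n. evp (coeff N j) x * y ^ j)"
proof -
  have "degree (map_poly (\<lambda>c. evp c x) N) \<le> n"
    by (rule degree_le) (use assms in \<open>auto simp: coeff_map_poly coeff_eq_0\<close>)
  hence "ev2 N x y = (\<Sum>j\<le>n. coeff (map_poly (\<lambda>c. evp c x) N) j * y ^ j)"
    unfolding ev2_def poly_altdef by (intro sum.mono_neutral_left) (auto simp: coeff_eq_0)
  thus ?thesis by (simp add: coeff_map_poly)
qed

lemma emb_sum: "emb i \<Longrightarrow> i (sum F A) = (\<Sum>a\<in>A. i (F a))"
  by (induction A rule: infinite_finite_induct) (auto simp: emb_0 emb_add)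

text \<open>\<open>recip c\<close> is \<open>c(1/X)\<close>.\<close>

definition recip :: "'a poly \<Rightarrow> 'a poly fract" where
  "recip c = poly (map_poly (\<lambda>k. tf [:k:]) c) (1 / tf [:0, 1:])"

lemma evf_recip:
  assumes t: "transc x"
  shows "evf (recip c) x = evp c (1 / x)"
proof (induction c)
  case 0 thus ?case using t by (simp add: recip_def evf_0)
next
  case (pCons k c)
  have "recip (pCons k c) = tf [:k:] + (1 / tf [:0, 1:]) * recip c"
    by (simp add: recip_def map_poly_pCons)
  moreover have "1 / tf [:0, 1 :: 'a:] = Fract 1 [:0, 1:]" by (subst Fract_eq_tf_div) auto
  ultimately show ?case using t pCons
    by (simp add: evf_add evf_mult evf_tf evf_Fract evp_const evp_pCons)
qed

lemma evp_inverse_X_vanishes: "k > 0 \<Longrightarrow> evp c (1 / fls_X) $$ k = 0" for c :: "'a poly"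
proof (induction c arbitrary: k)
  case (pCons a c)
  have X: "1 / fls_X = (fls_X_inv :: 'a fls)" by (simp add: divide_inverse fls_inverse_X)
  have "evp (pCons a c) (1 / fls_X) = K a + fls_shift 1 (evp c (1 / fls_X))"
    unfolding X by (simp only: evp_pCons fls_X_inv_times_conv_shift)
  thus ?case using pCons by (simp only: fls_plus_nth fls_shift_nth fls_const_nth) simp
qed simp

lemma dvd_Fpol_eq_smult:
  assumes "Fpol dvd P" "degree P \<le> Suc q"
  shows "\<exists>e. P = smult e Fpol"
proof -
  obtain E where E: "P = Fpol * E" using assms by (auto simp: dvd_def)
  have "degree E = 0"
  proof (cases "E = 0")
    case False
    thus ?thesis using E assms(2) degree_Fpol degree_mult_eq[of Fpol E] Fpol_nonzero by simp
  qed simp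
  then obtain e where "E = [:e:]" by (auto elim: degree_eq_zeroE)
  thus ?thesis using E by (intro exI[of _ e]) simp
qed

text \<open>The inversion \<open>(x, y) \<mapsto> (1/x, 1/y)\<close> moves the places over infinity to the node at the origin; the
  leading coefficient in \<open>y\<close> of \<open>numer f\<close>, evaluated at \<open>1/x\<close>, is then divisible by \<open>x\<^sup>2\<close>.\<close>

lemma degree_numer_less:
  assumes reg: "regular_diff f"
  shows "degree (numer f) < q"
proof -
  obtain w where w: "w \<in> Hgens q lam" "fmul q lam (w xf) xf = 1" "fmul q lam (w yf) yf = 1"
    using exists_inversion by blast
  have wA: "w \<in> AutX" using w(1) by (simp add: Hgens_def)
  \<comment> \<open>f2 dx is the image of f dx under the inversion, as d(1/x) = - dx / x^2; hence it
    is regular too and has a polynomial numerator \<open>N2\<close>.\<close>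
  define f2 where "f2 = - (w (f mod Fpol) * (w xf) ^ 2)"
  have jx: "act w i xf = 1 / i xf" "act w i yf = 1 / i yf" if i: "emb i" for i
    using inversion_emb[OF w(2) i] inversion_emb_y[OF w(3) i]
      transc_nonzero[OF emb_transc[OF i]] transc_nonzero[OF emb_transc_y[OF i]]
    by (simp_all add: act_xf act_yf nonzero_eq_divide_eq)
  have jf: "i f2 = - (act w i f * (1 / i xf) ^ 2)" if i: "emb i" for i
    using jx(1)[OF i]
    by (simp add: f2_def emb_simps[OF i] act_xf) (simp add: act_def)
  have reg2: "regular_diff f2" unfolding regular_diff_def
  proof (intro allI impI)
    fix i assume i: "emb i"
    have x0: "i xf \<noteq> 0" using transc_nonzero[OF emb_transc[OF i]] .
    have "fls_deriv (1 / i xf * i xf) = 0" using x0 by simp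
    hence "fls_deriv (1 / i xf) * i xf = - (1 / i xf * fls_deriv (i xf))"
      by (simp only: fls_deriv_mult eq_neg_iff_add_eq_0 add.commute)
    hence "fls_deriv (1 / i xf) = - ((1 / i xf) ^ 2 * fls_deriv (i xf))"
      using x0 by (simp add: field_simps power2_eq_square)
    hence "i f2 * fls_deriv (i xf) = act w i f * fls_deriv (act w i xf)"
      by (simp add: jf[OF i] jx(1)[OF i])
    moreover have "ge 0 (act w i f * fls_deriv (act w i xf))"
      using reg emb_act[OF wA i] unfolding regular_diff_def by blast
    ultimately show "ge 0 (i f2 * fls_deriv (i xf))" by simp
  qed
  obtain N0 where N0: "numer f = map_poly tf N0" using regular_diff_numer_polynomial[OF reg] by blast
  obtain N2 where N2: "numer f2 = map_poly tf N2" using regular_diff_numer_polynomial[OF reg2] by blast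
  have dN: "degree N0 \<le> q" "degree N2 \<le> q"
    using degree_numer[of f] degree_numer[of f2] unfolding N0 N2 by (simp_all add: degree_map_poly)
  let ?X = "tf [:0, 1 :: 'a:]"
  \<comment> \<open>On the curve x^(q-1) y^q N0(1/x, 1/y) = y N2(x, y), by the behaviour of F_y
    under inversion. The difference \<open>P\<close> has degree at most q + 1 in y and is therefore
    a K(x)-multiple of \<open>Fpol\<close>.\<close>
  define P where "P = (\<Sum>j\<le>q. monom (?X ^ (q - 1) * recip (coeff N0 j)) (q - j)) - yf * map_poly tf N2"
  have tX: "transc (fls_X :: 'a fls)" using transc_const_plus_X[of 0] by simp
  have "Fpol dvd P"
  proof -
    obtain i where i: "emb i" using emb_exists by blast
    define x y where "x = i xf" and "y = i yf"
    have t: "transc x" unfolding x_def by (rule emb_transc[OF i])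
    have nz: "x \<noteq> 0" "y \<noteq> 0" using transc_nonzero t emb_transc_y[OF i] by (auto simp: y_def)
    define A where "A = act w i f"
    have e1: "ev2 N0 (1 / x) (1 / y) = A * Dy (1 / x) (1 / y)"
      using emb_map_poly[OF emb_act[OF wA i], of N0] emb_numer[OF emb_act[OF wA i], of f]
      by (simp add: N0 jx[OF i] A_def x_def y_def)
    have e2: "ev2 N2 x y = - (A * (1 / x) ^ 2) * Dy x y"
      using emb_map_poly[OF i, of N2] emb_numer[OF i, of f2]
      by (simp add: N2 jf[OF i] A_def x_def y_def)
    have e3: "Dy (1 / x) (1 / y) * (x * y) ^ (q + 1) = - (y ^ 2 * Dy x y)"
      by (rule Gy_inverse[OF nz]) (simp add: x_def y_def emb_G[OF i])
    have "x ^ 2 * y * (x ^ (q - 1) * (y ^ q * ev2 N0 (1 / x) (1 / y))) = x ^ 2 * y * (y * ev2 N2 x y)"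
    proof -
      have xq: "x ^ (q + 1) = x ^ 2 * x ^ (q - 1)" using q_gt_1 by (simp flip: power_add)
      have "x ^ 2 * y * (x ^ (q - 1) * (y ^ q * ev2 N0 (1 / x) (1 / y)))
        = A * (Dy (1 / x) (1 / y) * (x * y) ^ (q + 1))"
        unfolding power_mult_distrib xq e1 by (simp add: algebra_simps)
      also have "\<dots> = x ^ 2 * y * (y * ev2 N2 x y)"
        unfolding e3 e2 using nz by (simp add: power2_eq_square field_simps)
      finally show ?thesis .
    qed
    hence E: "x ^ (q - 1) * (y ^ q * ev2 N0 (1 / x) (1 / y)) = y * ev2 N2 x y" using nz by simp
    have "y ^ q * ev2 N0 (1 / x) (1 / y) = (\<Sum>j\<le>q. evp (coeff N0 j) (1 / x) * y ^ (q - j))"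
      unfolding ev2_altdef[OF dN(1)] sum_distrib_left using nz
      by (intro sum.cong) (auto simp: power_divide power_diff)
    hence "(\<Sum>j\<le>q. x ^ (q - 1) * evp (coeff N0 j) (1 / x) * y ^ (q - j)) = y * ev2 N2 x y"
      using E by (simp add: sum_distrib_left mult.assoc)
    moreover have "i (monom (?X ^ (q - 1) * recip c) k) = x ^ (q - 1) * evp c (1 / x) * y ^ k" for c k
    proof -
      have "?X ^ n = tf ([:0, 1:] ^ n)" for n by (induction n) (simp_all only: power_0 tf_1 power_Suc tf_mult)
      hence X: "evf (?X ^ (q - 1)) x = x ^ (q - 1)" using t by (simp add: evf_tf evp_power evp_X)
      have "monom (?X ^ (q - 1) * recip c) k = [:?X ^ (q - 1) * recip c:] * yf ^ k"
        by (simp add: monom_altdef yf_def)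
      thus ?thesis using t
        by (simp only: emb_mult[OF i] emb_power[OF i] emb_const[OF i] x_def[symmetric] y_def[symmetric] evf_mult X evf_recip)
    qed
    ultimately have "i P = 0"
      unfolding P_def emb_diff[OF i] emb_sum[OF i] emb_mult[OF i] emb_map_poly[OF i] by (simp add: x_def y_def)
    thus ?thesis using emb_eq_0_iff[OF i] by blast
  qed
  moreover have "degree P \<le> Suc q"
  proof -
    have "degree (\<Sum>j\<le>q. monom (?X ^ (q - 1) * recip (coeff N0 j)) (q - j)) \<le> Suc q"
      by (rule degree_sum_le) (auto intro: order.trans[OF degree_monom_le])
    moreover have "degree (yf * map_poly tf N2) \<le> Suc q"
      using degree_mult_le[of yf "map_poly tf N2"] dN degree_map_poly[of tf N2] by (simp add: degree_yf)
    ultimately show ?thesis unfolding P_def by (rule degree_diff_le)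
  qed
  ultimately obtain e where P: "P = smult e Fpol" using dvd_Fpol_eq_smult by blast
  have cy: "coeff (yf * R) (Suc n) = coeff R n" "coeff (yf * R) 0 = 0" for R n by (simp_all add: yf_def)
  have c0: "coeff P 0 = ?X ^ (q - 1) * recip (coeff N0 q)"
  proof -
    have "(\<Sum>j\<le>q. coeff (monom (?X ^ (q - 1) * recip (coeff N0 j)) (q - j)) 0)
      = (\<Sum>j\<le>q. if j = q then ?X ^ (q - 1) * recip (coeff N0 q) else 0)"
      by (intro sum.cong) auto
    thus ?thesis by (simp add: P_def coeff_sum cy)
  qed
  have cq: "coeff P (Suc q) = - tf (coeff N2 q)"
  proof -
    have "(\<Sum>j\<le>q. coeff (monom (?X ^ (q - 1) * recip (coeff N0 j)) (q - j)) (Suc q)) = 0"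
      by (intro sum.neutral) (auto simp: coeff_monom)
    thus ?thesis by (simp add: P_def coeff_sum cy coeff_map_poly)
  qed
  \<comment> \<open>In \<open>Fpol\<close> the constant coefficient is x^(q+1) times the leading
    one, and the same ratio must hold in \<open>P\<close>. After cancelling x^(q-1), a polynomial in
    1/x equals x^2 times a polynomial in x, so it is zero.\<close>
  have "?X ^ (q - 1) * recip (coeff N0 q) = - tf (coeff N2 q) * (?X * ?X ^ q)"
    using c0 cq unfolding P Fpol_def coeff_smult coeff_fibre_poly_0[OF q_gt_1] coeff_fibre_poly_top[OF q_gt_1]
    by (metis mult.assoc)
  also have "?X * ?X ^ q = ?X ^ (q - 1) * ?X ^ 2"
    using q_gt_1 by (simp flip: power_add power_Suc)
  finally have "?X ^ (q - 1) * recip (coeff N0 q) = ?X ^ (q - 1) * (- tf (coeff N2 q) * ?X ^ 2)"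
    by (simp only: mult_ac)
  moreover have "?X ^ (q - 1) \<noteq> 0" by simp
  ultimately have r': "recip (coeff N0 q) = - tf (coeff N2 q) * ?X ^ 2" using mult_left_cancel by blast
  have r: "recip (coeff N0 q) = tf (- coeff N2 q * [:0, 1:] ^ 2)"
    unfolding r' by (simp only: tf_mult tf_uminus power2_eq_square)
  have "evp (coeff N0 q) (1 / fls_X) = evp (- coeff N2 q) fls_X * fls_X ^ 2"
    using evf_recip[OF tX, of "coeff N0 q"] unfolding r evf_tf[OF tX]
    by (simp only: evp_mult evp_power evp_X)
  moreover have "ge (0 + int 2) (evp (- coeff N2 q) fls_X * fls_X ^ 2)"
    by (intro ge_mult ge_evp ge_X_power) (simp add: ge_def)
  ultimately have ge2: "ge 2 (evp (coeff N0 q) (1 / fls_X))" by simp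
  have "evp (coeff N0 q) (1 / fls_X) $$ k = 0" for k
    using ge2 evp_inverse_X_vanishes[of k "coeff N0 q"] by (cases "k > 0") (auto simp: ge_def)
  hence "evp (coeff N0 q) (1 / fls_X) = 0" by (intro fls_eqI) simp
  moreover have "transc (1 / fls_X :: 'a fls)"
  proof (rule transcI', rule)
    assume "1 / fls_X \<in> range (K :: 'a \<Rightarrow> _)"
    then obtain c where "1 / fls_X = K (c :: 'a)" by blast
    hence "fls_subdegree (inverse fls_X :: 'a fls) = 0" by (simp add: divide_inverse)
    thus False by simp
  qed
  ultimately have "coeff N0 q = 0" by (simp add: transc_evp_eq_0)
  hence "coeff (numer f) q = 0" unfolding N0 by (simp add: coeff_map_poly)
  hence "degree (numer f) \<noteq> q" using q_gt_1 leading_coeff_0_iff[of "numer f"] by force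
  thus ?thesis using degree_numer[of f] by simp
qed

section \<open>Traces over a generic fibre\<close>

definition fibre_pt :: "'a \<Rightarrow> 'a \<Rightarrow> 'a fls" where
  "fibre_pt x0 s = (SOME y. ge 0 y \<and> y $$ 0 = s \<and> G (K x0 + fls_X) y = 0)"

definition fibre_emb :: "'a \<Rightarrow> 'a \<Rightarrow> 'a poly fract poly \<Rightarrow> 'a fls" where
  "fibre_emb x0 s = (\<lambda>r. evr r (K x0 + fls_X) (fibre_pt x0 s))"

definition fibre :: "'a \<Rightarrow> 'a set" where "fibre x0 = {s. Gf q lam x0 s = 0}"

lemma finite_fibre: "x0 ^ q \<noteq> x0 \<Longrightarrow> finite (fibre x0)" and card_fibre': "x0 ^ q \<noteq> x0 \<Longrightarrow> card (fibre x0) = Suc q"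
  using card_fibre[of x0] by (auto simp: fibre_def intro: card_ge_0_finite)

lemma fibre_pt:
  assumes "x0 ^ q \<noteq> x0" "s \<in> fibre x0"
  shows "ge 0 (fibre_pt x0 s)" "fibre_pt x0 s $$ 0 = s" "G (K x0 + fls_X) (fibre_pt x0 s) = 0"
  using someI_ex[OF exists_point_over[OF assms(1)], of s] assms(2) unfolding fibre_pt_def fibre_def by auto

lemma fibre_emb:
  assumes "x0 ^ q \<noteq> x0" "s \<in> fibre x0"
  shows "emb (fibre_emb x0 s)" "fibre_emb x0 s xf = K x0 + fls_X" "fibre_emb x0 s yf = fibre_pt x0 s"
  using fibre_pt[OF assms] transc_const_plus_X by (simp_all add: fibre_emb_def emb_evr evr_xf evr_yf)

lemma fibre_pt_inj: "x0 ^ q \<noteq> x0 \<Longrightarrow> inj_on (fibre_pt x0) (fibre x0)"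
  by (rule inj_onI) (metis fibre_pt(2))

lemma trace_zero:
  assumes reg: "regular_diff f" and x0: "x0 ^ q \<noteq> x0"
  shows "(\<Sum>s\<in>fibre x0. fibre_emb x0 s f) = 0"
proof -
  let ?x = "K x0 + fls_X"
  let ?S = "fibre_pt x0 ` fibre x0"
  have t: "transc ?x" by (rule transc_const_plus_X)
  define P where "P = fibre_poly q (K lam) ?x"
  define g where "g = map_poly (\<lambda>c. evf c ?x) (numer f)"
  have l1: "K lam \<noteq> 1" using lam_neq_1 by simp
  have card: "card ?S = Suc q" using card_image[OF fibre_pt_inj[OF x0]] card_fibre'[OF x0] by simp
  have 0: "(\<Sum>y\<in>?S. poly g y / poly (pderiv P) y) = 0"
  proof (rule euler_sum)
    show "finite ?S" using finite_fibre[OF x0] by simp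
    show "card ?S = degree P" unfolding card P_def degree_fibre_poly[OF q_gt_1 l1] ..
    show "poly P y = 0" if "y \<in> ?S" for y using that fibre_pt(3)[OF x0] by (auto simp: P_def poly_fibre_poly)
    show "P \<noteq> 0" unfolding P_def by (rule fibre_poly_nonzero[OF q_gt_1 l1])
    \<comment> \<open>The bound q - 1 on the degree is the largest that Euler's formula admits for q
      + 1 points.\<close>
    have "degree g \<le> degree (numer f)" unfolding g_def
      by (rule degree_le) (auto simp: coeff_map_poly coeff_eq_0 evf_0 t)
    thus "degree g + 1 < card ?S" using degree_numer_less[OF reg] card by simp
  qed
  have q0: "of_nat q = (0 :: 'a fls)" by (simp add: fls_of_nat of_nat_q)
  have "poly g (fibre_pt x0 s) / poly (pderiv P) (fibre_pt x0 s) = fibre_emb x0 s f" if s: "s \<in> fibre x0" for s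
  proof -
    note i = fibre_emb[OF x0 s]
    have "poly g (fibre_pt x0 s) = fibre_emb x0 s (numer f)" by (simp add: g_def fibre_emb_def evr_def)
    also have "\<dots> = fibre_emb x0 s f * Dy ?x (fibre_pt x0 s)" by (simp only: emb_numer[OF i(1)] i)
    finally show ?thesis using Dy_nonzero[OF i(1)] unfolding P_def poly_pderiv_fibre_poly[OF q0] by (simp only: i) simp
  qed
  thus ?thesis using 0 by (subst (asm) sum.reindex[OF fibre_pt_inj[OF x0]]) simp
qed

lemma xf_neq_yf_mod: "\<not> Fpol dvd xf - yf"
proof
  assume d: "Fpol dvd xf - yf"
  have e: "(xf :: 'a poly fract poly) - yf = [:tf [:0, 1:], -1:]" by (simp add: xf_def yf_def)
  have n: "(xf :: 'a poly fract poly) - yf \<noteq> 0" and "degree ((xf :: 'a poly fract poly) - yf) \<le> 1"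
    unfolding e by auto
  thus False using dvd_imp_degree_le[OF d n] degree_Fpol q_gt_1 by linarith
qed

text \<open>The image under \<open>s\<close> of each regular form (x - y) x^j y^k dx / F_y has trace
  zero. Only the two powers depend on j and k; the common factor becomes the weight.\<close>

lemma automorphism_relation:
  assumes s: "s \<in> AutX" and x0: "x0 ^ q \<noteq> x0"
  shows "\<exists>W. (\<forall>t\<in>fibre x0. W t \<noteq> 0) \<and> (\<forall>j k. j \<le> q - 2 \<longrightarrow> k \<le> q - 2 \<longrightarrow>
    (\<Sum>t\<in>fibre x0. W t * fibre_emb x0 t (s xf) ^ j * fibre_emb x0 t (s yf) ^ k) = 0)"
proof -
  \<comment> \<open>The image of (x - y) dx / F_y under \<open>s\<close>; on this fibre dx is
    dt.\<close>
  define W where "W t = (let X = fibre_emb x0 t (s xf); Z = fibre_emb x0 t (s yf)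
    in (X - Z) * fls_deriv X / Dy X Z)" for t
  obtain w where w: "Fpol dvd DyR * w - 1" using DyR_inverse by blast
  obtain m where m: "\<And>i. emb i \<Longrightarrow> fls_deriv (i (s xf)) = i m * fls_deriv (i xf)"
    using exists_derivative by blast
  have "(\<Sum>t\<in>fibre x0. W t * fibre_emb x0 t (s xf) ^ j * fibre_emb x0 t (s yf) ^ k) = 0"
    if jk: "j \<le> q - 2" "k \<le> q - 2" for j k
  proof -
    define g where "g = (xf - yf) * xf ^ j * yf ^ k * w"
    have gi: "i g = (i xf - i yf) * i xf ^ j * i yf ^ k / Dy (i xf) (i yf)" if i: "emb i" for i
    proof -
      have "i DyR * i w = 1" using emb_cong[OF i w] emb_mult[OF i] emb_1[OF i] by metis
      hence "i w = 1 / Dy (i xf) (i yf)" using Dy_nonzero[OF i] by (simp add: emb_DyR[OF i] field_simps)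
      thus ?thesis by (simp add: g_def emb_simps[OF i])
    qed
    define f where "f = s (g mod Fpol) * m"
    have fi: "i f * fls_deriv (i xf) = (act s i xf - act s i yf) * act s i xf ^ j * act s i yf ^ k
        * fls_deriv (act s i xf) / Dy (act s i xf) (act s i yf)" if i: "emb i" for i
    proof -
      have "i f * fls_deriv (i xf) = act s i g * fls_deriv (act s i xf)"
        by (simp add: f_def emb_mult[OF i] act_xf m[OF i]) (simp add: act_def)
      thus ?thesis by (simp add: gi[OF emb_act[OF s i]])
    qed
    have "regular_diff f" unfolding regular_diff_def
    proof (intro allI impI)
      fix i assume i: "emb i"
      note j = emb_act[OF s i]
      show "ge 0 (i f * fls_deriv (i xf))"
        unfolding fi[OF i] by (rule holomorphic[OF emb_G[OF j] emb_transc[OF j] jk])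
    qed
    hence "(\<Sum>t\<in>fibre x0. fibre_emb x0 t f) = 0" by (rule trace_zero[OF _ x0])
    moreover have "fibre_emb x0 t f = W t * fibre_emb x0 t (s xf) ^ j * fibre_emb x0 t (s yf) ^ k"
      if t: "t \<in> fibre x0" for t
      using fi[OF fibre_emb(1)[OF x0 t]] by (simp add: fibre_emb(2)[OF x0 t] act_xf act_yf W_def Let_def)
    ultimately show ?thesis by simp
  qed
  moreover have "W t \<noteq> 0" if t: "t \<in> fibre x0" for t
  proof -
    let ?i = "fibre_emb x0 t"
    note i = fibre_emb[OF x0 t]
    note j = emb_act[OF s i(1)]
    have "act s ?i (xf - yf) \<noteq> 0" using emb_eq_0_iff[OF j] xf_neq_yf_mod by blast
    hence 1: "?i (s xf) - ?i (s yf) \<noteq> 0" by (simp add: emb_diff[OF j] act_xf act_yf)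
    \<comment> \<open>Applying \<open>s\<close> to the derivative of s^{-1}(x) gives dx / d s(x), so
      the derivative of s(x) is a divisor of 1 and cannot vanish.\<close>
    obtain m' where m': "\<And>i. emb i \<Longrightarrow> fls_deriv (i (inv_aut q lam s xf)) = i m' * fls_deriv (i xf)"
      using exists_derivative by blast
    have "act s ?i (inv_aut q lam s xf) = ?i xf"
      by (simp add: act_FF Aut_in_FF[OF inv_in_Aut(1)[OF s] xf_in_FF] inv_in_Aut(2)[OF s xf_in_FF])
    hence "act s ?i m' * fls_deriv (?i (s xf)) = 1"
      using m'[OF j] i(2) by (simp add: act_xf)
    hence 2: "fls_deriv (?i (s xf)) \<noteq> 0" by auto
    show ?thesis using 1 2 Dy_nonzero[OF j] by (simp add: W_def Let_def act_xf act_yf)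
  qed
  ultimately show ?thesis by blast
qed

end

section \<open>Points failing to impose independent conditions\<close>

lemma poly_sum_le:
  fixes p :: "'b::comm_ring_1 poly"
  assumes "degree p \<le> n" shows "poly p x = (\<Sum>j\<le>n. coeff p j * x ^ j)"
  unfolding poly_altdef using assms by (intro sum.mono_neutral_left) (auto simp: coeff_eq_0)

lemma grid_relation_polys:
  fixes X Z W :: "'c \<Rightarrow> 'b::field"
  assumes rel: "\<And>j k. j \<le> n \<Longrightarrow> k \<le> n \<Longrightarrow> (\<Sum>s\<in>S. W s * X s ^ j * Z s ^ k) = 0"
    and d: "degree p \<le> n" "degree r \<le> n"
  shows "(\<Sum>s\<in>S. W s * poly p (X s) * poly r (Z s)) = 0"
proof -
  have "(\<Sum>s\<in>S. W s * poly p (X s) * poly r (Z s)) =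
     (\<Sum>s\<in>S. \<Sum>j\<le>n. \<Sum>k\<le>n. coeff p j * coeff r k * (W s * X s ^ j * Z s ^ k))"
    unfolding poly_sum_le[OF d(1)] poly_sum_le[OF d(2)] mult.assoc[of "W _"]
    unfolding sum_product unfolding sum_distrib_left
    by (intro sum.cong refl) (simp only: mult_ac)
  also have "\<dots> = (\<Sum>j\<le>n. \<Sum>s\<in>S. \<Sum>k\<le>n. coeff p j * coeff r k * (W s * X s ^ j * Z s ^ k))"
    by (rule sum.swap)
  also have "\<dots> = (\<Sum>j\<le>n. \<Sum>k\<le>n. \<Sum>s\<in>S. coeff p j * coeff r k * (W s * X s ^ j * Z s ^ k))"
    by (intro sum.cong refl sum.swap)
  also have "\<dots> = (\<Sum>j\<le>n. \<Sum>k\<le>n. coeff p j * coeff r k * (\<Sum>s\<in>S. W s * X s ^ j * Z s ^ k))"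
    by (simp only: sum_distrib_left)
  also have "\<dots> = 0" by (intro sum.neutral ballI) (simp add: rel)
  finally show ?thesis .
qed

text \<open>A union of at most n lines from each ruling is the zero set of a form of bidegree (n,
  n). If it contains all points but t, the relation for this form isolates the weight of t.\<close>

lemma grid_separation:
  fixes X Z W :: "'c \<Rightarrow> 'b::field"
  assumes rel: "\<And>j k. j \<le> n \<Longrightarrow> k \<le> n \<Longrightarrow> (\<Sum>s\<in>S. W s * X s ^ j * Z s ^ k) = 0"
    and S: "finite S" "t \<in> S" "W t \<noteq> 0"
    and A: "finite A" "card A \<le> n" "X t \<notin> A" and B: "finite B" "card B \<le> n" "Z t \<notin> B"
    and cover: "\<And>s. s \<in> S \<Longrightarrow> s \<noteq> t \<Longrightarrow> X s \<in> A \<or> Z s \<in> B"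
  shows False
proof -
  define p where "p = (\<Prod>a\<in>A. [:-a, 1:])"
  define r where "r = (\<Prod>b\<in>B. [:-b, 1:])"
  have d: "degree p \<le> n" "degree r \<le> n"
    unfolding p_def r_def using A B by (subst degree_prod_eq_sum_degree; auto)+
  have z: "poly p x = 0 \<longleftrightarrow> x \<in> A" "poly r x = 0 \<longleftrightarrow> x \<in> B" for x
    using A B by (auto simp: p_def r_def poly_prod)
  have "0 = (\<Sum>s\<in>S. W s * poly p (X s) * poly r (Z s))"
    by (rule grid_relation_polys[OF rel d, symmetric])
  also have "\<dots> = W t * poly p (X t) * poly r (Z t) + (\<Sum>s\<in>S - {t}. W s * poly p (X s) * poly r (Z s))"
    using S by (simp add: sum.remove)
  also have "(\<Sum>s\<in>S - {t}. W s * poly p (X s) * poly r (Z s)) = 0"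
    using cover z by (intro sum.neutral) auto
  finally show False using S A B z by auto
qed

text \<open>This is where \<open>q > 3\<close> enters: \<open>q + 1\<close> points that are dependent with respect to forms of
  bidegree \<open>(q - 2, q - 2)\<close> must lie on a line of a ruling.\<close>

lemma grid_dichotomy:
  fixes X Z W :: "'c \<Rightarrow> 'b::field"
  assumes q: "q > 3"
    and rel: "\<And>j k. j \<le> q - 2 \<Longrightarrow> k \<le> q - 2 \<Longrightarrow> (\<Sum>s\<in>S. W s * X s ^ j * Z s ^ k) = 0"
    and S: "finite S" "card S = Suc q" "\<And>s. s \<in> S \<Longrightarrow> W s \<noteq> 0"
    and inj: "\<And>s t. s \<in> S \<Longrightarrow> t \<in> S \<Longrightarrow> X s = X t \<Longrightarrow> Z s = Z t \<Longrightarrow> s = t"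
  shows "(\<exists>w. \<forall>s\<in>S. X s = w) \<or> (\<exists>w. \<forall>s\<in>S. Z s = w)"
proof (cases "\<exists>t\<in>S. card {s \<in> S - {t}. X s = X t} \<le> q - 2 \<and> card {s \<in> S - {t}. Z s = Z t} \<le> q - 2")
  case True
  then obtain t where t: "t \<in> S" and c: "card {s \<in> S - {t}. X s = X t} \<le> q - 2" "card {s \<in> S - {t}. Z s = Z t} \<le> q - 2"
    by blast
  define C D where "C = {s \<in> S - {t}. X s = X t}" and "D = {s \<in> S - {t}. Z s = Z t}"
  note c = c[folded C_def D_def]
  have CDS: "C \<subseteq> S - {t}" "D \<subseteq> S - {t}" by (auto simp: C_def D_def)
  have fin: "finite C" "finite D" "finite (S - {t})" using S by (auto simp: C_def D_def)
  have cS: "card (S - {t}) = q" using S t by simp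
  have disj: "C \<inter> D = {}" using inj t by (auto simp: C_def D_def)
  have "card C + card D = card (C \<union> D)" using fin disj by (simp add: card_Un_disjoint)
  also have "\<dots> \<le> q" unfolding cS[symmetric] using fin CDS by (intro card_mono) auto
  finally have CD: "card C + card D \<le> q" .
  have cC: "card (S - {t} - C) = q - card C" using fin cS CDS by (subst card_Diff_subset) auto
  \<comment> \<open>Points of \<open>B\<close> are separated from t by their X-value, the remaining
    ones by their Z-value, so \<open>B\<close> contains \<open>D\<close> and avoids
    \<open>C\<close>. Size \<open>max 2 (card D)\<close> leaves at most q - 2 points on each side; 2
    <= q - 2 is the use of q > 3.\<close>
  have "\<exists>B. D \<subseteq> B \<and> B \<subseteq> S - {t} - C \<and> card B = max 2 (card D)"
    using disj fin c CD q CDS by (intro exists_subset_between) (auto simp: cC)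
  then obtain B where B: "D \<subseteq> B" "B \<subseteq> S - {t} - C" "card B = max 2 (card D)" by blast
  have finB: "finite B" using B(2) fin by (meson finite_subset finite_Diff)
  have "card (S - {t} - B) = q - card B" using finB B(2) cS by (subst card_Diff_subset) auto
  hence cB: "card (S - {t} - B) \<le> q - 2" "card B \<le> q - 2" using B(3) c q by auto
  have False
  proof (rule grid_separation[OF rel S(1) t S(3)[OF t], where A = "X ` B" and B = "Z ` (S - {t} - B)"])
    show "finite (X ` B)" "finite (Z ` (S - {t} - B))" using finB fin by auto
    show "card (X ` B) \<le> q - 2" using card_image_le[OF finB, of X] cB by simp
    show "card (Z ` (S - {t} - B)) \<le> q - 2"
      using card_image_le[of "S - {t} - B" Z] cB fin by (meson finite_Diff order.trans)
    show "X t \<notin> X ` B" using B(2) by (force simp: C_def)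
    show "Z t \<notin> Z ` (S - {t} - B)" using B(1) by (force simp: D_def)
  qed auto
  thus ?thesis ..
next
  case False
  \<comment> \<open>Here at least q - 1 points share their X-value with t. A point u off this line
    would then be the only one, and the line alone separates u from the rest. The claim is stated
    for arbitrary X, Z so that it covers both rulings.\<close>
  have *: "\<exists>w. \<forall>s\<in>S. X s = w"
    if rel: "\<And>j k. j \<le> q - 2 \<Longrightarrow> k \<le> q - 2 \<Longrightarrow> (\<Sum>s\<in>S. W s * X s ^ j * Z s ^ k) = 0"
      and t: "t \<in> S" and c: "card {s \<in> S - {t}. X s = X t} > q - 2" for X Z :: "'c \<Rightarrow> 'b" and t
  proof (rule ccontr)
    assume n: "\<nexists>w. \<forall>s\<in>S. X s = w"
    then obtain u where u: "u \<in> S" "X u \<noteq> X t" by metis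
    let ?C = "{s \<in> S - {t}. X s = X t}"
    have "?C \<subseteq> S - {t, u}" using u by auto
    moreover have "u \<noteq> t" using u by auto
    hence "card (S - {t, u}) = q - 1" using S t u by (subst card_Diff_subset) auto
    ultimately have "?C = S - {t, u}" using c S q by (intro card_subset_eq) (auto intro: antisym dest: card_mono[rotated])
    hence *: "X s = X t" if "s \<in> S" "s \<noteq> u" for s using that by (cases "s = t") auto
    show False
      by (rule grid_separation[OF rel S(1) u(1) S(3)[OF u(1)], where A = "{X t}" and B = "{}"])
         (use q u * in auto)
  qed
  have "S \<noteq> {}" using S by auto
  then obtain t where t: "t \<in> S" by blast
  have "card {s \<in> S - {t}. X s = X t} > q - 2 \<or> card {s \<in> S - {t}. Z s = Z t} > q - 2"
    using False t by force
  thus ?thesis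
  proof
    assume "card {s \<in> S - {t}. X s = X t} > q - 2"
    thus ?thesis using *[OF rel t] by blast
  next
    assume c: "card {s \<in> S - {t}. Z s = Z t} > q - 2"
    have rel': "(\<Sum>s\<in>S. W s * Z s ^ j * X s ^ k) = 0" if "j \<le> q - 2" "k \<le> q - 2" for j k
      using rel[OF that(2,1)] by (simp only: mult_ac)
    show ?thesis using *[OF rel' t c] by blast
  qed
qed

context curve
begin

section \<open>Automorphisms preserve the two rulings\<close>

lemma infinite_UNIV: "infinite (UNIV :: 'a set)"
proof
  assume fin: "finite (UNIV :: 'a set)"
  define P where "P = (\<Prod>a\<in>(UNIV :: 'a set). [:-a, 1:])"
  have "degree P = card (UNIV :: 'a set)" unfolding P_def by (subst degree_prod_eq_sum_degree) auto
  hence "degree P > 0" using fin by (simp add: card_gt_0_iff)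
  hence "degree (P + 1) > 0" by (simp add: degree_add_eq_left)
  then obtain z where "poly (P + 1) z = 0" using alg_closed by blast
  moreover have "poly P z = 0" using fin by (auto simp: P_def poly_prod)
  ultimately show False by simp
qed

lemma nonroot_exists: "P \<noteq> 0 \<Longrightarrow> \<exists>z. poly P z \<noteq> 0" for P :: "'a poly"
  using infinite_UNIV poly_roots_finite[of P] by (metis (mono_tags, lifting) UNIV_I finite_subset mem_Collect_eq subsetI)

lemma off_Fq_exists: "\<exists>x0 :: 'a. x0 ^ q \<noteq> x0"
  using infinite_UNIV card_Fq q_gt_1 by (metis (mono_tags, lifting) Collect_cong UNIV_def card.infinite
      finite_subset not_less_zero subset_UNIV)

text \<open>The q + 1 points (s(x), s(y)) over x = x0 + t are distinct because s^{-1}(y) recovers y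
  from them, so \<open>grid_dichotomy\<close> makes one coordinate constant on the fibre.\<close>

lemma automorphism_dichotomy:
  assumes s: "s \<in> AutX"
  shows "(\<exists>a. s xf = [:a:]) \<or> (\<exists>a. s yf = [:a:])"
proof -
  obtain x0 :: 'a where x0: "x0 ^ q \<noteq> x0" using off_Fq_exists by blast
  let ?e = "fibre_emb x0" and ?x = "K x0 + fls_X"
  have t: "transc ?x" by (rule transc_const_plus_X)
  obtain W where W: "\<And>t. t \<in> fibre x0 \<Longrightarrow> W t \<noteq> 0" "\<And>j k. j \<le> q - 2 \<Longrightarrow> k \<le> q - 2 \<Longrightarrow>
    (\<Sum>t\<in>fibre x0. W t * ?e t (s xf) ^ j * ?e t (s yf) ^ k) = 0"
    using automorphism_relation[OF s x0] by blast
  have "(\<exists>w. \<forall>t\<in>fibre x0. ?e t (s xf) = w) \<or> (\<exists>w. \<forall>t\<in>fibre x0. ?e t (s yf) = w)"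
  proof (rule grid_dichotomy[OF q_gt_3 W(2) finite_fibre[OF x0] card_fibre'[OF x0] W(1)])
    fix t u assume tu: "t \<in> fibre x0" "u \<in> fibre x0" "?e t (s xf) = ?e u (s xf)" "?e t (s yf) = ?e u (s yf)"
    have "act s (?e t) = act s (?e u)"
      using tu by (intro emb_eqI emb_act[OF s] fibre_emb(1)[OF x0]) (auto simp: act_xf act_yf)
    hence "act s (?e t) (inv_aut q lam s yf) = act s (?e u) (inv_aut q lam s yf)" by simp
    hence "?e t yf = ?e u yf"
      by (simp add: act_FF Aut_in_FF[OF inv_in_Aut(1)[OF s] yf_in_FF] inv_in_Aut(2)[OF s yf_in_FF])
    hence "fibre_pt x0 t = fibre_pt x0 u" using fibre_emb(3)[OF x0] tu by simp
    thus "t = u" using fibre_pt_inj[OF x0] tu by (auto dest: inj_onD)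
  qed auto
  \<comment> \<open>A polynomial of degree at most q in y with the same value at q + 1 points is
    constant, so r lies in K(x).\<close>
  moreover have "\<exists>a. r = [:a:]" if r: "degree r \<le> q" and w: "\<forall>t\<in>fibre x0. ?e t r = w" for r w
  proof -
    let ?r = "map_poly (\<lambda>c. evf c ?x) r"
    have "?r = [:w:]"
    proof (rule poly_eqI_degree[where A = "fibre_pt x0 ` fibre x0"])
      have c: "card (fibre_pt x0 ` fibre x0) = Suc q"
        using card_image[OF fibre_pt_inj[OF x0]] card_fibre'[OF x0] by simp
      show "degree [:w:] < card (fibre_pt x0 ` fibre x0)" unfolding c by simp
      show "degree ?r < card (fibre_pt x0 ` fibre x0)"
        unfolding c using r degree_map_poly[of "\<lambda>c. evf c ?x" r] by (simp add: evf_eq_0[OF t])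
      show "poly ?r y = poly [:w:] y" if "y \<in> fibre_pt x0 ` fibre x0" for y
        using that w by (auto simp: fibre_emb_def evr_def)
    qed
    hence "degree ?r = 0" by simp
    hence "degree r = 0" using degree_map_poly[of "\<lambda>c. evf c ?x" r] by (simp add: evf_eq_0[OF t])
    thus ?thesis by (metis degree_eq_zeroE)
  qed
  moreover have "degree (s xf) \<le> q" "degree (s yf) \<le> q"
    using Aut_in_FF[OF s] xf_in_FF yf_in_FF FF_iff by auto
  ultimately show ?thesis by blast
qed

lemma subfield_consts:
  assumes i: "emb i"
  shows "subfield_fls (range (\<lambda>r. i [:r:]))"
  unfolding subfield_fls_def
proof (intro conjI ballI allI)
  fix c show "K c \<in> range (\<lambda>r. i [:r:])" using emb_kc[OF i, of c] unfolding kc_def by (metis rangeI)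
next
  fix u v assume "u \<in> range (\<lambda>r. i [:r:])" "v \<in> range (\<lambda>r. i [:r:])"
  then obtain a b where ab: "u = i [:a:]" "v = i [:b:]" by blast
  have "u + v = i [:a + b:]" "u * v = i [:a * b:]"
    using emb_add[OF i, of "[:a:]" "[:b:]"] emb_mult[OF i, of "[:a:]" "[:b:]"]
    by (simp_all add: ab mult.commute)
  thus "u + v \<in> range (\<lambda>r. i [:r:])" "u * v \<in> range (\<lambda>r. i [:r:])" by blast+
next
  fix u assume "u \<in> range (\<lambda>r. i [:r:])"
  then obtain a where a: "u = i [:a:]" by blast
  show "inverse u \<in> range (\<lambda>r. i [:r:])"
  proof (cases "a = 0")
    case True
    hence "inverse u = i [:0:]" using a emb_0[OF i] by simp
    thus ?thesis by (rule range_eqI)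
  next
    case False
    hence "[:a:] * [:1 / a:] = 1" by (simp add: one_pCons)
    hence "i [:a:] * i [:1 / a:] = 1" using emb_mult[OF i, of "[:a:]" "[:1 / a:]"] emb_1[OF i] by simp
    hence "inverse u = i [:1 / a:]" unfolding a by (rule inverse_unique)
    thus ?thesis by (rule range_eqI)
  qed
qed

lemma evf_in_consts:
  assumes i: "emb i" and w: "transc w" "w \<in> range (\<lambda>r. i [:r:])"
  shows "evf b w \<in> range (\<lambda>r. i [:r:])"
proof -
  have "evr [:b:] w w = evf b w" using w by (simp add: evr_pCons evr_0)
  thus ?thesis using subfield_evr[OF subfield_consts[OF i] w w(2), of "[:b:]"] by simp
qed

lemma const_in_FF: "[:r:] \<in> FF q lam" by (simp add: FF_iff)

lemma yf_not_const_range: "emb i \<Longrightarrow> i yf \<notin> range (\<lambda>r. i [:r:])"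
proof
  assume i: "emb i" and "i yf \<in> range (\<lambda>r. i [:r:])"
  then obtain r where "i yf = i [:r:]" by blast
  hence "(yf :: 'a poly fract poly) = [:r:]" using FF_inj[OF i yf_in_FF const_in_FF] by blast
  from arg_cong[OF this, of degree] show False by (simp add: degree_yf)
qed

section \<open>Rational functions with a rational inverse\<close>

definition moebius_x :: "'a \<Rightarrow> 'a \<Rightarrow> 'a \<Rightarrow> 'a \<Rightarrow> ('a poly fract poly \<Rightarrow> 'a poly fract poly) \<Rightarrow> bool" where
  "moebius_x a b c d s \<longleftrightarrow> (\<forall>i. emb i \<longrightarrow>
     i (s xf) * (K c * i xf + K d) = K a * i xf + K b)"

lemma moebius_xI:
  assumes i: "emb i" and e: "i (s xf) * (K c * i xf + K d) = K a * i xf + K b"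
  shows "moebius_x a b c d s"
  unfolding moebius_x_def
proof (intro allI impI)
  fix j assume j: "emb j"
  let ?r = "s xf * (kc c * xf + kc d)" and ?t = "kc a * xf + kc b"
  have "i ?r = i ?t" using e by (simp add: emb_simps[OF i])
  hence "j ?r = j ?t" using emb_eq_iff[OF i] emb_eq_iff[OF j] by blast
  thus "j (s xf) * (K c * j xf + K d) = K a * j xf + K b"
    by (simp add: emb_simps[OF j])
qed

lemma evp_homogenize:
  fixes p n d :: "'a poly"
  assumes "degree p \<le> k" "A * evp d x = evp n x"
  shows "evp (\<Sum>i\<le>k. smult (coeff p i) (n ^ i * d ^ (k - i))) x = evp d x ^ k * evp p A"
proof -
  have s: "evp (\<Sum>i\<le>m. f i) x = (\<Sum>i\<le>m. evp (f i) x)" for m and f :: "nat \<Rightarrow> 'a poly"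
    by (induction m) (auto simp: evp_add)
  have "evp p A = (\<Sum>i\<le>k. K (coeff p i) * A ^ i)"
  proof -
    have "degree (map_poly K p) \<le> k" using assms by (simp add: degree_map_poly)
    thus ?thesis unfolding evp_def by (simp add: poly_sum_le coeff_map_poly)
  qed
  hence "evp d x ^ k * evp p A = (\<Sum>i\<le>k. K (coeff p i) * (A ^ i * evp d x ^ k))"
    by (simp add: sum_distrib_left mult_ac)
  also have "\<dots> = (\<Sum>i\<le>k. K (coeff p i) * (evp n x ^ i * evp d x ^ (k - i)))"
  proof (intro sum.cong refl)
    fix i assume "i \<in> {..k}"
    hence "evp d x ^ k = evp d x ^ i * evp d x ^ (k - i)" by (simp flip: power_add)
    thus "K (coeff p i) * (A ^ i * evp d x ^ k) = K (coeff p i) * (evp n x ^ i * evp d x ^ (k - i))"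
      by (simp add: assms(2)[symmetric] power_mult_distrib mult_ac)
  qed
  finally show ?thesis by (simp add: s evp_smult evp_mult evp_power)
qed

lemma poly_homogenize:
  fixes p n d :: "'a poly"
  assumes "degree p \<le> k" "poly d z \<noteq> 0"
  shows "poly (\<Sum>i\<le>k. smult (coeff p i) (n ^ i * d ^ (k - i))) z = poly d z ^ k * poly p (poly n z / poly d z)"
  unfolding poly_sum poly_sum_le[OF assms(1)] sum_distrib_left
  using assms(2) by (intro sum.cong refl) (simp add: power_divide power_diff)

text \<open>A rational function possessing a rational inverse is injective with nonvanishing derivative at
  almost all points, whence all its generic fibres are singletons without multiplicity.\<close>

lemma moebius_of_rational_inverse:
  fixes x A :: "'a fls"
  assumes t: "transc x" "fls_deriv x = 1" and A: "transc A" "A = evf a x" and B: "evf b A = x"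
  shows "\<exists>\<alpha> \<beta> \<gamma> \<delta>. \<alpha> * \<delta> \<noteq> \<beta> * \<gamma> \<and> A * (K \<gamma> * x + K \<delta>) = K \<alpha> * x + K \<beta>"
proof -
  obtain n d where nd: "d \<noteq> 0" "a = Fract n d" "\<And>z. \<not> (poly n z = 0 \<and> poly d z = 0)"
    using Fract_no_common_root[of a] by blast
  obtain n2 d2 where b: "b = Fract n2 d2" "d2 \<noteq> 0" by (cases b) auto
  have D: "evp d x \<noteq> 0" using t nd by (simp add: transc_evp_eq_0)
  have AD: "A * evp d x = evp n x" using A t nd D by (simp add: evf_Fract)
  have BA: "evp n2 A = x * evp d2 A"
    using B A b transc_evp_eq_0[OF A(1), of d2] by (simp add: evf_Fract field_simps)
  define k where "k = max (degree n2) (degree d2)"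
  \<comment> \<open>\<open>H p\<close> is d^k p(n/d), which clears denominators; b(a(x)) = x becomes
    a polynomial identity that can be specialised to x = z.\<close>
  define H where "H p = (\<Sum>i\<le>k. smult (coeff p i) (n ^ i * d ^ (k - i)))" for p :: "'a poly"
  have k: "degree n2 \<le> k" "degree d2 \<le> k" by (auto simp: k_def)
  have "evp (H n2) x = evp ([:0, 1:] * H d2) x"
    unfolding H_def evp_mult evp_homogenize[OF k(1) AD] evp_homogenize[OF k(2) AD] BA by (simp add: evp_X)
  hence H: "H n2 = [:0, 1:] * H d2" using transc_evp_eq[OF t(1)] by blast
  have star: "poly n2 (poly n z / poly d z) = z * poly d2 (poly n z / poly d z)" if "poly d z \<noteq> 0" for z
  proof -
    have "poly (H n2) z = z * poly (H d2) z" by (simp add: H)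
    thus ?thesis using that unfolding H_def poly_homogenize[OF k(1) that] poly_homogenize[OF k(2) that] by simp
  qed
  have H0: "H d2 \<noteq> 0"
  proof -
    have "evp (H d2) x \<noteq> 0" unfolding H_def evp_homogenize[OF k(2) AD]
      using D A b by (simp add: transc_evp_eq_0)
    thus ?thesis by auto
  qed
  \<comment> \<open>Separability: a vanishing derivative of A would pass to b(A) = x, whose
    derivative is 1.\<close>
  have "fls_deriv A \<noteq> 0"
  proof
    assume "fls_deriv A = 0"
    hence "fls_deriv (evp n2 A) = 0" "fls_deriv (evp d2 A) = 0" by (simp_all add: deriv_evp)
    hence "evp d2 A = 0" using BA t(2) by simp
    thus False using A b by (simp add: transc_evp_eq_0)
  qed
  define W where "W = pderiv n * d - n * pderiv d"
  have "evp W x = fls_deriv A * evp d x ^ 2"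
  proof -
    have "fls_deriv (A * evp d x) = fls_deriv (evp n x)" by (simp only: AD)
    hence "fls_deriv A * evp d x + A * evp (pderiv d) x = evp (pderiv n) x" by (simp add: deriv_evp t(2) add.commute)
    hence "evp W x = (fls_deriv A * evp d x + A * evp (pderiv d) x) * evp d x - (A * evp d x) * evp (pderiv d) x"
      by (simp add: W_def evp_diff evp_mult AD)
    thus ?thesis by (simp add: algebra_simps power2_eq_square)
  qed
  hence "evp W x \<noteq> 0" using D \<open>fls_deriv A \<noteq> 0\<close> by simp
  hence W0: "W \<noteq> 0" by auto
  define good where "good z \<longleftrightarrow> poly d z \<noteq> 0 \<and> poly W z \<noteq> 0 \<and> poly (H d2) z \<noteq> 0" for z
  \<comment> \<open>The roots of \<open>Q t\<close> are the points where n/d takes the value t. For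
    t attained at a good z, a second root equals z because b recovers it from t; then z is a
    multiple root, against \<open>poly W z\<close> being nonzero.\<close>
  define Q where "Q t = n - smult t d" for t
  have Q1: "degree (Q (poly n z / poly d z)) \<le> 1" if z: "good z" for z
  proof (rule ccontr)
    let ?t = "poly n z / poly d z"
    assume deg: "\<not> degree (Q ?t) \<le> 1"
    have dz: "poly d z \<noteq> 0" using z by (simp add: good_def)
    have nz: "poly n z = ?t * poly d z" using dz by simp
    have "poly (Q ?t) z = 0" using dz by (simp add: Q_def)
    then obtain R where R: "Q ?t = [:-z, 1:] * R" by (auto simp: poly_eq_0_iff_dvd dvd_def)
    have "R \<noteq> 0" using R deg by auto
    hence "degree (Q ?t) = Suc (degree R)" by (subst R, subst degree_mult_eq) auto
    then obtain w where w: "poly R w = 0" using alg_closed deg by force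
    hence Qw: "poly n w = ?t * poly d w" using arg_cong[OF R, of "\<lambda>p. poly p w"] by (simp add: Q_def)
    hence dw: "poly d w \<noteq> 0" using nd(3)[of w] by auto
    hence tw: "poly n w / poly d w = ?t" using Qw by simp
    have "poly d2 ?t \<noteq> 0" using z poly_homogenize[OF k(2) dz, of n] by (auto simp: good_def H_def)
    moreover have "z * poly d2 ?t = w * poly d2 ?t"       by (rule trans[OF star[OF dz, symmetric] star[OF dw, unfolded tw]])
    ultimately have "w = z" by (metis mult_right_cancel)
    hence "poly (pderiv (Q ?t)) z = 0" using w by (simp add: R pderiv_mult del: mult_pCons_left)
    hence "poly (pderiv n) z = ?t * poly (pderiv d) z" by (simp add: Q_def pderiv_diff pderiv_smult)
    hence "poly W z = 0" using dz by (simp add: W_def)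
    thus False using z by (simp add: good_def)
  qed
  have g0: "d * W * H d2 \<noteq> 0" using nd W0 H0 by simp
  then obtain z1 where z1: "good z1" using nonroot_exists[OF g0] by (auto simp: good_def)
  define t1 where "t1 = poly n z1 / poly d z1"
  have "Q t1 \<noteq> 0"
  proof
    assume "Q t1 = 0"
    hence "n = smult t1 d" by (simp add: Q_def)
    hence "A = K t1" using AD D by (simp add: evp_smult)
    thus False using transc_not_const[OF A(1)] by blast
  qed
  \<comment> \<open>For two distinct values t1, t2 the polynomials \<open>Q t1\<close>,
    \<open>Q t2\<close> of degree at most 1 span n and d.\<close>
  then obtain z2 where "poly (d * W * H d2 * Q t1) z2 \<noteq> 0" using nonroot_exists[of "d * W * H d2 * Q t1"] g0 by auto
  hence z2: "good z2" "poly (Q t1) z2 \<noteq> 0" by (auto simp: good_def)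
  define t2 where "t2 = poly n z2 / poly d z2"
  have "t1 \<noteq> t2"
  proof
    assume "t1 = t2"
    hence "poly (Q t1) z2 = 0" using z2(1) by (simp add: Q_def t2_def good_def)
    thus False using z2 by simp
  qed
  have q: "degree (Q t1) \<le> 1" "degree (Q t2) \<le> 1" using Q1[OF z1] Q1[OF z2(1)] by (auto simp: t1_def t2_def)
  have "d = smult (1 / (t2 - t1)) (Q t1 - Q t2)"
  proof -
    have "Q t1 - Q t2 = smult (t2 - t1) d" by (simp add: Q_def smult_diff_left)
    thus ?thesis using \<open>t1 \<noteq> t2\<close> by simp
  qed
  moreover have "degree (smult (1 / (t2 - t1)) (Q t1 - Q t2)) \<le> 1"
    using q by (intro order.trans[OF degree_smult_le] degree_diff_le)
  ultimately have dd: "degree d \<le> 1" by simp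
  have "n = Q t1 + smult t1 d" by (simp add: Q_def)
  moreover have "degree (Q t1 + smult t1 d) \<le> 1"
    using q dd by (intro degree_add_le order.trans[OF degree_smult_le])
  ultimately have dn: "degree n \<le> 1" by simp
  have lin: "\<exists>\<alpha> \<beta>. p = [:\<beta>, \<alpha>:]" if "degree p \<le> 1" for p :: "'a poly"
    using that by (intro exI[of _ "coeff p 1"] exI[of _ "coeff p 0"] poly_eqI)
      (auto simp: coeff_pCons coeff_eq_0 split: nat.splits)
  obtain \<alpha> \<beta> where n: "n = [:\<beta>, \<alpha>:]" using lin[OF dn] by blast
  obtain \<gamma> \<delta> where d: "d = [:\<delta>, \<gamma>:]" using lin[OF dd] by blast
  have "W = [:\<alpha> * \<delta> - \<beta> * \<gamma>:]" by (simp add: W_def n d pderiv_pCons mult.commute)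
  hence "\<alpha> * \<delta> \<noteq> \<beta> * \<gamma>" using W0 by auto
  moreover have "A * (K \<gamma> * x + K \<delta>) = K \<alpha> * x + K \<beta>"
    using AD by (simp add: n d evp_pCons algebra_simps)
  ultimately show ?thesis by blast
qed

lemma emb_exists_deriv: "\<exists>i. emb i \<and> fls_deriv (i xf) = 1"
proof -
  obtain x0 :: 'a where x0: "x0 ^ q \<noteq> x0" using off_Fq_exists by blast
  then obtain s where "s \<in> fibre x0" using card_fibre'[OF x0] by (metis card.empty ex_in_conv nat.distinct(1))
  thus ?thesis using fibre_emb[OF x0] by (intro exI[of _ "fibre_emb x0 s"]) simp
qed

lemma act_inv_aut: "s \<in> AutX \<Longrightarrow> r \<in> FF q lam \<Longrightarrow> act s i (inv_aut q lam s r) = i r"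
  by (simp add: act_FF Aut_in_FF[OF inv_in_Aut(1)] inv_in_Aut(2))

text \<open>If s^{-1}(x) were not in K(x), s^{-1}(y) would be; applying \<open>s\<close> would
  express y rationally through s(x) and put it into K(x). So s(x) is a rational function with a
  rational inverse.\<close>

lemma moebius_x_of_const:
  assumes s: "s \<in> AutX" and a: "s xf = [:a:]"
  obtains b \<alpha> \<beta> \<gamma> \<delta> where "inv_aut q lam s xf = [:b:]" "\<alpha> * \<delta> \<noteq> \<beta> * \<gamma>" "moebius_x \<alpha> \<beta> \<gamma> \<delta> s"
proof -
  obtain i where i: "emb i" "fls_deriv (i xf) = 1" using emb_exists_deriv by blast
  note j = emb_act[OF s i(1)]
  have A: "act s i xf = evf a (i xf)" "act s i xf = i [:a:]" by (simp_all add: act_xf a emb_const[OF i(1)])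
  have tA: "transc (act s i xf)" by (rule emb_transc[OF j])
  have r: "act s i [:b:] \<in> range (\<lambda>r. i [:r:])" for b
    unfolding emb_const[OF j] by (rule evf_in_consts[OF i(1) tA]) (use A in blast)
  have "\<not> (\<exists>b. inv_aut q lam s yf = [:b:])"
  proof
    assume "\<exists>b. inv_aut q lam s yf = [:b:]"
    hence "i yf \<in> range (\<lambda>r. i [:r:])" using act_inv_aut[OF s yf_in_FF, of i] r by metis
    thus False using yf_not_const_range[OF i(1)] by blast
  qed
  then obtain b where b: "inv_aut q lam s xf = [:b:]"
    using automorphism_dichotomy[OF inv_in_Aut(1)[OF s]] by blast
  have "evf b (act s i xf) = i xf"
    using act_inv_aut[OF s xf_in_FF, of i] unfolding b emb_const[OF j] .
  then obtain \<alpha> \<beta> \<gamma> \<delta> where m: "\<alpha> * \<delta> \<noteq> \<beta> * \<gamma>"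
    "act s i xf * (K \<gamma> * i xf + K \<delta>) = K \<alpha> * i xf + K \<beta>"
    using moebius_of_rational_inverse[OF emb_transc[OF i(1)] i(2) tA A(1)] by blast
  show ?thesis using that[OF b m(1)] moebius_xI[OF i(1), of s] m(2) by (simp add: act_xf)
qed

end

text \<open>Write [v, w] for the determinant of two vectors. The vector V = a2 [p, q] r + a1 [r, q]
  p has zero determinant with the basis s, t, so V = 0. Its determinant with q gives (a1 + a2)
  [p, q] [r, q] = 0, and V = 0 turns the vanishing of one factor into that of both.\<close>

lemma proportional_vectors:
  fixes a1 a2 p1 p2 q1 q2 r1 r2 s1 s2 t1 t2 :: "'b::field"
  assumes s: "a2 * (p1 * q2 - p2 * q1) * (r1 * s2 - r2 * s1) + a1 * (p1 * s2 - p2 * s1) * (r1 * q2 - r2 * q1) = 0"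
    and t: "a2 * (p1 * q2 - p2 * q1) * (r1 * t2 - r2 * t1) + a1 * (p1 * t2 - p2 * t1) * (r1 * q2 - r2 * q1) = 0"
    and st: "s1 * t2 \<noteq> s2 * t1" and a: "a1 \<noteq> 0" "a2 \<noteq> 0" "a1 + a2 \<noteq> 0"
    and p: "p1 \<noteq> 0 \<or> p2 \<noteq> 0" and r: "r1 \<noteq> 0 \<or> r2 \<noteq> 0"
  shows "p1 * q2 = p2 * q1 \<and> r1 * q2 = r2 * q1"
proof -
  define u where "u = p1 * q2 - p2 * q1"
  define w where "w = r1 * q2 - r2 * q1"
  define V1 where "V1 = a2 * u * r1 + a1 * w * p1"
  define V2 where "V2 = a2 * u * r2 + a1 * w * p2"
  have s': "V1 * s2 = V2 * s1" and t': "V1 * t2 = V2 * t1"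
    using s t unfolding V1_def V2_def u_def[symmetric] w_def[symmetric] by (simp_all add: algebra_simps)
  have "V1 * (s1 * t2 - s2 * t1) = s1 * (V1 * t2) - t1 * (V1 * s2)" by (simp add: algebra_simps)
  also have "\<dots> = 0" unfolding s' t' by (simp add: algebra_simps)
  finally have V1: "V1 = 0" using st by simp
  have "V2 * (s1 * t2 - s2 * t1) = t2 * (V2 * s1) - s2 * (V2 * t1)" by (simp add: algebra_simps)
  also have "\<dots> = 0" unfolding s'[symmetric] t'[symmetric] by (simp add: algebra_simps)
  finally have V2: "V2 = 0" using st by simp
  have "(a1 + a2) * u * w = V1 * q2 - V2 * q1"
    unfolding V1_def V2_def u_def w_def by (simp add: algebra_simps)
  hence "u = 0 \<or> w = 0" using V1 V2 a by simp
  hence "u = 0 \<and> w = 0"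
    using V1 V2 a p r unfolding V1_def V2_def by auto
  thus ?thesis by (simp add: u_def w_def)
qed

context curve
begin

section \<open>Pairs of Moebius transformations preserving the curve\<close>

lemma swap_involution:
  assumes P: "P \<in> AutX" "P xf = yf" "P yf = xf"
  shows "P \<circ> P = id"
proof -
  obtain i where i: "emb i" using emb_exists by blast
  show ?thesis by (rule Aut_eqI[OF comp_in_Aut[OF P(1) P(1)] id_in_Aut i]) (simp_all add: P)
qed

text \<open>Conjugate by the swap \<open>P\<close>. If the conjugate did not send x into K(x), it
  would send y there, so P(s(x)) would lie in K(x). As x is a rational function of s(x), P(x) = y
  would too.\<close>

lemma moebius_on_both_rulings:
  assumes s: "s \<in> AutX" and a: "s xf = [:a:]" and P: "P \<in> AutX" "P xf = yf" "P yf = xf"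
  shows "\<exists>\<alpha> \<beta> \<gamma> \<delta>. \<alpha> * \<delta> \<noteq> \<beta> * \<gamma> \<and> (\<forall>i. emb i \<longrightarrow>
     i (s yf) * (K \<gamma> * i yf + K \<delta>) = K \<alpha> * i yf + K \<beta>)"
proof -
  define s' where "s' = P \<circ> (s \<circ> P)"
  have s'A: "s' \<in> AutX" unfolding s'_def by (intro comp_in_Aut s P)
  have sF: "s xf \<in> FF q lam" "s yf \<in> FF q lam" using Aut_in_FF[OF s] xf_in_FF yf_in_FF by auto
  obtain b \<alpha> \<beta> \<gamma> \<delta> where b: "inv_aut q lam s xf = [:b:]" using moebius_x_of_const[OF s a] by blast
  have "\<not> (\<exists>r. s' yf = [:r:])"
  proof
    assume "\<exists>r. s' yf = [:r:]"
    then obtain r where r: "P (s xf) = [:r:]" by (auto simp: s'_def P)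
    obtain i where i: "emb i" using emb_exists by blast
    note j = emb_act[OF P(1) i]
    note k = emb_act[OF s j]
    have kx: "act s (act P i) xf = i [:r:]" by (simp add: act_xf act_FF sF r)
    have "i yf = act P i xf" by (simp add: act_xf P)
    also have "\<dots> = act s (act P i) [:b:]" using act_inv_aut[OF s xf_in_FF, of "act P i"] unfolding b ..
    also have "\<dots> = evf b (act s (act P i) xf)" by (rule emb_const[OF k])
    also have "\<dots> \<in> range (\<lambda>r. i [:r:])"
      by (rule evf_in_consts[OF i emb_transc[OF k]]) (simp add: kx)
    finally show False using yf_not_const_range[OF i] by blast
  qed
  then obtain r where r: "s' xf = [:r:]" using automorphism_dichotomy[OF s'A] by blast
  obtain c \<alpha> \<beta> \<gamma> \<delta> where "inv_aut q lam s' xf = [:c:]"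
    and m: "\<alpha> * \<delta> \<noteq> \<beta> * \<gamma>" "moebius_x \<alpha> \<beta> \<gamma> \<delta> s'"
    by (rule moebius_x_of_const[OF s'A r])
  have PP: "P (P t) = t" for t using swap_involution[OF P] by (metis comp_apply id_apply)
  have "i (s yf) * (K \<gamma> * i yf + K \<delta>) = K \<alpha> * i yf + K \<beta>" if i: "emb i" for i
  proof -
    have "act P i (s' xf) = i (s yf)"
      using Aut_in_FF[OF s'A xf_in_FF] by (simp add: act_FF) (simp add: s'_def P PP)
    moreover have "act P i xf = i yf" by (simp add: act_xf P)
    ultimately show ?thesis using m(2) emb_act[OF P(1) i] unfolding moebius_x_def by metis
  qed
  thus ?thesis using m(1) by blast
qed

lemma coeff_fibre_poly_q: "coeff (fibre_poly q l x) q = (1 + l) * x - 2 * x ^ q"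
  and coeff_fibre_poly_1: "coeff (fibre_poly q l x) 1 = (1 + l) * x ^ q - 2 * x"
  using q_gt_1 by (cases q; auto simp: fibre_poly_def coeff_pCons split: nat.splits)+

text \<open>A relation of degree at most q + 1 in y is a multiple of \<open>Fpol\<close>, so its
  coefficients are proportional to those of \<open>Fpol\<close>; the multiplier is eliminated in
  favour of \<open>g11\<close>.\<close>

lemma Fpol_relation:
  fixes g11 g10 g01 g00 :: "'a poly"
  assumes i: "emb i"
    and z: "evp g11 (i xf) * i yf ^ Suc q + evp g10 (i xf) * i yf ^ q + evp g01 (i xf) * i yf + evp g00 (i xf) = 0"
  shows "smult (1 - lam) g10 = g11 * (smult (1 + lam) [:0, 1:] - 2 * [:0, 1:] ^ q)"
    and "smult (1 - lam) g01 = g11 * (smult (1 + lam) ([:0, 1:] ^ q) - 2 * [:0, 1:])"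
    and "g00 = g11 * [:0, 1:] ^ Suc q"
proof -
  define R where "R = monom (tf g11) (Suc q) + monom (tf g10) q + [:tf g00, tf g01:]"
  have mon: "i (monom (tf g) n) = evp g (i xf) * i yf ^ n" for g n
  proof -
    have "monom (tf g) n = [:tf g:] * yf ^ n" by (simp add: monom_altdef yf_def)
    thus ?thesis by (simp only: emb_mult[OF i] emb_poly[OF i] emb_power[OF i])
  qed
  have "[:tf g00, tf g01:] = monom (tf g00) 0 + monom (tf g01) 1" by (simp add: monom_altdef)
  hence "i R = 0" unfolding R_def using z by (simp add: emb_add[OF i] mon add_ac)
  hence "Fpol dvd R" using emb_eq_0_iff[OF i] by blast
  moreover have "degree R \<le> Suc q" unfolding R_def
    using q_gt_1 by (intro degree_add_le) (auto intro: order.trans[OF degree_monom_le])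
  ultimately obtain e where e: "R = smult e Fpol" using dvd_Fpol_eq_smult by blast
  let ?L = "tf [:lam:]" and ?X = "tf [:0, 1:]"
  have "q = Suc (Suc (q - 2))" using q_gt_1 by simp
  then obtain q' where q': "q = Suc (Suc q')" by blast
  have c: "coeff R (Suc q) = tf g11" "coeff R q = tf g10" "coeff R 1 = tf g01" "coeff R 0 = tf g00"
    unfolding R_def q' by (auto simp: coeff_pCons)
  have F: "tf g11 = e * (1 - ?L)" "tf g10 = e * ((1 + ?L) * ?X - 2 * ?X ^ q)"
    "tf g01 = e * ((1 + ?L) * ?X ^ q - 2 * ?X)" "tf g00 = e * ((1 - ?L) * (?X * ?X ^ q))"
    unfolding c[symmetric] e Fpol_def coeff_smult coeff_fibre_poly_q coeff_fibre_poly_1 coeff_fibre_poly_0[OF q_gt_1] coeff_fibre_poly_top[OF q_gt_1]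
    by simp_all
  have tp: "tf a ^ n = tf (a ^ n)" for a :: "'a poly" and n by (induction n) (simp_all only: power_0 tf_1 power_Suc tf_mult)
  have t2: "2 = tf (2 :: 'a poly)" by (metis one_add_one tf_1 tf_add)
  have sm: "smult (1 - lam) g = (1 - [:lam:]) * g" "smult (1 + lam) g = (1 + [:lam:]) * g" for g
    by (simp_all add: smult_diff_left smult_add_left left_diff_distrib distrib_right)
  have "tf ((1 - [:lam:]) * g10) = tf (g11 * ((1 + [:lam:]) * [:0, 1:] - 2 * [:0, 1:] ^ q))"
    unfolding tf_mult tf_diff tf_add tp[symmetric] tf_1 t2[symmetric] F by (simp only: mult_ac)
  thus "smult (1 - lam) g10 = g11 * (smult (1 + lam) [:0, 1:] - 2 * [:0, 1:] ^ q)"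
    unfolding sm tf_eq_iff .
  have "tf ((1 - [:lam:]) * g01) = tf (g11 * ((1 + [:lam:]) * [:0, 1:] ^ q - 2 * [:0, 1:]))"
    unfolding tf_mult tf_diff tf_add tp[symmetric] tf_1 t2[symmetric] F by (simp only: mult_ac)
  thus "smult (1 - lam) g01 = g11 * (smult (1 + lam) ([:0, 1:] ^ q) - 2 * [:0, 1:])"
    unfolding sm tf_eq_iff .
  have "tf g00 = tf (g11 * [:0, 1:] ^ Suc q)"
    unfolding tf_mult tp[symmetric] F power_Suc by (simp only: mult_ac)
  thus "g00 = g11 * [:0, 1:] ^ Suc q" unfolding tf_eq_iff .
qed

definition lin_poly :: "'a \<Rightarrow> 'a \<Rightarrow> 'a poly" where "lin_poly a b = [:b, a:]"
definition frob_poly :: "'a \<Rightarrow> 'a \<Rightarrow> 'a poly" where "frob_poly a b = monom a q + [:b:]"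

text \<open>The coefficient of degree q + 1 and the values at 0 and 1 test the matrices at infinity,
  0 and 1, enough to determine a Moebius transformation.\<close>

lemma frob_lin_mult:
  "coeff (frob_poly a b * lin_poly c d) (Suc q) = a * c" "poly (frob_poly a b * lin_poly c d) 0 = b * d"
  "poly (frob_poly a b * lin_poly c d) 1 = (a + b) * (c + d)" "degree (frob_poly a b * lin_poly c d) \<le> Suc q"
proof -
  show "coeff (frob_poly a b * lin_poly c d) (Suc q) = a * c"
    using q_gt_1 by (simp add: lin_poly_def frob_poly_def coeff_pCons split: nat.splits)
  show "poly (frob_poly a b * lin_poly c d) 0 = b * d" "poly (frob_poly a b * lin_poly c d) 1 = (a + b) * (c + d)"
    using q_gt_1 by (simp_all add: lin_poly_def frob_poly_def poly_monom power_0_left algebra_simps)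
  have "degree (frob_poly a b) \<le> q" unfolding frob_poly_def by (intro degree_add_le) (auto simp: degree_monom_le)
  moreover have "degree (lin_poly c d) \<le> 1" by (simp add: lin_poly_def)
  ultimately show "degree (frob_poly a b * lin_poly c d) \<le> Suc q" using degree_mult_le[of "frob_poly a b" "lin_poly c d"] by linarith
qed

lemma evp_lin_poly: "evp (lin_poly a b) x = K a * x + K b"
  by (simp add: lin_poly_def evp_pCons mult.commute)

lemma evp_frob_poly: "evp (frob_poly (a ^ q) (b ^ q)) x = (K a * x + K b) ^ q"
proof -
  have "evp (monom (a ^ q) q) x = K (a ^ q) * x ^ q"
    by (simp add: monom_altdef evp_smult evp_power evp_X)
  thus ?thesis
    by (simp add: frob_poly_def evp_add evp_const frobenius_add power_mult_distrib fls_const_power)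
qed

text \<open>Let M, M' be the two matrices. Substituting them into the cross-ratio form gives a
  constant multiple of the equation. For a = infinity, 0, 1 the equation with x = x^q = y^q = a
  vanishes identically in y; by \<open>proportional_vectors\<close> the Frobenius twists of M and of
  M' both agree with M at a. Three points force M to equal both twists, so M has entries in F_q and
  M' = M.\<close>

lemma moebius_pair:
  fixes a b c d a' b' c' d' :: 'a
  assumes i: "emb i" and G: "G u v = 0"
    and u: "u * (K c * i xf + K d) = K a * i xf + K b"
    and v: "v * (K c' * i yf + K d') = K a' * i yf + K b'"
    and det: "a * d \<noteq> b * c" "a' * d' \<noteq> b' * c'"
    and nf: "(c = 0 \<and> d = 1) \<or> c = 1" "(c' = 0 \<and> d' = 1) \<or> c' = 1"
  shows "(a, b, c, d) = (a', b', c', d')" and "a \<in> Fq q" "b \<in> Fq q" "c \<in> Fq q" "d \<in> Fq q"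
proof -
  let ?a1 = "1 - lam" and ?a2 = "1 + lam"
  define P1 P2 Q1 Q2 where "P1 = frob_poly (a ^ q) (b ^ q)" and "P2 = frob_poly (c ^ q) (d ^ q)"
    and "Q1 = lin_poly a b" and "Q2 = lin_poly c d"
  \<comment> \<open>The left-hand side of \<open>T\<close> with constant vectors in place of those
    depending on y. It is linear in each of them, so \<open>T\<close> expands in y^q and y into the
    four values \<open>g11\<close>, \<open>g10\<close>, \<open>g01\<close>,
    \<open>g00\<close>.\<close>
  define g where "g r1 r2 s1 s2 = smult (?a2 * (r1 * s2 - r2 * s1)) (P1 * Q2 - P2 * Q1)
     + smult ?a1 (smult (s2 * r1) (P1 * Q2) - smult (s2 * r2) (P1 * Q1) - smult (s1 * r1) (P2 * Q2) + smult (s1 * r2) (P2 * Q1))"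
    for r1 r2 s1 s2
  define x y where "x = i xf" and "y = i yf"
  define p1 p2 q1 q2 where "p1 = evp P1 x" and "p2 = evp P2 x" and "q1 = evp Q1 x" and "q2 = evp Q2 x"
  define r1 r2 s1 s2 where "r1 = (K a' * y + K b') ^ q" and "r2 = (K c' * y + K d') ^ q"
    and "s1 = K a' * y + K b'" and "s2 = K c' * y + K d'"
  have pq: "p1 = q1 ^ q" "p2 = q2 ^ q" "r1 = s1 ^ q" "r2 = s2 ^ q"
    by (simp_all add: p1_def p2_def q1_def q2_def r1_def r2_def s1_def s2_def P1_def P2_def Q1_def Q2_def evp_lin_poly evp_frob_poly)
  have uq: "q1 = u * q2" "s1 = v * s2"
    using u v by (simp_all add: q1_def q2_def s1_def s2_def Q1_def Q2_def evp_lin_poly x_def y_def)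
  \<comment> \<open>The equation for (u, v) in homogeneous coordinates (q1 : q2) and (s1 : s2); p
    and r are their q-th powers.\<close>
  have "K ?a2 * (p1 * q2 - p2 * q1) * (r1 * s2 - r2 * s1) + K ?a1 * (p1 * s2 - p2 * s1) * (r1 * q2 - r2 * q1)
    = - (q2 ^ q * q2 * (s2 ^ q * s2) * G u v)"
    unfolding pq uq power_mult_distrib Gf_def fls_const_1_pm_lam[symmetric] by (simp add: algebra_simps)
  also have "\<dots> = 0" using G by simp
  finally have T: "K ?a2 * (p1 * q2 - p2 * q1) * (r1 * s2 - r2 * s1)
      + K ?a1 * (p1 * s2 - p2 * s1) * (r1 * q2 - r2 * q1) = 0" .
  have r: "r1 = K (a' ^ q) * y ^ q + K (b' ^ q)" "r2 = K (c' ^ q) * y ^ q + K (d' ^ q)"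
    by (simp_all add: r1_def r2_def frobenius_add power_mult_distrib fls_const_power)
  have eg: "evp (g k1 k2 l1 l2) x = K ?a2 * (K k1 * K l2 - K k2 * K l1) * (p1 * q2 - p2 * q1)
     + K ?a1 * (K l2 * K k1 * (p1 * q2) - K l2 * K k2 * (p1 * q1)
       - K l1 * K k1 * (p2 * q2) + K l1 * K k2 * (p2 * q1))" for k1 k2 l1 l2
    unfolding g_def p1_def p2_def q1_def q2_def
    by (simp only: evp_add evp_diff evp_smult evp_mult fls_const_mult_const[symmetric] fls_minus_const[symmetric])
  define g11 g10 g01 g00 where "g11 = g (a' ^ q) (c' ^ q) a' c'" and "g10 = g (a' ^ q) (c' ^ q) b' d'"
    and "g01 = g (b' ^ q) (d' ^ q) a' c'" and "g00 = g (b' ^ q) (d' ^ q) b' d'"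
  have "evp g11 x * y ^ Suc q + evp g10 x * y ^ q + evp g01 x * y + evp g00 x =
      K ?a2 * (p1 * q2 - p2 * q1) * (r1 * s2 - r2 * s1) + K ?a1 * (p1 * s2 - p2 * s1) * (r1 * q2 - r2 * q1)"
    unfolding g11_def g10_def g01_def g00_def eg r s1_def s2_def power_Suc by (simp only: algebra_simps)
  hence z: "evp g11 x * y ^ Suc q + evp g10 x * y ^ q + evp g01 x * y + evp g00 x = 0" using T by simp
  note rel = Fpol_relation[OF i z[unfolded x_def y_def]]
  have dg: "degree (g k1 k2 l1 l2) \<le> Suc q" for k1 k2 l1 l2
    unfolding g_def P1_def P2_def Q1_def Q2_def
    by (intro degree_add_le degree_diff_le order.trans[OF degree_smult_le] frob_lin_mult(4))
  \<comment> \<open>\<open>g00\<close> is \<open>g11\<close> times x^(q+1) and has degree at most q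
    + 1, so the multiplier is a constant.\<close>
  have "degree g11 = 0"
  proof (cases "g11 = 0")
    case False
    hence "degree g00 = degree g11 + Suc q"
      unfolding rel(3) by (subst degree_mult_eq) (auto simp: degree_power_eq simp del: power_Suc)
    thus ?thesis using dg unfolding g00_def by (metis add_le_same_cancel2 le_zero_eq)
  qed simp
  then obtain e where e: "g11 = [:e:]" by (auto elim: degree_eq_zeroE)
  have a1: "?a1 \<noteq> 0" and a2: "?a2 \<noteq> 0" and a12: "?a1 + ?a2 \<noteq> 0"
    using lam_neq_1 lam_neq_neg_1 by (auto simp: add_eq_0_iff)
  have ex: "smult ?a1 g10 = smult e (smult ?a2 [:0, 1:] - 2 * [:0, 1:] ^ q)"
    "smult ?a1 g01 = smult e (smult ?a2 ([:0, 1:] ^ q) - 2 * [:0, 1:])" "g00 = smult e ([:0, 1:] ^ Suc q)"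
    using rel unfolding e by simp_all
  have two: "(2 :: 'a poly) = [:2:]" by (simp add: numeral_poly)
  have z11: "coeff g11 (Suc q) = 0" by (simp add: e)
  have z10: "coeff g10 (Suc q) = 0"
  proof -
    have "degree (smult e (smult ?a2 [:0, 1:] - 2 * [:0, 1:] ^ q)) \<le> q"
      unfolding two using q_gt_1
      by (intro order.trans[OF degree_smult_le] degree_diff_le) (auto simp: degree_power_eq)
    hence "coeff (smult ?a1 g10) (Suc q) = 0" unfolding ex by (intro coeff_eq_0) simp
    thus ?thesis using a1 by simp
  qed
  have z01: "poly g01 0 = 0"
  proof -
    have "poly (smult ?a1 g01) 0 = 0" unfolding ex using q_gt_1 by (simp add: power_0_left)
    thus ?thesis using a1 by simp
  qed
  have z00: "poly g00 0 = 0" unfolding ex by simp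
  have s1': "poly g11 1 + poly g01 1 = 0"
  proof -
    have "?a1 * poly g01 1 = poly (smult ?a1 g01) 1" by simp
    also have "\<dots> = e * (?a2 - 2)" unfolding ex by simp
    also have "\<dots> = ?a1 * (- e)" by (simp add: algebra_simps)
    finally have "poly g01 1 = - e" using a1 by (metis mult_left_cancel)
    thus ?thesis by (simp add: e)
  qed
  have s2': "poly g10 1 + poly g00 1 = 0"
  proof -
    have "?a1 * poly g10 1 = poly (smult ?a1 g10) 1" by simp
    also have "\<dots> = e * (?a2 - 2)" unfolding ex by simp
    also have "\<dots> = ?a1 * (- e)" by (simp add: algebra_simps)
    finally have "poly g10 1 = - e" using a1 by (metis mult_left_cancel)
    moreover have "poly g00 1 = e" unfolding ex by simp
    ultimately show ?thesis by simp
  qed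
  have gtop: "coeff (g k1 k2 l1 l2) (Suc q) = ?a2 * (a ^ q * c - c ^ q * a) * (k1 * l2 - k2 * l1)
      + ?a1 * (a ^ q * l2 - c ^ q * l1) * (k1 * c - k2 * a)" for k1 k2 l1 l2
    unfolding g_def P1_def P2_def Q1_def Q2_def coeff_add coeff_diff coeff_smult frob_lin_mult
    by (simp add: algebra_simps)
  have g0: "poly (g k1 k2 l1 l2) 0 = ?a2 * (b ^ q * d - d ^ q * b) * (k1 * l2 - k2 * l1)
      + ?a1 * (b ^ q * l2 - d ^ q * l1) * (k1 * d - k2 * b)" for k1 k2 l1 l2
    unfolding g_def P1_def P2_def Q1_def Q2_def poly_add poly_diff poly_smult frob_lin_mult
    by (simp add: algebra_simps)
  have g1: "poly (g k1 k2 l1 l2) 1 = ?a2 * ((a ^ q + b ^ q) * (c + d) - (c ^ q + d ^ q) * (a + b)) * (k1 * l2 - k2 * l1)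
      + ?a1 * ((a ^ q + b ^ q) * l2 - (c ^ q + d ^ q) * l1) * (k1 * (c + d) - k2 * (a + b))" for k1 k2 l1 l2
    unfolding g_def P1_def P2_def Q1_def Q2_def poly_add poly_diff poly_smult frob_lin_mult
    by (simp add: algebra_simps)
  have st: "a' * d' \<noteq> c' * b'" using det(2) by (simp add: mult.commute)
  have E1: "a ^ q * c = c ^ q * a \<and> a' ^ q * c = c' ^ q * a"
    by (rule proportional_vectors[OF z11[unfolded g11_def gtop] z10[unfolded g10_def gtop] st a1 a2 a12])
       (use det in auto)
  have E2: "b ^ q * d = d ^ q * b \<and> b' ^ q * d = d' ^ q * b"
    by (rule proportional_vectors[OF z01[unfolded g01_def g0] z00[unfolded g00_def g0] st a1 a2 a12])
       (use det in auto)
  have nz: "a ^ q + b ^ q \<noteq> 0 \<or> c ^ q + d ^ q \<noteq> 0" if "a * d \<noteq> b * c" for a b c d :: 'a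
  proof -
    have "a + b \<noteq> 0 \<or> c + d \<noteq> 0"
    proof (rule ccontr)
      assume "\<not> (a + b \<noteq> 0 \<or> c + d \<noteq> 0)"
      hence "b = - a" "d = - c" by (auto simp: add_eq_0_iff)
      thus False using that by simp
    qed
    thus ?thesis using frobenius_add[of a b] frobenius_add[of c d] by (metis power_not_zero)
  qed
  have E3: "(a ^ q + b ^ q) * (c + d) = (c ^ q + d ^ q) * (a + b) \<and>
      (a' ^ q + b' ^ q) * (c + d) = (c' ^ q + d' ^ q) * (a + b)"
  proof (rule proportional_vectors[OF _ _ st a1 a2 a12 nz[OF det(1)] nz[OF det(2)]])
    show "?a2 * ((a ^ q + b ^ q) * (c + d) - (c ^ q + d ^ q) * (a + b)) * ((a' ^ q + b' ^ q) * c' - (c' ^ q + d' ^ q) * a')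
      + ?a1 * ((a ^ q + b ^ q) * c' - (c ^ q + d ^ q) * a') * ((a' ^ q + b' ^ q) * (c + d) - (c' ^ q + d' ^ q) * (a + b)) = 0"
      using s1' unfolding g11_def g01_def g1 by (simp only: algebra_simps)
    show "?a2 * ((a ^ q + b ^ q) * (c + d) - (c ^ q + d ^ q) * (a + b)) * ((a' ^ q + b' ^ q) * d' - (c' ^ q + d' ^ q) * b')
      + ?a1 * ((a ^ q + b ^ q) * d' - (c ^ q + d ^ q) * b') * ((a' ^ q + b' ^ q) * (c + d) - (c' ^ q + d' ^ q) * (a + b)) = 0"
      using s2' unfolding g10_def g00_def g1 by (simp only: algebra_simps)
  qed
  have frob_det: "a ^ q * d ^ q \<noteq> b ^ q * c ^ q" if "a * d \<noteq> b * c" for a b c d :: 'a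
    using that frobenius_eq_iff[of "a * d" "b * c"] by (simp add: power_mult_distrib)
  have frob_nf: "(c ^ q = 0 \<and> d ^ q = 1) \<or> c ^ q = 1" if "(c = 0 \<and> d = 1) \<or> c = 1" for c d :: 'a
    using that q_gt_1 by (auto simp: power_0_left)
  have M: "(a, b, c, d) = (a ^ q, b ^ q, c ^ q, d ^ q)"
    using E1 E2 E3 by (intro moebius_nf_unique[OF det(1) nf(1) frob_det[OF det(1)] frob_nf[OF nf(1)]])
      (auto simp: algebra_simps)
  have M': "(a, b, c, d) = (a' ^ q, b' ^ q, c' ^ q, d' ^ q)"
    using E1 E2 E3 by (intro moebius_nf_unique[OF det(1) nf(1) frob_det[OF det(2)] frob_nf[OF nf(2)]])
      (auto simp: algebra_simps)
  show "a \<in> Fq q" "b \<in> Fq q" "c \<in> Fq q" "d \<in> Fq q" using M by (auto simp: Fq_def)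
  show "(a, b, c, d) = (a', b', c', d')"
  proof -
    have "a ^ q = a' ^ q" "b ^ q = b' ^ q" "c ^ q = c' ^ q" "d ^ q = d' ^ q" using M M' by auto
    thus ?thesis using frobenius_eq_iff[where ?'b = 'a] by simp
  qed
qed

lemma normalize_moebius:
  fixes \<alpha> \<beta> \<gamma> \<delta> :: 'a
  assumes "\<alpha> * \<delta> \<noteq> \<beta> * \<gamma>"
  obtains k where "k * \<alpha> * (k * \<delta>) \<noteq> k * \<beta> * (k * \<gamma>)" "(k * \<gamma> = 0 \<and> k * \<delta> = 1) \<or> k * \<gamma> = 1"
proof (cases "\<gamma> = 0")
  case True
  hence "\<delta> \<noteq> 0" using assms by auto
  thus ?thesis using True assms by (intro that[of "1 / \<delta>"]) (auto simp: field_simps)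
next
  case False
  thus ?thesis using assms by (intro that[of "1 / \<gamma>"]) (auto simp: field_simps)
qed

lemma const_imp_Hgrp:
  assumes s: "s \<in> AutX" and a: "s xf = [:a:]" and P: "P \<in> AutX" "P xf = yf" "P yf = xf"
  shows "s \<in> Hgrp q lam"
proof -
  obtain b \<alpha> \<beta> \<gamma> \<delta> where "inv_aut q lam s xf = [:b:]"
    and x: "\<alpha> * \<delta> \<noteq> \<beta> * \<gamma>" "moebius_x \<alpha> \<beta> \<gamma> \<delta> s"
    by (rule moebius_x_of_const[OF s a])
  obtain \<alpha>' \<beta>' \<gamma>' \<delta>' where y: "\<alpha>' * \<delta>' \<noteq> \<beta>' * \<gamma>'" "\<And>i. emb i \<Longrightarrow>
     i (s yf) * (K \<gamma>' * i yf + K \<delta>') = K \<alpha>' * i yf + K \<beta>'"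
    using moebius_on_both_rulings[OF s a P] by blast
  obtain k where k: "k * \<alpha> * (k * \<delta>) \<noteq> k * \<beta> * (k * \<gamma>)" "(k * \<gamma> = 0 \<and> k * \<delta> = 1) \<or> k * \<gamma> = 1"
    using normalize_moebius[OF x(1)] by blast
  obtain k' where k': "k' * \<alpha>' * (k' * \<delta>') \<noteq> k' * \<beta>' * (k' * \<gamma>')" "(k' * \<gamma>' = 0 \<and> k' * \<delta>' = 1) \<or> k' * \<gamma>' = 1"
    using normalize_moebius[OF y(1)] by blast
  have ex: "i (s xf) * (K (k * \<gamma>) * i xf + K (k * \<delta>)) = K (k * \<alpha>) * i xf + K (k * \<beta>)"
    and ey: "i (s yf) * (K (k' * \<gamma>') * i yf + K (k' * \<delta>')) = K (k' * \<alpha>') * i yf + K (k' * \<beta>')"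
    if i: "emb i" for i
    using x(2) y(2) i unfolding moebius_x_def by (blast intro: scale_moebius_eq)+
  obtain i where i: "emb i" using emb_exists by blast
  have G: "G (i (s xf)) (i (s yf)) = 0" using emb_G[OF emb_act[OF s i]] by (simp add: act_xf act_yf)
  note pair = moebius_pair[OF i G ex[OF i] ey[OF i] k(1) k'(1) k(2) k'(2)]
  have "moebius_type (k * \<alpha>) (k * \<beta>) (k * \<gamma>) (k * \<delta>) s"
    unfolding moebius_type_def using ex ey pair(1) by (metis prod.inject)
  hence "in_PGL s" using pair(2-5) k(1) by (intro in_PGLI)
  thus ?thesis using in_PGL_imp_Hgrp s by blast
qed

lemma swap_commutes:
  assumes P: "P \<in> AutX" "P xf = yf" "P yf = xf" and h: "h \<in> Hgrp q lam"
  shows "h \<circ> P = P \<circ> h"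
proof -
  obtain a b c d where hA: "h \<in> AutX" and m: "a * d \<noteq> b * c" "moebius_type a b c d h"
    using Hgrp_in_PGL[OF h] unfolding in_PGL_def by blast
  obtain i where i: "emb i" using emb_exists by blast
  note j = emb_act[OF P(1) i]
  have cd: "c \<noteq> 0 \<or> d \<noteq> 0" using m by auto
  have hF: "h xf \<in> FF q lam" "h yf \<in> FF q lam" using Aut_in_FF[OF hA] xf_in_FF yf_in_FF by auto
  have jx: "act P i xf = i yf" "act P i yf = i xf" by (simp_all add: act_xf act_yf P)
  have jh: "act P i (h xf) = i (P (h xf))" "act P i (h yf) = i (P (h yf))" by (simp_all add: act_FF hF)
  have "i (P (h xf)) * (K c * i yf + K d) = i (h yf) * (K c * i yf + K d)"
    "i (P (h yf)) * (K c * i xf + K d) = i (h xf) * (K c * i xf + K d)"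
    using m(2) i j jx jh unfolding moebius_type_def by metis+
  hence "i (P (h xf)) = i (h yf)" "i (P (h yf)) = i (h xf)"
    using linear_nonzero[OF emb_transc[OF i] cd] linear_nonzero[OF emb_transc_y[OF i] cd] by simp_all
  thus ?thesis by (intro Aut_eqI[OF comp_in_Aut[OF hA P(1)] comp_in_Aut[OF P(1) hA] i]) (simp_all add: P)
qed

text \<open>Otherwise y would be a fractional linear function of x.\<close>

lemma swap_notin_Hgrp:
  assumes P: "P xf = yf"
  shows "P \<notin> Hgrp q lam"
proof
  assume "P \<in> Hgrp q lam"
  then obtain a b c d where cd: "a * d \<noteq> b * c" and m: "moebius_type a b c d P"
    using Hgrp_in_PGL unfolding in_PGL_def by blast
  obtain i where i: "emb i" using emb_exists by blast
  have "c \<noteq> 0 \<or> d \<noteq> 0" using cd by auto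
  hence nz: "K c * i xf + K d \<noteq> 0" by (rule linear_nonzero[OF emb_transc[OF i]])
  have "i yf * (K c * i xf + K d) = K a * i xf + K b"
    using m i P unfolding moebius_type_def by metis
  hence "i yf = (K a * i xf + K b) / (K c * i xf + K d)"
    using nz by (simp add: field_simps)
  also have "\<dots> = evf (Fract [:b, a:] [:d, c:]) (i xf)"
    using cd emb_transc[OF i] by (subst evf_Fract) (auto simp: evp_pCons algebra_simps)
  also have "\<dots> = i [:Fract [:b, a:] [:d, c:]:]" by (rule emb_const[OF i, symmetric])
  finally show False using yf_not_const_range[OF i] by blast
qed

theorem automorphism_group:
  "Hgrp q lam \<subseteq> Aut q lam \<and>
    (\<exists>\<Phi>\<in>Aut q lam. \<Phi> xf = yf \<and> \<Phi> yf = xf \<and> \<Phi> \<circ> \<Phi> = id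
      \<and> \<Phi> \<notin> Hgrp q lam
      \<and> (\<forall>h\<in>Hgrp q lam. h \<circ> \<Phi> = \<Phi> \<circ> h)
      \<and> Aut q lam = Hgrp q lam \<union> (\<lambda>h. h \<circ> \<Phi>) ` Hgrp q lam)
    \<and> finite (Aut q lam) \<and> card (Aut q lam) = 2 * (q ^ 3 - q)"
proof -
  have H: "Hgrp q lam \<subseteq> AutX" using Hgrp_in_PGL by blast
  obtain P where P: "P \<in> AutX" "P xf = yf" "P yf = xf" using exists_swap by blast
  have PP: "P \<circ> P = id" by (rule swap_involution[OF P])
  have n: "P \<notin> Hgrp q lam" by (rule swap_notin_Hgrp[of P, OF P(2)])
  let ?c = "\<lambda>h. h \<circ> P"
  have cc: "?c (?c h) = h" for h using PP by (simp add: comp_assoc)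
  have A: "AutX = Hgrp q lam \<union> ?c ` Hgrp q lam"
  proof
    show "Hgrp q lam \<union> ?c ` Hgrp q lam \<subseteq> AutX" using H comp_in_Aut[OF _ P(1)] by blast
    show "AutX \<subseteq> Hgrp q lam \<union> ?c ` Hgrp q lam"
    proof
      fix s assume s: "s \<in> AutX"
      show "s \<in> Hgrp q lam \<union> ?c ` Hgrp q lam"
      proof (cases "\<exists>a. s xf = [:a:]")
        case True thus ?thesis using const_imp_Hgrp[OF s _ P] by blast
      next
        case False
        \<comment> \<open>Otherwise s(y) lies in K(x), and composing with the swap moves it to the
          first coordinate.\<close>
        then obtain a where "(?c s) xf = [:a:]" using automorphism_dichotomy[OF s] P by auto
        hence "?c s \<in> Hgrp q lam" using const_imp_Hgrp[OF comp_in_Aut[OF s P(1)] _ P] by blast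
        hence "?c (?c s) \<in> ?c ` Hgrp q lam" by blast
        thus ?thesis unfolding cc by blast
      qed
    qed
  qed
  have inj: "inj_on ?c (Hgrp q lam)" by (rule inj_on_inverseI[where g = ?c]) (rule cc)
  have disj: "Hgrp q lam \<inter> ?c ` Hgrp q lam = {}"
  proof (rule ccontr)
    assume "Hgrp q lam \<inter> ?c ` Hgrp q lam \<noteq> {}"
    then obtain h where h: "h \<in> Hgrp q lam" "h \<circ> P \<in> Hgrp q lam" by blast
    have hA: "h \<in> AutX" "h \<circ> P \<in> AutX" using h H by auto
    note g = Hgrp_in_PGL[OF h(1)] Hgrp_in_PGL[OF h(2)]
    \<comment> \<open>The inductive definition of \<open>Hgrp\<close> only multiplies by generators
      and their inverses on the left; general products and inverses are formed in
      \<open>in_PGL\<close>.\<close>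
    have "in_PGL (inv_aut q lam h \<circ> (h \<circ> P))"
      using g by (intro in_PGL_comp[OF inv_in_Aut(1)[OF hA(1)] in_PGL_inv hA(2)]) auto
    moreover have "inv_aut q lam h \<circ> (h \<circ> P) = P"
    proof
      fix r
      show "(inv_aut q lam h \<circ> (h \<circ> P)) r = P r"
        using inv_in_Aut(3)[OF hA(1)] Aut_in_FF[OF P(1)] AutD(5)[OF P(1)] AutD(5)[OF hA(1)]
          AutD(5)[OF inv_in_Aut(1)[OF hA(1)]] by (cases "r \<in> FF q lam") simp_all
    qed
    ultimately have "P \<in> Hgrp q lam" using in_PGL_imp_Hgrp[OF P(1)] by simp
    thus False using n by blast
  qed
  have fin: "finite AutX" unfolding A using card_Hgrp(1) by simp
  have "card AutX = card (Hgrp q lam) + card (?c ` Hgrp q lam)"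
    unfolding A using card_Hgrp(1) disj by (intro card_Un_disjoint) auto
  also have "\<dots> = 2 * (q ^ 3 - q)" using card_image[OF inj] card_Hgrp(2) by simp
  finally have "card AutX = 2 * (q ^ 3 - q)" .
  thus ?thesis using H P PP n A fin swap_commutes[OF P] by blast
qed

end

theorem mainTheorem19:
  fixes p q :: nat and lam :: "'a::field"
  assumes "prime p" and "odd p" and "\<exists>k>0. q = p ^ k" and "q > 3"
    and "CHAR('a) = p"
    and "\<forall>P :: 'a poly. degree P > 0 \<longrightarrow> (\<exists>z. poly P z = 0)"
    and "\<forall>a :: 'a. \<exists>n>0. a ^ (p ^ n) = a"
    and "lam \<noteq> 1" and "lam \<noteq> -1"
  shows "Hgrp q lam \<subseteq> Aut q lam \<and>
    (\<exists>\<Phi>\<in>Aut q lam. \<Phi> xf = yf \<and> \<Phi> yf = xf \<and> \<Phi> \<circ> \<Phi> = id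
      \<and> \<Phi> \<notin> Hgrp q lam
      \<and> (\<forall>h\<in>Hgrp q lam. h \<circ> \<Phi> = \<Phi> \<circ> h)
      \<and> Aut q lam = Hgrp q lam \<union> (\<lambda>h. h \<circ> \<Phi>) ` Hgrp q lam)
    \<and> finite (Aut q lam) \<and> card (Aut q lam) = 2 * (q ^ 3 - q)"
proof -
  interpret curve q lam
    using assms by unfold_locales auto
  show ?thesis by (rule automorphism_group)
qed

end
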